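(* For every $n\geq 1$, the map $\Phi=\gamma\circ\phi$ is a bijection from $\mathcal{I}_n$ onto $\mathcal{B}_n$.
   Context: A binary tree is either a single leaf or a node with an ordered pair (left, right) of binary subtrees; its size is its number of nodes and $\mathcal{T}_n$ is the set of binary trees of size $n$. A right rotation replaces a subtree of the form $((A,B),C)$ by $(A,(B,C))$; the Tamari order $\le$ on $\mathcal{T}_n$ is the reflexive-transitive closure of the relation "$T'$ is obtained from $T$ by one right rotation". $\mathcal{I}_n=\{(T,T')\in\mathcal{T}_n\times\mathcal{T}_n : T\le T'\}$ is the set of Tamari intervals of size $n$. For $T\in\mathcal{T}_n$, label its nodes $v_1,\dots,v_n$ in infix (in-order) order and let $a_t(T)$ (resp. $b_t(T)$) be the number of nodes in the right (resp. left) subtree of $v_t$. For $(T,T')\in\mathcal{T}_n\times\mathcal{T}_n$, $\phi(T,T')$ is the arc-diagram on the points $0,\tfrac12,1,\dots,n-\tfrac12,n$ of the horizontal axis (integer points black, half-integer points white) having, for each $t\in[n]$, an upper arc (semicircle in the upper half-plane) joining the white point $t-\tfrac12$ to the black point $t-1-b_t(T')$, and a lower arc (semicircle in the lower half-plane) joining $t-\tfrac12$ to the black point $t+a_t(T)$. A meandering diagram of size $n$ is a non-crossing arc-diagram on these $2n+1$ points with all arcs in the upper or lower half-plane, every upper arc having a black left end and a white right end, every lower arc having a white left end and a black right end, and every white point incident to exactly one upper and one lower arc. Its underlying graph has the black points as vertices and, for each white point, an edge joining the black ends of its upper and lower arcs. A meandering tree is a meandering diagram whose underlying graph is a tree. A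 blossoming tree is an unrooted plane tree with at least two nodes (vertices of degree $\ge 2$) in which every node is adjacent to exactly two leaves; edges to leaves are buds, other edges are plain edges; its size is its number of plain edges. It is bicolored if each half-edge of each plain edge is colored red or blue, no plain edge is monochromatic, and at every node the two buds separate the incident half-edges of plain edges into a group of blue ones and a group of red ones (one group possibly empty). $\mathcal{B}_n$ is the set of bicolored blossoming trees of size $n$. For a meandering tree $M$ of size $n$, $\gamma(M)$ is the plane tree obtained from the drawing of $M$: its vertices are the black points; for each white point $w$, the union of the upper and lower arcs at $w$ is a plain edge joining their black ends, its half-edge containing the upper arc colored blue and the one containing the lower arc colored red; and at each black point two buds are attached, one pointing left and one pointing right along the axis; the plane embedding is inherited from the drawing. *)

theory Defs
  imports Complex_Main "HOL-Library.Tree" "HOL-Combinatorics.Combinatorics"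
begin

section \<open>Binary trees and Tamari intervals\<close>

text \<open>The library function \<^const>\<open>size\<close> on \<^typ>\<open>unit tree\<close> counts the (inner) nodes.\<close>

type_synonym bintree = "unit tree"

definition binary_trees :: "nat \<Rightarrow> bintree set" where
  "binary_trees n = {T. size T = n}"

inductive right_rotation :: "bintree \<Rightarrow> bintree \<Rightarrow> bool" where
  here: "right_rotation (Node (Node A () B) () C) (Node A () (Node B () C))"
| in_left: "right_rotation A A' \<Longrightarrow> right_rotation (Node A () B) (Node A' () B)"
| in_right: "right_rotation B B' \<Longrightarrow> right_rotation (Node A () B) (Node A () B')"

definition tamari_le :: "bintree \<Rightarrow> bintree \<Rightarrow> bool" where
  "tamari_le = right_rotation\<^sup>*\<^sup>*"

definition tamari_intervals :: "nat \<Rightarrow> (bintree \<times> bintree) set" where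
  "tamari_intervals n =
     {(T, T'). T \<in> binary_trees n \<and> T' \<in> binary_trees n \<and> tamari_le T T'}"

text \<open>The list of the subtrees rooted at \<open>v\<^sub>1, \<dots>, v\<^sub>n\<close>, the nodes in infix order.\<close>

fun infix_subtrees :: "bintree \<Rightarrow> bintree list" where
  "infix_subtrees Leaf = []"
| "infix_subtrees (Node A x B) = infix_subtrees A @ Node A x B # infix_subtrees B"

definition right_size :: "bintree \<Rightarrow> nat \<Rightarrow> nat" where
  "right_size T t = size (right (infix_subtrees T ! (t - 1)))"

definition left_size :: "bintree \<Rightarrow> nat \<Rightarrow> nat" where
  "left_size T t = size (left (infix_subtrees T ! (t - 1)))"


section \<open>Multigraphs that are trees\<close>

text \<open>
  A multigraph has vertex set \<open>V\<close>, edge set \<open>E\<close> and a map sending each edge to its set of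
  ends (a singleton for a loop).  A cycle passes through the distinct vertices
  \<open>vs ! 0, vs ! 1, \<dots>\<close>, using the distinct edges \<open>es ! i\<close> from \<open>vs ! i\<close> to the cyclically next
  vertex; loops and pairs of parallel edges are cycles of length 1 and 2.
\<close>

definition is_cycle :: "'e set \<Rightarrow> ('e \<Rightarrow> 'v set) \<Rightarrow> 'v list \<Rightarrow> 'e list \<Rightarrow> bool" where
  "is_cycle E ends vs es \<longleftrightarrow>
     es \<noteq> [] \<and> length vs = length es \<and> distinct vs \<and> distinct es \<and> set es \<subseteq> E \<and>
     (\<forall>i < length es. ends (es ! i) = {vs ! i, vs ! (Suc i mod length es)})"

definition is_tree :: "'v set \<Rightarrow> 'e set \<Rightarrow> ('e \<Rightarrow> 'v set) \<Rightarrow> bool" where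
  "is_tree V E ends \<longleftrightarrow>
     finite V \<and> finite E \<and> V \<noteq> {} \<and>
     (\<forall>e\<in>E. \<exists>u\<in>V. \<exists>v\<in>V. ends e = {u, v}) \<and>
     (\<forall>u\<in>V. \<forall>v\<in>V. (u, v) \<in> {(x, y). \<exists>e\<in>E. ends e = {x, y}}\<^sup>*) \<and>
     (\<nexists>vs es. is_cycle E ends vs es)"


section \<open>Arc-diagrams and meandering trees\<close>

text \<open>
  Points of the horizontal axis are real numbers, points of the plane are complex numbers.
  An arc is given as the pair (left end, right end).
\<close>

record arc_diagram =
  diagram_size :: nat
  upper_arcs :: "(real \<times> real) set"
  lower_arcs :: "(real \<times> real) set"

definition black_points :: "nat \<Rightarrow> real set" where
  "black_points n = real ` {0..n}"

definition white_points :: "nat \<Rightarrow> real set" where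
  "white_points n = (\<lambda>t. real t - 1/2) ` {1..n}"

text \<open>Semicircles without their two ends.\<close>

definition upper_semicircle :: "real \<times> real \<Rightarrow> complex set" where
  "upper_semicircle = (\<lambda>(x, y).
     {z. Im z > 0 \<and> cmod (z - complex_of_real ((x + y) / 2)) = (y - x) / 2})"

definition lower_semicircle :: "real \<times> real \<Rightarrow> complex set" where
  "lower_semicircle = (\<lambda>(x, y).
     {z. Im z < 0 \<and> cmod (z - complex_of_real ((x + y) / 2)) = (y - x) / 2})"

definition non_crossing :: "arc_diagram \<Rightarrow> bool" where
  "non_crossing M \<longleftrightarrow>
     pairwise (\<lambda>a b. disjnt (upper_semicircle a) (upper_semicircle b)) (upper_arcs M) \<and>
     pairwise (\<lambda>a b. disjnt (lower_semicircle a) (lower_semicircle b)) (lower_arcs M)"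

definition meandering_diagram :: "nat \<Rightarrow> arc_diagram \<Rightarrow> bool" where
  "meandering_diagram n M \<longleftrightarrow>
     diagram_size M = n \<and>
     (\<forall>(x, y)\<in>upper_arcs M. x \<in> black_points n \<and> y \<in> white_points n \<and> x < y) \<and>
     (\<forall>(x, y)\<in>lower_arcs M. x \<in> white_points n \<and> y \<in> black_points n \<and> x < y) \<and>
     (\<forall>w\<in>white_points n. (\<exists>!x. (x, w) \<in> upper_arcs M) \<and> (\<exists>!y. (w, y) \<in> lower_arcs M)) \<and>
     non_crossing M"

text \<open>Ends of the edge of the underlying graph that corresponds to the white point \<open>w\<close>.\<close>

definition underlying_ends :: "arc_diagram \<Rightarrow> real \<Rightarrow> real set" where
  "underlying_ends M w = {x. (x, w) \<in> upper_arcs M} \<union> {y. (w, y) \<in> lower_arcs M}"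

definition meandering_trees :: "nat \<Rightarrow> arc_diagram set" where
  "meandering_trees n =
     {M. meandering_diagram n M \<and>
         is_tree (black_points n) (white_points n) (underlying_ends M)}"

definition phi :: "bintree \<times> bintree \<Rightarrow> arc_diagram" where
  "phi = (\<lambda>(T, T').
     \<lparr> diagram_size = size T,
       upper_arcs = (\<lambda>t. (real t - 1 - real (left_size T' t), real t - 1/2)) ` {1..size T},
       lower_arcs = (\<lambda>t. (real t - 1/2, real t + real (right_size T t))) ` {1..size T} \<rparr>)"


section \<open>Plane trees with colored half-edges\<close>

datatype color = Red | Blue

text \<open>
  A plane tree with at least one edge is encoded by its half-edges: \<open>rot\<close> maps a half-edge to
  the next one in counterclockwise order around its vertex, and \<open>opp\<close> maps it to the other
  half of its edge.  Vertices are the orbits of \<open>rot\<close>.  Since the underlying graph is a tree,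
  every such rotation system is planar.
  Unrooted plane trees are isomorphism classes of these structures; every class has
  representatives whose half-edges are natural numbers, and it is identified with the set of
  these representatives.  The value \<^const>\<open>None\<close> means an uncolored half-edge.
\<close>

record 'h half_edge_map =
  half_edges :: "'h set"
  rot :: "'h \<Rightarrow> 'h"
  opp :: "'h \<Rightarrow> 'h"
  half_color :: "'h \<Rightarrow> color option"

definition map_iso :: "'g half_edge_map \<Rightarrow> 'h half_edge_map \<Rightarrow> bool" where
  "map_iso X Y \<longleftrightarrow>
     (\<exists>f. bij_betw f (half_edges X) (half_edges Y) \<and>
          (\<forall>h\<in>half_edges X. f (rot X h) = rot Y (f h) \<and> f (opp X h) = opp Y (f h) \<and>
                              half_color Y (f h) = half_color X h))"

type_synonym unrooted_plane_tree = "nat half_edge_map set"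

definition iso_class :: "'h half_edge_map \<Rightarrow> unrooted_plane_tree" where
  "iso_class X = {Y. map_iso X Y}"

definition vertex_of :: "'h half_edge_map \<Rightarrow> 'h \<Rightarrow> 'h set" where
  "vertex_of X h = orbit (rot X) h"

definition vertices :: "'h half_edge_map \<Rightarrow> 'h set set" where
  "vertices X = vertex_of X ` half_edges X"

definition edges :: "'h half_edge_map \<Rightarrow> 'h set set" where
  "edges X = (\<lambda>h. {h, opp X h}) ` half_edges X"

definition edge_ends :: "'h half_edge_map \<Rightarrow> 'h set \<Rightarrow> 'h set set" where
  "edge_ends X e = vertex_of X ` e"

definition plane_tree :: "'h half_edge_map \<Rightarrow> bool" where
  "plane_tree X \<longleftrightarrow>
     finite (half_edges X) \<and>
     bij_betw (rot X) (half_edges X) (half_edges X) \<and>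
     (\<forall>h\<in>half_edges X. opp X h \<in> half_edges X \<and> opp X h \<noteq> h \<and> opp X (opp X h) = h) \<and>
     is_tree (vertices X) (edges X) (edge_ends X)"

text \<open>A vertex is the set of its incident half-edges, so its degree is its cardinality.\<close>

definition nodes :: "'h half_edge_map \<Rightarrow> 'h set set" where
  "nodes X = {v \<in> vertices X. card v \<ge> 2}"

definition leaves :: "'h half_edge_map \<Rightarrow> 'h set set" where
  "leaves X = {v \<in> vertices X. card v = 1}"

definition plain_edges :: "'h half_edge_map \<Rightarrow> 'h set set" where
  "plain_edges X = {e \<in> edges X. edge_ends X e \<inter> leaves X = {}}"

definition bud_edges :: "'h half_edge_map \<Rightarrow> 'h set set" where
  "bud_edges X = {e \<in> edges X. edge_ends X e \<inter> leaves X \<noteq> {}}"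

definition blossoming_tree :: "'h half_edge_map \<Rightarrow> bool" where
  "blossoming_tree X \<longleftrightarrow>
     plane_tree X \<and> card (nodes X) \<ge> 2 \<and>
     (\<forall>v\<in>nodes X. card {l \<in> leaves X. \<exists>e\<in>edges X. edge_ends X e = {v, l}} = 2)"

text \<open>
  Turning counterclockwise around the node \<open>v\<close>, starting just after one of its two buds, one
  meets only blue half-edges until the other bud, and then only red ones.
\<close>

definition buds_separate_colors :: "'h half_edge_map \<Rightarrow> 'h set \<Rightarrow> bool" where
  "buds_separate_colors X v \<longleftrightarrow>
     (\<exists>p\<in>v. \<exists>k. 0 < k \<and> k < card v \<and>
        p \<in> \<Union> (bud_edges X) \<and> (rot X ^^ k) p \<in> \<Union> (bud_edges X) \<and>
        (\<forall>i. 0 < i \<and> i < k \<longrightarrow> half_color X ((rot X ^^ i) p) = Some Blue) \<and>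
        (\<forall>i. k < i \<and> i < card v \<longrightarrow> half_color X ((rot X ^^ i) p) = Some Red))"

definition bicolored :: "'h half_edge_map \<Rightarrow> bool" where
  "bicolored X \<longleftrightarrow>
     (\<forall>h\<in>half_edges X. half_color X h \<noteq> None \<longleftrightarrow> h \<in> \<Union> (plain_edges X)) \<and>
     (\<forall>h\<in>\<Union> (plain_edges X). half_color X h \<noteq> half_color X (opp X h)) \<and>
     (\<forall>v\<in>nodes X. buds_separate_colors X v)"

definition bicolored_blossoming_trees :: "nat \<Rightarrow> unrooted_plane_tree set" where
  "bicolored_blossoming_trees n =
     iso_class ` {X :: nat half_edge_map.
       blossoming_tree X \<and> bicolored X \<and> card (plain_edges X) = n}"


section \<open>From meandering trees to plane trees\<close>

text \<open>
  Half-edges of the plane tree of a diagram: for a white point \<open>w\<close>, those containing the upper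
  and the lower arc at \<open>w\<close>; for a black point \<open>b\<close>, the two halves of its left-pointing bud and
  of its right-pointing bud, the first one at \<open>b\<close> and the second one at the leaf.
\<close>

datatype diagram_half_edge =
    Upper_half real | Lower_half real
  | Left_bud real | Left_bud_tip real
  | Right_bud real | Right_bud_tip real

text \<open>
  The half-edges around a black point \<open>b\<close> in the drawing, counterclockwise from the
  right-pointing bud.  In a meandering diagram the upper arcs at \<open>b\<close> leave \<open>b\<close> to the right;
  all are vertical at \<open>b\<close>, and the smaller ones bend away first, so counterclockwise they come
  by increasing white end.  The lower arcs at \<open>b\<close> leave \<open>b\<close> to the left and come, after the
  left-pointing bud, again from the smallest to the largest, i.e. by decreasing white end.
\<close>

definition half_edges_around :: "arc_diagram \<Rightarrow> real \<Rightarrow> diagram_half_edge list" where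
  "half_edges_around M b =
     Right_bud b # map Upper_half (sorted_list_of_set {w. (b, w) \<in> upper_arcs M}) @
     Left_bud b # map Lower_half (rev (sorted_list_of_set {w. (w, b) \<in> lower_arcs M}))"

fun gamma_rot :: "arc_diagram \<Rightarrow> diagram_half_edge \<Rightarrow> diagram_half_edge" where
  "gamma_rot M (Upper_half w) =
     cycle_of_list (half_edges_around M (THE b. (b, w) \<in> upper_arcs M)) (Upper_half w)"
| "gamma_rot M (Lower_half w) =
     cycle_of_list (half_edges_around M (THE b. (w, b) \<in> lower_arcs M)) (Lower_half w)"
| "gamma_rot M (Left_bud b) = cycle_of_list (half_edges_around M b) (Left_bud b)"
| "gamma_rot M (Right_bud b) = cycle_of_list (half_edges_around M b) (Right_bud b)"
| "gamma_rot M (Left_bud_tip b) = Left_bud_tip b"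
| "gamma_rot M (Right_bud_tip b) = Right_bud_tip b"

fun gamma_opp :: "diagram_half_edge \<Rightarrow> diagram_half_edge" where
  "gamma_opp (Upper_half w) = Lower_half w"
| "gamma_opp (Lower_half w) = Upper_half w"
| "gamma_opp (Left_bud b) = Left_bud_tip b"
| "gamma_opp (Left_bud_tip b) = Left_bud b"
| "gamma_opp (Right_bud b) = Right_bud_tip b"
| "gamma_opp (Right_bud_tip b) = Right_bud b"

fun gamma_color :: "diagram_half_edge \<Rightarrow> color option" where
  "gamma_color (Upper_half w) = Some Blue"
| "gamma_color (Lower_half w) = Some Red"
| "gamma_color _ = None"

definition gamma_map :: "arc_diagram \<Rightarrow> diagram_half_edge half_edge_map" where
  "gamma_map M =
     \<lparr> half_edges =
         (\<Union>w\<in>white_points (diagram_size M). {Upper_half w, Lower_half w}) \<union>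
         (\<Union>b\<in>black_points (diagram_size M).
            {Left_bud b, Left_bud_tip b, Right_bud b, Right_bud_tip b}),
       rot = gamma_rot M,
       opp = gamma_opp,
       half_color = gamma_color \<rparr>"

definition gamma :: "arc_diagram \<Rightarrow> unrooted_plane_tree" where
  "gamma M = iso_class (gamma_map M)"

definition Phi :: "bintree \<times> bintree \<Rightarrow> unrooted_plane_tree" where
  "Phi = gamma \<circ> phi"

end

theory Submission
  imports Defs
begin

text \<open>
  Number the black points 0, ..., \<open>n\<close> and the white points 1, ..., \<open>n\<close>.  A pair of binary trees is
  the same as a pair of non-crossing families of upper and lower arcs, and \<open>T \<le> T'\<close> means that
  there is no conflict: no white points \<open>s < t\<close> such that the lower arc of \<open>s\<close> passes below \<open>t\<close>
  while the upper arc of \<open>t\<close> passes above \<open>s\<close>.  A closest conflict separates the black points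
  between \<open>s\<close> and \<open>t\<close> from the others, so a connected diagram has none.  Conversely, in a diagram
  without conflicts every black point is joined by an arc to a neighbouring white point; counting
  degrees gives a black point with a single arc, and deleting it together with that white
  point leaves a smaller diagram without conflicts, which is a tree by induction.

  A bicolored blossoming tree amounts to a tree with two linear orders at each vertex, on its blue
  and on its red half-edges.  By induction it has exactly one meandering diagram: in any diagram
  the single edge of a leaf is adjacent to the leaf, and the order of the arcs at the other end of
  that edge leaves exactly one place where this pair of points can be inserted.  Uniqueness makes
  \<open>gamma\<close> injective and existence makes it surjective.
\<close>

section \<open>Leaves of trees\<close>

text \<open>Abstract diagrams have arbitrary types of vertices and edges, so that deleting a leaf
  keeps the names of the other points and only renumbers them. Only leaves whose single half-edge is
  blue are treated directly: a half turn of the plane exchanges upper and lower arcs and keeps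
  counterclockwise orders, which reduces red leaves to blue ones. The obstacle to uniqueness is that
  a leaf could a priori be nested anywhere; its place is forced because the corner at its neighbour
  decides which lower arcs pass outside the new one. That some black point carries a single arc is a
  matter of averages: \<open>n\<close> white points send \<open>2 * n\<close> arcs to
  \<open>n + 1\<close> black points. For binary trees, the ends of the lower arcs form the bracket
  vector, which grows along rotations; this is what ties conflicts to the Tamari order. The
  restriction \<open>n \<ge> 1\<close> enters because a blossoming tree has at least two
  nodes.\<close>

lemma is_tree_ends:
  assumes "is_tree V E ends" "e \<in> E"
  obtains u v where "u \<in> V" "v \<in> V" "ends e = {u, v}"
  using assms unfolding is_tree_def by metis

text \<open>Walks are pushed forward along \<open>f\<close>; cycles are pulled back along the
  inverses of \<open>f\<close> and \<open>g\<close>. This transports trees between black points,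
  nodes of a half-edge map and abstract vertices.\<close>

lemma is_tree_isomorphic:
  assumes "is_tree V E ends" "inj_on f V" "inj_on g E"
    and ends': "\<And>e. e \<in> E \<Longrightarrow> ends' (g e) = f ` ends e"
  shows "is_tree (f ` V) (g ` E) ends'"
proof -
  note T = assms(1)[unfolded is_tree_def]
  have endsV: "ends e \<subseteq> V" if "e \<in> E" for e
    using is_tree_ends[OF assms(1) that] by (metis empty_subsetI insert_subset)
  have conn: "(f u, f v) \<in> {(x, y). \<exists>e\<in>g ` E. ends' e = {x, y}}\<^sup>*"
    if "(u, v) \<in> {(x, y). \<exists>e\<in>E. ends e = {x, y}}\<^sup>*" for u v
    using that
  proof (induction rule: rtrancl_induct)
    case (step y z)
    then obtain e where "e \<in> E" "ends e = {y, z}" by auto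
    then have "(f y, f z) \<in> {(x, y). \<exists>e\<in>g ` E. ends' e = {x, y}}"
      using ends' by fastforce
    with step show ?case by (meson rtrancl.rtrancl_into_rtrancl)
  qed auto
  have acyc: False if "is_cycle (g ` E) ends' vs es" for vs es
  proof -
    let ?vs = "map (the_inv_into V f) vs" and ?es = "map (the_inv_into E g) es"
    note C = that[unfolded is_cycle_def]
    have esE: "set es \<subseteq> g ` E" using C by simp
    have inv: "the_inv_into E g e \<in> E" "g (the_inv_into E g e) = e" if "e \<in> g ` E" for e
      using that assms(3) the_inv_into_into[of g E e E] f_the_inv_into_f[of g E e] by auto
    have in_E: "the_inv_into E g (es ! i) \<in> E" and
      e_eq: "f ` ends (the_inv_into E g (es ! i)) = {vs ! i, vs ! (Suc i mod length es)}"
      if "i < length es" for i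
    proof -
      have "es ! i \<in> g ` E" using that esE by auto
      then show "the_inv_into E g (es ! i) \<in> E"
        "f ` ends (the_inv_into E g (es ! i)) = {vs ! i, vs ! (Suc i mod length es)}"
        using inv[of "es ! i"] ends'[of "the_inv_into E g (es ! i)"] C that by auto
    qed
    have vsV: "vs ! i \<in> f ` V" if "i < length es" for i
      using e_eq[OF that] endsV[OF in_E[OF that]] by blast
    then have vsV': "set vs \<subseteq> f ` V" using C by (metis in_set_conv_nth subsetI)
    have "is_cycle E ends ?vs ?es"
      unfolding is_cycle_def
    proof (intro conjI allI impI)
      show "?es \<noteq> []" "length ?vs = length ?es" using C by auto
      show "distinct ?vs"
        using C inj_on_subset[OF inj_on_the_inv_into[OF assms(2)] vsV']
        by (simp add: distinct_map)
      show "distinct ?es"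
        using C inj_on_subset[OF inj_on_the_inv_into[OF assms(3)] esE]
        by (simp add: distinct_map)
      show "set ?es \<subseteq> E" using esE inv by auto
    next
      fix i assume "i < length ?es"
      then have i: "i < length es" "Suc i mod length es < length es"
        by (auto intro: mod_less_divisor)
      have "ends (the_inv_into E g (es ! i)) =
        the_inv_into V f ` (f ` ends (the_inv_into E g (es ! i)))"
        using endsV[OF in_E[OF i(1)]] the_inv_into_f_f[OF assms(2)]
        by (force simp: image_image)
      then show "ends (?es ! i) = {?vs ! i, ?vs ! (Suc i mod length ?es)}"
        using i C e_eq[OF i(1)] by simp
    qed
    then show False using T by blast
  qed
  show ?thesis
    unfolding is_tree_def
  proof (intro conjI)
    show "\<forall>e\<in>g ` E. \<exists>u\<in>f ` V. \<exists>v\<in>f ` V. ends' e = {u, v}"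
    proof
      fix e' assume "e' \<in> g ` E"
      then obtain e where e: "e \<in> E" "e' = g e" by auto
      then obtain u v where "u \<in> V" "v \<in> V" "ends e = {u, v}" using T by blast
      then have "f u \<in> f ` V" "f v \<in> f ` V" "ends' e' = {f u, f v}" using e ends' by auto
      then show "\<exists>u\<in>f ` V. \<exists>v\<in>f ` V. ends' e' = {u, v}" by blast
    qed
  qed (use T conn acyc in auto)
qed

lemma is_tree_cong:
  assumes "is_tree V E ends" "\<And>e. e \<in> E \<Longrightarrow> ends' e = ends e"
  shows "is_tree V E ends'"
  using is_tree_isomorphic[OF assms(1), of id id ends'] assms(2) by simp

definition pendant :: "'e set \<Rightarrow> ('e \<Rightarrow> 'v set) \<Rightarrow> 'v \<Rightarrow> 'e \<Rightarrow> 'v \<Rightarrow> bool" where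
  "pendant E ends v e u \<longleftrightarrow>
     e \<in> E \<and> ends e = {v, u} \<and> u \<noteq> v \<and> (\<forall>e'\<in>E. v \<in> ends e' \<longrightarrow> e' = e)"

definition is_path :: "'e set \<Rightarrow> ('e \<Rightarrow> 'v set) \<Rightarrow> 'v list \<Rightarrow> 'e list \<Rightarrow> bool" where
  "is_path E ends vs es \<longleftrightarrow>
     length vs = Suc (length es) \<and> distinct vs \<and> set es \<subseteq> E \<and>
     (\<forall>i < length es. ends (es ! i) = {vs ! i, vs ! Suc i})"

text \<open>Distinct vertices suffice: the pairs of consecutive vertices at two different positions
  are different sets.\<close>

lemma is_path_distinct_edges:
  assumes "is_path E ends vs es"
  shows "distinct es"
  unfolding distinct_conv_nth
proof (intro allI impI notI)
  fix i j assume ij: "i < length es" "j < length es" "i \<noteq> j" "es ! i = es ! j"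
  have "{vs ! i, vs ! Suc i} = {vs ! j, vs ! Suc j}"
    using assms ij unfolding is_path_def by metis
  moreover have "distinct vs" "length vs = Suc (length es)" using assms by (auto simp: is_path_def)
  ultimately show False
    using ij by (auto simp: doubleton_eq_iff nth_eq_iff_index_eq)
qed

text \<open>The first vertex of a longest path is a leaf.\<close>

lemma tree_obtains_pendant:
  assumes T: "is_tree V E ends" and "card V \<ge> 2"
  obtains v e u where "v \<in> V" "u \<in> V" "pendant E ends v e u"
proof -
  note T' = T[unfolded is_tree_def]
  have fin: "finite V" using T' by blast
  obtain a b where ab: "a \<in> V" "b \<in> V" "a \<noteq> b"
    using assms(2) card_le_Suc0_iff_eq[OF fin] by auto
  then have "(a, b) \<in> {(x, y). \<exists>e\<in>E. ends e = {x, y}}\<^sup>*" using T' by blast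
  then obtain c e0 where "e0 \<in> E" "ends e0 = {a, c}" "a \<noteq> c"
    using ab(3) by (induction rule: converse_rtrancl_induct) (auto, metis)
  have pathV: "set vs \<subseteq> V" if "is_path E ends vs es" "es \<noteq> []" for vs es
  proof
    fix w assume "w \<in> set vs"
    then obtain i where i: "i < length vs" "w = vs ! i" by (metis in_set_conv_nth)
    have "\<exists>j<length es. w \<in> ends (es ! j)"
    proof (cases i)
      case 0
      then show ?thesis using that i unfolding is_path_def
        by (metis insertI1 length_greater_0_conv)
    next
      case (Suc j)
      then have "j < length es" using that i unfolding is_path_def by simp
      then show ?thesis using that i Suc unfolding is_path_def by auto
    qed
    then obtain j where "j < length es" "w \<in> ends (es ! j)" by blast
    moreover have "es ! j \<in> E" using that calculation unfolding is_path_def by auto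
    ultimately show "w \<in> V" using is_tree_ends[OF T] by (metis empty_iff insert_iff)
  qed
  define P where "P k \<longleftrightarrow> (\<exists>vs es. is_path E ends vs es \<and> length es = k \<and> k > 0)" for k
  have P1: "P 1"
    unfolding P_def is_path_def
    using \<open>e0 \<in> E\<close> \<open>ends e0 = {a, c}\<close> \<open>a \<noteq> c\<close>
    by (intro exI[of _ "[a, c]"] exI[of _ "[e0]"]) auto
  have Pb: "k \<le> card V" if Pk: "P k" for k
  proof -
    obtain vs es where *: "is_path E ends vs es" "length es = k" "k > 0"
      using Pk unfolding P_def by blast
    then have "set vs \<subseteq> V" using pathV by auto
    then have "length vs \<le> card V"
      using * fin unfolding is_path_def by (metis card_mono distinct_card)
    then show ?thesis using * unfolding is_path_def by simp
  qed
  define m where "m = (GREATEST k. P k)"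
  have m: "P m" and max: "\<And>k. P k \<Longrightarrow> k \<le> m"
    unfolding m_def using GreatestI_nat[of P 1] Greatest_le_nat[of P] P1 Pb by blast+
  obtain vs es where p: "is_path E ends vs es" "length es = m" "m > 0"
    using m unfolding P_def by blast
  note p' = p(1)[unfolded is_path_def]
  let ?v = "vs ! 0" and ?u = "vs ! 1" and ?e = "es ! 0"
  have e: "?e \<in> E" "ends ?e = {?v, ?u}" using p p' by auto
  have "?u \<noteq> ?v" using p p' by (simp add: nth_eq_iff_index_eq)
  have "e' = ?e" if e': "e' \<in> E" "?v \<in> ends e'" for e'
  proof (rule ccontr)
    assume ne: "e' \<noteq> ?e"
    obtain a b where ab: "a \<in> V" "b \<in> V" "ends e' = {a, b}"
      using is_tree_ends[OF T e'(1)] .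
    obtain w where w: "w \<in> V" "ends e' = {?v, w}"
    proof (cases "a = ?v")
      case True
      with ab that[of b] show ?thesis by simp
    next
      case False
      with ab e'(2) that[of a] show ?thesis by (simp add: insert_commute)
    qed
    have notin: "e' \<notin> set es"
    proof
      assume "e' \<in> set es"
      then obtain i where i: "i < length es" "e' = es ! i" by (metis in_set_conv_nth)
      then have "vs ! 0 = vs ! i \<or> vs ! 0 = vs ! Suc i" using p' that(2) by auto
      then have "i = 0" using p' i by (auto simp: nth_eq_iff_index_eq)
      with ne i show False by simp
    qed
    show False
    \<comment> \<open>A new vertex \<open>w\<close> prolongs the path, an old one closes its initial
      segment to a cycle. For \<open>j = 0\<close> this cycle is a loop, for \<open>j = 1\<close> it
      consists of two parallel edges.\<close>
    proof (cases "w \<in> set vs")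
      case False
      have "ends ((e' # es) ! i) = {(w # vs) ! i, (w # vs) ! Suc i}"
        if "i < length (e' # es)" for i
        using that p' w by (cases i) (auto simp: insert_commute)
      then have "is_path E ends (w # vs) (e' # es)"
        unfolding is_path_def using p' that False by auto
      then have "P (Suc m)" unfolding P_def using p(2) by fastforce
      then show False using max by fastforce
    next
      case True
      then obtain j where j: "j < length vs" "w = vs ! j" by (metis in_set_conv_nth)
      then have jl: "j \<le> length es" using p' by simp
      have "is_cycle E ends (take (Suc j) vs) (take j es @ [e'])"
        unfolding is_cycle_def
      proof (intro conjI allI impI)
        show "distinct (take j es @ [e'])"
          using is_path_distinct_edges[OF p(1)] notin by (auto dest: in_set_takeD)
        show "set (take j es @ [e']) \<subseteq> E" using p' that by (auto dest: in_set_takeD)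
      next
        fix i assume "i < length (take j es @ [e'])"
        then have "i < j \<or> i = j" using jl by auto
        then show "ends ((take j es @ [e']) ! i) =
          {take (Suc j) vs ! i, take (Suc j) vs ! (Suc i mod length (take j es @ [e']))}"
          using jl j p' w by (auto simp: nth_append insert_commute)
      qed (use p' jl in auto)
      then show False using T' by blast
    qed
  qed
  then have "pendant E ends ?v ?e ?u"
    using e \<open>?u \<noteq> ?v\<close> unfolding pendant_def by blast
  moreover have "?v \<in> V" "?u \<in> V" using pathV[OF p(1)] p p' by (auto intro!: subsetD[OF _ nth_mem])
  ultimately show thesis using that by blast
qed

section \<open>Removing and attaching leaves\<close>

lemma tree_delete_pendant:
  assumes T: "is_tree V E ends" and p: "pendant E ends v e u"
  shows "is_tree (V - {v}) (E - {e}) ends"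
proof -
  note T' = T[unfolded is_tree_def] and p' = p[unfolded pendant_def]
  let ?R = "{(x, y). \<exists>e\<in>E. ends e = {x, y}}"
  let ?R' = "{(x, y). \<exists>e'\<in>E - {e}. ends e' = {x, y}}"
  have uV: "u \<in> V" using is_tree_ends[OF T, of e] p' by (metis insert_iff singletonD)
  \<comment> \<open>Walks are rerouted by letting \<open>u\<close> stand for \<open>v\<close>: a
    step along \<open>e\<close> then stays at \<open>u\<close>, and every other step avoids
    \<open>v\<close>.\<close>
  have walk: "(a, if b = v then u else b) \<in> ?R'\<^sup>*" if "(a, b) \<in> ?R\<^sup>*" "a \<noteq> v" for a b
    using that
  proof (induction rule: rtrancl_induct)
    case (step b c)
    then obtain e' where e': "e' \<in> E" "ends e' = {b, c}" by auto
    show ?case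
    proof (cases "e' = e")
      case True
      then have "{b, c} = {v, u}" using e' p' by simp
      then have "b = v \<and> c = u \<or> b = u \<and> c = v" by (simp add: doubleton_eq_iff)
      then show ?thesis using step.IH step.prems p' by (elim disjE) simp_all
    next
      case False
      then have bc: "b \<noteq> v" "c \<noteq> v" using e' p' by auto
      have "(a, b) \<in> ?R'\<^sup>*" using step.IH step.prems bc by simp
      moreover have "(b, c) \<in> ?R'" using e' False by blast
      ultimately have "(a, c) \<in> ?R'\<^sup>*" by (rule rtrancl_into_rtrancl)
      with bc show ?thesis by simp
    qed
  qed auto
  show ?thesis
    unfolding is_tree_def
  proof (intro conjI)
    show "\<forall>e'\<in>E - {e}. \<exists>u\<in>V - {v}. \<exists>w\<in>V - {v}. ends e' = {u, w}"
    proof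
      fix e' assume e': "e' \<in> E - {e}"
      then obtain a b where "a \<in> V" "b \<in> V" "ends e' = {a, b}"
        using is_tree_ends[OF T, of e'] by auto
      moreover have "v \<notin> ends e'" using e' p' by auto
      ultimately show "\<exists>u\<in>V - {v}. \<exists>w\<in>V - {v}. ends e' = {u, w}" by blast
    qed
    show "\<forall>a\<in>V - {v}. \<forall>b\<in>V - {v}. (a, b) \<in> ?R'\<^sup>*"
    proof (intro ballI)
      fix a b assume ab: "a \<in> V - {v}" "b \<in> V - {v}"
      then have "(a, b) \<in> ?R\<^sup>*" using T' by blast
      from walk[OF this] ab show "(a, b) \<in> ?R'\<^sup>*" by auto
    qed
    show "\<nexists>vs es. is_cycle (E - {e}) ends vs es"
      using T' unfolding is_cycle_def by blast
    show "V - {v} \<noteq> {}" using uV p' by auto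
  qed (use T' in auto)
qed

lemma tree_insert_pendant:
  assumes T: "is_tree V E ends" and u: "u \<in> V" "v \<notin> V" "e \<notin> E" "ends e = {v, u}"
  shows "is_tree (insert v V) (insert e E) ends"
proof -
  note T' = T[unfolded is_tree_def]
  let ?R = "{(x, y). \<exists>e\<in>E. ends e = {x, y}}"
  let ?R' = "{(x, y). \<exists>e'\<in>insert e E. ends e' = {x, y}}"
  have only: "e' = e" if "e' \<in> insert e E" "v \<in> ends e'" for e'
    using that is_tree_ends[OF T, of e'] u(2) by (metis insert_iff singletonD)
  have sub: "?R\<^sup>* \<subseteq> ?R'\<^sup>*" by (rule rtrancl_mono) auto
  have vu: "(v, u) \<in> ?R'\<^sup>*" "(u, v) \<in> ?R'\<^sup>*" using u by (auto simp: insert_commute)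
  have "(a, u) \<in> ?R'\<^sup>*" "(u, a) \<in> ?R'\<^sup>*" if "a \<in> insert v V" for a
    using that T' sub vu u by blast+
  then have conn: "(a, b) \<in> ?R'\<^sup>*" if "a \<in> insert v V" "b \<in> insert v V" for a b
    using that by (meson rtrancl_trans)
  have acyc: False if "is_cycle (insert e E) ends vs es" for vs es
  proof -
    note C = that[unfolded is_cycle_def]
    have "e \<in> set es"
    proof (rule ccontr)
      assume "e \<notin> set es"
      then have "is_cycle E ends vs es" using C unfolding is_cycle_def by blast
      then show False using T' by blast
    qed
    then obtain i where i: "i < length es" "es ! i = e" by (metis in_set_conv_nth)
    let ?l = "length es" and ?s = "\<lambda>i. Suc i mod length es"
    have s: "?s i < ?l" if "i < ?l" for i using that by (auto intro: mod_less_divisor)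
    have e: "{vs ! i, vs ! ?s i} = {v, u}" using C i u by metis
    have l2: "?l \<noteq> 1"
    proof
      assume "?l = 1"
      then have "vs ! i = vs ! ?s i" using i by simp
      with e u show False by (auto simp: doubleton_eq_iff)
    qed
    \<comment> \<open>The cycle meets \<open>v\<close> in a second edge: the next one if
      \<open>v\<close> is the later end of \<open>e\<close>, the previous one otherwise. As
      \<open>l2\<close> excludes a loop, its position differs from \<open>i\<close>, against
      \<open>only\<close>.\<close>
    have "\<exists>j<?l. j \<noteq> i \<and> v \<in> ends (es ! j)"
    proof (cases "vs ! ?s i = v")
      case True
      have "?s i \<noteq> i"
        using i l2 by (cases "Suc i = ?l") auto
      moreover have "v \<in> ends (es ! ?s i)" using C True s[OF i(1)] by auto
      ultimately show ?thesis using s[OF i(1)] by blast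
    next
      case False
      then have vi: "vs ! i = v" using e by (auto simp: doubleton_eq_iff)
      define j where "j = (if i = 0 then ?l - 1 else i - 1)"
      have "j < ?l" "?s j = i" "j \<noteq> i" using i l2 unfolding j_def by auto
      moreover have "v \<in> ends (es ! j)" using C vi calculation by auto
      ultimately show ?thesis by blast
    qed
    then obtain j where "j < ?l" "j \<noteq> i" "v \<in> ends (es ! j)" by blast
    then have "es ! j = e" using only C by (metis nth_mem subsetD)
    then show False using C i \<open>j < ?l\<close> \<open>j \<noteq> i\<close> nth_eq_iff_index_eq by metis
  qed
  show ?thesis
    unfolding is_tree_def
  proof (intro conjI)
    show "\<forall>e\<in>insert e E. \<exists>u\<in>insert v V. \<exists>v\<in>insert v V. ends e = {u, v}"
      using T' u by blast
  qed (use T' conn acyc in auto)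
qed

text \<open>Used to attach the leaves of all buds at once: \<open>g\<close> names the edge of each
  leaf, and every new edge leads to an old vertex.\<close>

lemma tree_insert_pendants:
  assumes "finite L" and "is_tree V E ends"
    and "inj_on g L" "L \<inter> V = {}" "g ` L \<inter> E = {}"
    and "\<And>l. l \<in> L \<Longrightarrow> \<exists>u\<in>V. ends (g l) = {l, u}"
  shows "is_tree (V \<union> L) (E \<union> g ` L) ends"
  using assms
proof (induction L)
  case (insert l L)
  obtain u where u: "u \<in> V" "ends (g l) = {l, u}" using insert.prems(5) by blast
  have "is_tree (V \<union> L) (E \<union> g ` L) ends" using insert by (auto simp: inj_on_insert)
  then have "is_tree (insert l (V \<union> L)) (insert (g l) (E \<union> g ` L)) ends"
    by (rule tree_insert_pendant) (use insert u in auto)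
  then show ?case by simp
qed simp

text \<open>Used to strip a blossoming tree of its buds. Deleting one leaf removes only its own
  edge, since \<open>g\<close> is injective, so the other leaves stay pendant.\<close>

lemma tree_delete_pendants:
  assumes "finite L" and "is_tree V E ends" and "inj_on g L"
    and "\<And>l. l \<in> L \<Longrightarrow> \<exists>u. u \<notin> L \<and> pendant E ends l (g l) u"
  shows "is_tree (V - L) (E - g ` L) ends"
  using assms
proof (induction L arbitrary: V E)
  case (insert l L)
  obtain u where u: "pendant E ends l (g l) u" using insert.prems by blast
  have "is_tree (V - {l} - L) (E - {g l} - g ` L) ends"
  proof (rule insert.IH)
    show "is_tree (V - {l}) (E - {g l}) ends"
      using tree_delete_pendant insert.prems(1) u .
    show "inj_on g L" using insert.prems by (simp add: inj_on_insert)
  next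
    fix k assume k: "k \<in> L"
    then obtain w where w: "w \<notin> insert l L" "pendant E ends k (g k) w"
      using insert.prems(3) by blast
    have "g k \<noteq> g l" using k insert.hyps(2) insert.prems(2) unfolding inj_on_def by blast
    then show "\<exists>u. u \<notin> L \<and> pendant (E - {g l}) ends k (g k) u"
      using w unfolding pendant_def by blast
  qed
  then show ?case by (metis Diff_insert2 image_insert)
qed simp

lemma tree_card:
  assumes "is_tree V E ends"
  shows "card V = Suc (card E)"
  using assms
proof (induction "card V" arbitrary: V E rule: less_induct)
  case less
  have fin: "finite V" "finite E" "V \<noteq> {}" using less.prems unfolding is_tree_def by auto
  show ?case
  proof (cases "card V \<ge> 2")
    case True
    then obtain v e u where p: "v \<in> V" "pendant E ends v e u"
      using tree_obtains_pendant less.prems by metis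
    then have "card (V - {v}) = Suc (card (E - {e}))"
      using less.hyps[OF _ tree_delete_pendant[OF less.prems p(2)]] fin by (simp add: card_gt_0_iff)
    moreover have "e \<in> E" using p by (simp add: pendant_def)
    ultimately show ?thesis using p(1) fin
      by (metis card_Suc_Diff1)
  next
    case False
    then have "card V = 1" using fin by (simp add: not_le less_Suc_eq numeral_2_eq_2)
    then obtain v where v: "V = {v}" by (auto simp: card_1_singleton_iff)
    have "E = {}"
    proof (rule ccontr)
      assume "E \<noteq> {}"
      then obtain e where e: "e \<in> E" by blast
      then have "ends e = {v}" using less.prems v unfolding is_tree_def by auto
      then have "is_cycle E ends [v] [e]" using e unfolding is_cycle_def by auto
      then show False using less.prems unfolding is_tree_def by blast
    qed
    then show ?thesis using v by simp
  qed
qed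

section \<open>Abstract diagrams\<close>

text \<open>
  An abstract diagram: \<open>x\<close> numbers the black points \<open>V\<close> from 0 and \<open>y\<close> numbers the white points
  \<open>E\<close> from 1, so that the white point number \<open>t\<close> lies between the black points \<open>t - 1\<close> and \<open>t\<close>.
  The upper and lower arcs at \<open>e\<close> lead to \<open>bv e\<close> and \<open>rv e\<close>.
\<close>

definition diag ::
  "'v set \<Rightarrow> 'e set \<Rightarrow> ('e \<Rightarrow> 'v) \<Rightarrow> ('e \<Rightarrow> 'v) \<Rightarrow> ('v \<Rightarrow> nat) \<Rightarrow> ('e \<Rightarrow> nat) \<Rightarrow> bool" where
  "diag V E bv rv x y \<longleftrightarrow>
     bij_betw x V {0..card E} \<and> bij_betw y E {1..card E} \<and>
     (\<forall>e\<in>E. bv e \<in> V \<and> rv e \<in> V \<and> x (bv e) < y e \<and> y e \<le> x (rv e)) \<and>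
     (\<forall>e\<in>E. \<forall>f\<in>E. \<not> (x (bv e) < x (bv f) \<and> x (bv f) < y e \<and> y e < y f)) \<and>
     (\<forall>e\<in>E. \<forall>f\<in>E. \<not> (y e < y f \<and> y f \<le> x (rv e) \<and> x (rv e) < x (rv f)))"

text \<open>These are the orders of \<open>half_edges_around\<close>: counterclockwise around a
  black point, upper arcs come by increasing and lower arcs by decreasing white end.\<close>

definition arcs_ordered ::
  "'v set \<Rightarrow> ('v \<Rightarrow> 'e list) \<Rightarrow> ('v \<Rightarrow> 'e list) \<Rightarrow> ('e \<Rightarrow> nat) \<Rightarrow> bool" where
  "arcs_ordered V bl rl y \<longleftrightarrow>
     (\<forall>v\<in>V. sorted_wrt (<) (map y (bl v)) \<and> sorted_wrt (>) (map y (rl v)))"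

text \<open>The two buds cut the cyclic order at a vertex into two linear orders, the lists
  \<open>bl v\<close> and \<open>rl v\<close> of its blue and red half-edges; a half-edge is
  represented by its edge.\<close>

definition colored_graph ::
  "'v set \<Rightarrow> 'e set \<Rightarrow> ('e \<Rightarrow> 'v) \<Rightarrow> ('e \<Rightarrow> 'v) \<Rightarrow> ('v \<Rightarrow> 'e list) \<Rightarrow> ('v \<Rightarrow> 'e list) \<Rightarrow> bool" where
  "colored_graph V E bv rv bl rl \<longleftrightarrow>
     (\<forall>e\<in>E. bv e \<in> V \<and> rv e \<in> V) \<and>
     (\<forall>v\<in>V. distinct (bl v) \<and> set (bl v) = {e \<in> E. bv e = v} \<and>
             distinct (rl v) \<and> set (rl v) = {e \<in> E. rv e = v})"

definition shift :: "nat \<Rightarrow> nat \<Rightarrow> nat" where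
  "shift c k = (if c \<le> k then Suc k else k)"

definition unshift :: "nat \<Rightarrow> nat \<Rightarrow> nat" where
  "unshift c k = (if c < k then k - 1 else k)"

lemma shift_unshift: "k \<noteq> c \<Longrightarrow> shift c (unshift c k) = k"
  by (auto simp: shift_def unshift_def)

text \<open>A blue leaf takes the black number \<open>c\<close> and its white point the number
  \<open>Suc c\<close>, so black numbers move by \<open>shift c\<close> and white ones by
  \<open>shift (Suc c)\<close>. The mixed rules say that the interleaving of black and white points
  survives.\<close>

lemma shift_less_shift [simp]:
  "shift c i < shift c j \<longleftrightarrow> i < j"
  "shift c i < shift (Suc c) j \<longleftrightarrow> i < j"
  "shift (Suc c) i \<le> shift c j \<longleftrightarrow> i \<le> j"
  by (auto simp: shift_def)

lemma bij_betw_shift: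
  assumes "a \<le> c" "c \<le> Suc n"
  shows "bij_betw (shift c) {a..n} ({a..Suc n} - {c})"
    and "bij_betw (unshift c) ({a..Suc n} - {c}) {a..n}"
proof -
  have *: "\<forall>k\<in>{a..n}. unshift c (shift c k) = k" "\<forall>k\<in>{a..Suc n} - {c}. shift c (unshift c k) = k"
    "shift c ` {a..n} \<subseteq> {a..Suc n} - {c}" "unshift c ` ({a..Suc n} - {c}) \<subseteq> {a..n}"
    using assms unfolding image_subset_iff shift_def unshift_def by auto
  show "bij_betw (shift c) {a..n} ({a..Suc n} - {c})"
    by (rule bij_betw_byWitness[where f' = "unshift c"]) (use * in auto)
  show "bij_betw (unshift c) ({a..Suc n} - {c}) {a..n}"
    by (rule bij_betw_byWitness[where f' = "shift c"]) (use * in auto)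
qed

section \<open>The half-turn symmetry of diagrams\<close>

lemma diag_finite:
  assumes "diag V E bv rv x y"
  shows "finite V" "finite E" "card V = Suc (card E)"
proof -
  have x: "bij_betw x V {0..card E}" and y: "bij_betw y E {1..card E}"
    using assms by (auto simp: diag_def)
  show "finite V" using bij_betw_finite[OF x] by (rule iffD2) simp
  show "finite E" using bij_betw_finite[OF y] by (rule iffD2) simp
  show "card V = Suc (card E)" using bij_betw_same_card[OF x] by simp
qed

text \<open>A half turn of the drawing reverses both numberings and exchanges upper with lower arcs,
  hence the roles of \<open>bv\<close> and \<open>rv\<close>.\<close>

lemma diag_rotate:
  assumes D: "diag V E bv rv x y"
  shows "diag V E rv bv (\<lambda>v. card E - x v) (\<lambda>e. Suc (card E) - y e)"
proof -
  let ?n = "card E"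
  have x: "bij_betw x V {0..?n}" and y: "bij_betw y E {1..?n}"
    using D by (auto simp: diag_def)
  have xr: "x v \<le> ?n" if "v \<in> V" for v using bij_betwE[OF x] that by auto
  have yr: "1 \<le> y e \<and> y e \<le> ?n" if "e \<in> E" for e using bij_betwE[OF y] that by auto
  have V: "bv e \<in> V" "rv e \<in> V" if "e \<in> E" for e using D that by (auto simp: diag_def)
  have "bij_betw (\<lambda>k. ?n - k) {0..?n} {0..?n}"
    by (rule bij_betw_byWitness[where f' = "\<lambda>k. ?n - k"]) auto
  from bij_betw_trans[OF x this] have 1: "bij_betw (\<lambda>v. ?n - x v) V {0..?n}"
    by (simp add: comp_def)
  have "bij_betw (\<lambda>k. Suc ?n - k) {1..?n} {1..?n}"
    by (rule bij_betw_byWitness[where f' = "\<lambda>k. Suc ?n - k"]) auto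
  from bij_betw_trans[OF y this] have 2: "bij_betw (\<lambda>e. Suc ?n - y e) E {1..?n}"
    by (simp add: comp_def)
  show ?thesis
    unfolding diag_def
  proof (intro conjI ballI 1 2)
    fix e assume e: "e \<in> E"
    note * = xr[OF V(1)[OF e]] xr[OF V(2)[OF e]] yr[OF e]
    show "rv e \<in> V" "bv e \<in> V" using V e by auto
    have "x (bv e) < y e" "y e \<le> x (rv e)" using D e by (auto simp: diag_def)
    with * show "?n - x (rv e) < Suc ?n - y e" "Suc ?n - y e \<le> ?n - x (bv e)"
      by auto
    fix f assume f: "f \<in> E"
    note ** = xr[OF V(1)[OF f]] xr[OF V(2)[OF f]] yr[OF f]
    have "\<not> (y f < y e \<and> y e \<le> x (rv f) \<and> x (rv f) < x (rv e))"
      "\<not> (x (bv f) < x (bv e) \<and> x (bv e) < y f \<and> y f < y e)"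
      using D e f unfolding diag_def by blast+
    then show "\<not> (?n - x (rv e) < ?n - x (rv f) \<and> ?n - x (rv f) < Suc ?n - y e \<and>
        Suc ?n - y e < Suc ?n - y f)"
      "\<not> (Suc ?n - y e < Suc ?n - y f \<and> Suc ?n - y f \<le> ?n - x (bv e) \<and>
        ?n - x (bv e) < ?n - x (bv f))"
      using * ** by linarith+
  qed
qed

text \<open>A rotation keeps counterclockwise orders, so the two lists are exchanged but not
  reversed, as they would be under a reflection.\<close>

lemma arcs_ordered_rotate:
  assumes C: "colored_graph V E bv rv bl rl" and D: "diag V E bv rv x y"
    and O: "arcs_ordered V bl rl y"
  shows "arcs_ordered V rl bl (\<lambda>e. Suc (card E) - y e)"
  unfolding arcs_ordered_def
proof (intro ballI conjI)
  fix v assume v: "v \<in> V"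
  have yr: "1 \<le> y e \<and> y e \<le> card E" if "e \<in> E" for e
    using D that bij_betwE[of y E "{1..card E}"] by (auto simp: diag_def)
  have sub: "set (bl v) \<subseteq> E" "set (rl v) \<subseteq> E" using C v by (auto simp: colored_graph_def)
  have "sorted_wrt (\<lambda>a b. y a < y b) (bl v)" "sorted_wrt (\<lambda>a b. y b < y a) (rl v)"
    using O v by (auto simp: arcs_ordered_def sorted_wrt_map)
  then have "sorted_wrt (\<lambda>a b. Suc (card E) - y b < Suc (card E) - y a) (bl v)"
    "sorted_wrt (\<lambda>a b. Suc (card E) - y a < Suc (card E) - y b) (rl v)"
  proof -
    show "sorted_wrt (\<lambda>a b. Suc (card E) - y b < Suc (card E) - y a) (bl v)"
      by (rule sorted_wrt_mono_rel[OF _ \<open>sorted_wrt (\<lambda>a b. y a < y b) (bl v)\<close>])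
        (use sub yr in \<open>meson diff_less_mono2 le_imp_less_Suc less_le_trans subsetD\<close>)
    show "sorted_wrt (\<lambda>a b. Suc (card E) - y a < Suc (card E) - y b) (rl v)"
      by (rule sorted_wrt_mono_rel[OF _ \<open>sorted_wrt (\<lambda>a b. y b < y a) (rl v)\<close>])
        (use sub yr in \<open>meson diff_less_mono2 le_imp_less_Suc less_le_trans subsetD\<close>)
  qed
  then show "sorted_wrt (<) (map (\<lambda>e. Suc (card E) - y e) (rl v))"
    "sorted_wrt (>) (map (\<lambda>e. Suc (card E) - y e) (bl v))"
    by (simp_all add: sorted_wrt_map)
qed

section \<open>Removing and inserting a blue leaf\<close>

locale blue_leaf =
  fixes V :: "'v set" and E :: "'e set" and bv rv :: "'e \<Rightarrow> 'v" and v :: 'v and e :: 'e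
  assumes v: "v \<in> V" and e: "e \<in> E" and fin: "finite V" "finite E"
    and bve: "bv e = v" and rve: "rv e \<noteq> v" "rv e \<in> V"
    and only: "\<And>f. f \<in> E \<Longrightarrow> bv f = v \<or> rv f = v \<Longrightarrow> f = e"
    and ends: "\<And>f. f \<in> E \<Longrightarrow> bv f \<in> V \<and> rv f \<in> V"
begin

lemma ends': "f \<in> E - {e} \<Longrightarrow> bv f \<in> V - {v} \<and> rv f \<in> V - {v}"
  using only ends by blast

text \<open>The leaf and its white point are neighbours on the axis, so removing both keeps black
  and white points alternating, and the old numbers are shifts of the new ones.\<close>

lemma delete:
  assumes D: "diag V E bv rv x y" and y: "y e = Suc (x v)"
  defines "x' \<equiv> \<lambda>u. unshift (x v) (x u)" and "y' \<equiv> \<lambda>f. unshift (Suc (x v)) (y f)"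
  shows "diag (V - {v}) (E - {e}) bv rv x' y'"
    and "\<And>u. u \<in> V - {v} \<Longrightarrow> x u = shift (x v) (x' u)"
    and "\<And>f. f \<in> E - {e} \<Longrightarrow> y f = shift (Suc (x v)) (y' f)"
proof -
  let ?n = "card (E - {e})"
  have n: "card E = Suc ?n" using e fin by (metis card_Suc_Diff1)
  have bx: "bij_betw x V {0..Suc ?n}" and by_: "bij_betw y E {1..Suc ?n}"
    using D by (auto simp: diag_def n)
  have "x (rv e) \<le> Suc ?n" using bij_betwE[OF bx] ends[OF e] by auto
  moreover have "x v < x (rv e)" using D e y unfolding diag_def by fastforce
  ultimately have xv: "x v \<le> ?n" by linarith
  have bx': "bij_betw x (V - {v}) ({0..Suc ?n} - {x v})"
    and by': "bij_betw y (E - {e}) ({1..Suc ?n} - {Suc (x v)})"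
    using bij_betw_DiffI[OF bx, of "{v}" "{x v}"] bij_betw_DiffI[OF by_, of "{e}" "{y e}"] v e y xv
    by (auto simp: bij_betw_def)
  show xs: "x u = shift (x v) (x' u)" if "u \<in> V - {v}" for u
    using bij_betwE[OF bx'] that shift_unshift unfolding x'_def by auto
  show ys: "y f = shift (Suc (x v)) (y' f)" if "f \<in> E - {e}" for f
    using bij_betwE[OF by'] that shift_unshift unfolding y'_def by auto
  have "bij_betw x' (V - {v}) {0..?n}" "bij_betw y' (E - {e}) {1..?n}"
    using bij_betw_trans[OF bx' bij_betw_shift(2)] bij_betw_trans[OF by' bij_betw_shift(2)] xv
    by (auto simp: x'_def y'_def comp_def)
  moreover have "x' (bv f) < y' f" "y' f \<le> x' (rv f)" if "f \<in> E - {e}" for f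
    using D that ends'[OF that] xs[of "bv f"] xs[of "rv f"] ys[of f] unfolding diag_def by auto
  moreover have
    "\<not> (x' (bv f) < x' (bv g) \<and> x' (bv g) < y' f \<and> y' f < y' g)"
    "\<not> (y' f < y' g \<and> y' g \<le> x' (rv f) \<and> x' (rv f) < x' (rv g))"
    if "f \<in> E - {e}" "g \<in> E - {e}" for f g
  proof -
    have "\<not> (x (bv f) < x (bv g) \<and> x (bv g) < y f \<and> y f < y g)"
      "\<not> (y f < y g \<and> y g \<le> x (rv f) \<and> x (rv f) < x (rv g))"
      using D that unfolding diag_def by blast+
    then show "\<not> (x' (bv f) < x' (bv g) \<and> x' (bv g) < y' f \<and> y' f < y' g)"
      "\<not> (y' f < y' g \<and> y' g \<le> x' (rv f) \<and> x' (rv f) < x' (rv g))"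
      using ends'[OF that(1)] ends'[OF that(2)] xs[of "bv f"] xs[of "rv f"] xs[of "bv g"]
        xs[of "rv g"] ys[OF that(1)] ys[OF that(2)] by simp_all
  qed
  ultimately show "diag (V - {v}) (E - {e}) bv rv x' y'"
    unfolding diag_def using ends' by blast
qed

text \<open>The new upper arc joins neighbours and crosses nothing. For the new lower arc,
  \<open>inside\<close> excludes arcs that start within it and end beyond it. An arc that starts
  before it and ends within it would already cross the arc provided by \<open>cover\<close>, which
  starts at \<open>c\<close> and reaches at least \<open>rv e\<close>.\<close>

lemma insert:
  assumes D: "diag (V - {v}) (E - {e}) bv rv x' y'" and c: "c \<le> x' (rv e)"
    and cover: "c = 0 \<or> (\<exists>g\<in>E - {e}. y' g = c \<and> x' (rv e) \<le> x' (rv g))"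
    and inside: "\<And>f. f \<in> E - {e} \<Longrightarrow> c < y' f \<Longrightarrow> y' f \<le> x' (rv e) \<Longrightarrow> x' (rv f) \<le> x' (rv e)"
  defines "x \<equiv> \<lambda>u. if u = v then c else shift c (x' u)"
    and "y \<equiv> \<lambda>f. if f = e then Suc c else shift (Suc c) (y' f)"
  shows "diag V E bv rv x y"
proof -
  let ?n = "card (E - {e})"
  have n: "card E = Suc ?n" using e fin by (metis card_Suc_Diff1)
  have bx: "bij_betw x' (V - {v}) {0..?n}" and by_: "bij_betw y' (E - {e}) {1..?n}"
    using D by (auto simp: diag_def)
  have "x' (rv e) \<le> ?n" using bij_betwE[OF bx] rve by auto
  then have cn: "c \<le> ?n" using c by simp
  have "bij_betw x (V - {v}) ({0..Suc ?n} - {c})"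
    using bij_betw_trans[OF bx bij_betw_shift(1), of c] cn
      bij_betw_cong[of "V - {v}" x "shift c \<circ> x'"] by (auto simp: x_def)
  from bij_betw_combine[OF this bij_betw_singletonI[of x v c]]
  have 1: "bij_betw x V {0..Suc ?n}" using v cn by (simp add: x_def insert_absorb)
  have "bij_betw y (E - {e}) ({1..Suc ?n} - {Suc c})"
    using bij_betw_trans[OF by_ bij_betw_shift(1), of "Suc c"] cn
      bij_betw_cong[of "E - {e}" y "shift (Suc c) \<circ> y'"] by (auto simp: y_def)
  from bij_betw_combine[OF this bij_betw_singletonI[of y e "Suc c"]]
  have 2: "bij_betw y E {1..Suc ?n}" using e cn by (simp add: y_def insert_absorb)
  have xs: "x u = shift c (x' u)" if "u \<in> V - {v}" for u using that by (simp add: x_def)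
  have ys: "y f = shift (Suc c) (y' f)" if "f \<in> E - {e}" for f using that by (simp add: y_def)
  have xe: "x (bv e) = c" "y e = Suc c" "x (rv e) = Suc (x' (rv e))"
    using bve rve c by (auto simp: x_def y_def shift_def)
  have old: "x' (bv f) < y' f" "y' f \<le> x' (rv f)" if "f \<in> E - {e}" for f
    using D that unfolding diag_def by blast+
  have upper: "\<not> (x' (bv f) < x' (bv g) \<and> x' (bv g) < y' f \<and> y' f < y' g)"
    and lower: "\<not> (y' f < y' g \<and> y' g \<le> x' (rv f) \<and> x' (rv f) < x' (rv g))"
    if "f \<in> E - {e}" "g \<in> E - {e}" for f g
    using D that unfolding diag_def by blast+
  show ?thesis
    unfolding diag_def n
  proof (intro conjI ballI 1 2)
    fix f assume f: "f \<in> E"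
    show "bv f \<in> V" "rv f \<in> V" using ends f by auto
    show "x (bv f) < y f" "y f \<le> x (rv f)"
      using old[of f] f ends'[of f] xs ys xe c by (cases "f = e"; simp)+
    fix g assume g: "g \<in> E"
    show "\<not> (x (bv f) < x (bv g) \<and> x (bv g) < y f \<and> y f < y g)"
    proof (cases "f = e \<or> g = e")
      case True
      then show ?thesis using xe f g xs ys ends'[of f] by (auto simp: shift_def)
    next
      case False
      then show ?thesis using upper[of f g] f g xs ys ends' by simp
    qed
    show "\<not> (y f < y g \<and> y g \<le> x (rv f) \<and> x (rv f) < x (rv g))"
    proof (cases "f = e \<or> g = e")
      case True
      have "\<not> (y e < y g \<and> y g \<le> x (rv e) \<and> x (rv e) < x (rv g))" if "g \<noteq> e"
        using that inside[of g] xe g xs[of "rv g"] ys[of g] ends'[of g]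
        by (auto simp: shift_def split: if_splits)
      moreover have "\<not> (y f < y e \<and> y e \<le> x (rv f) \<and> x (rv f) < x (rv e))" if "f \<noteq> e"
      proof
        assume a: "y f < y e \<and> y e \<le> x (rv f) \<and> x (rv f) < x (rv e)"
        have fE: "f \<in> E - {e}" using f that by simp
        have b: "y' f \<le> c" "c \<le> x' (rv f)" "x' (rv f) < x' (rv e)" "1 \<le> y' f"
          using a xe xs[of "rv f"] ys[OF fE] ends'[OF fE] old(1)[OF fE]
          by (auto simp: shift_def split: if_splits)
        then obtain h where h: "h \<in> E - {e}" "y' h = c" "x' (rv e) \<le> x' (rv h)"
          using cover by auto
        have "f \<noteq> h" using b h by auto
        then have "y' f \<noteq> y' h"
          using h(1) fE bij_betw_imp_inj_on[OF by_] inj_on_eq_iff by metis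
        then show False using lower[OF fE h(1)] b h by simp
      qed
      ultimately show ?thesis using True by blast
    next
      case False
      then show ?thesis using lower[of f g] f g xs ys ends' by simp
    qed
  qed
qed

text \<open>The point after \<open>v\<close> carries an upper arc, which can only start at \<open>v\<close>: otherwise that arc
  would separate \<open>v\<close> from the other end of its own arc.\<close>

lemma adjacent:
  assumes D: "diag V E bv rv x y"
  shows "y e = Suc (x v)"
proof (rule ccontr)
  assume ne: "y e \<noteq> Suc (x v)"
  have bx: "bij_betw x V {0..card E}" and by_: "bij_betw y E {1..card E}"
    using D by (auto simp: diag_def)
  have xye: "x v < y e" using D e bve unfolding diag_def by auto
  have "y e \<le> card E" using bij_betwE[OF by_] e by auto
  then have "Suc (x v) \<in> y ` E" using by_ xye by (auto simp: bij_betw_def)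
  then obtain g where g: "g \<in> E" "y g = Suc (x v)" by auto
  have "g \<noteq> e" using ne g by auto
  then have "bv g \<noteq> v" using only g by blast
  then have "x (bv g) \<noteq> x v"
    using bij_betw_imp_inj_on[OF bx] v ends[OF g(1)] by (auto dest: inj_onD)
  moreover have "x (bv g) < y g" using D g unfolding diag_def by auto
  ultimately have "x (bv g) < x (bv e) \<and> x (bv e) < y g \<and> y g < y e"
    using g xye ne bve by auto
  then show False using D g e unfolding diag_def by blast
qed

end

text \<open>
  Where the blue leaf goes: its lower arc must end at \<open>u\<close> in the corner between the arcs of
  \<open>P\<close> and those of \<open>Q\<close>, so it starts right after the white point number \<open>c\<close> (at the left end
  if \<open>c = 0\<close>) whose lower arc is the innermost one passing outside that corner.
\<close>

definition gap ::
  "'e set \<Rightarrow> ('e \<Rightarrow> 'v) \<Rightarrow> ('v \<Rightarrow> nat) \<Rightarrow> ('e \<Rightarrow> nat) \<Rightarrow> 'v \<Rightarrow> 'e list \<Rightarrow> 'e list \<Rightarrow> nat \<Rightarrow> bool" where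
  "gap E rv x y u P Q c \<longleftrightarrow>
     c \<le> x u \<and> (c = 0 \<or> (\<exists>g\<in>E. y g = c \<and> x u \<le> x (rv g))) \<and>
     (\<forall>f\<in>E. c < y f \<and> y f \<le> x u \<longrightarrow> x (rv f) \<le> x u) \<and>
     (\<forall>f\<in>set P. c < y f) \<and> (\<forall>f\<in>set Q. y f \<le> c)"

lemma gap_exists:
  assumes D: "diag V E bv rv x y" and "u \<in> V"
    and sorted: "sorted_wrt (>) (map y (P @ Q))" and set: "set (P @ Q) = {f \<in> E. rv f = u}"
  shows "\<exists>c. gap E rv x y u P Q c"
proof -
  \<comment> \<open>The arcs of \<open>A\<close> are those that have to stay outside the corner:
    they start before \<open>u\<close> and either pass below \<open>u\<close> or end there behind
    \<open>P\<close>. The innermost one starts last, hence the maximum; white numbers start at 1, so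
    the default 0 means that there is none.\<close>
  define A where "A = {f \<in> E. y f \<le> x u \<and> x u \<le> x (rv f) \<and> f \<notin> set P}"
  define c where "c = Max (insert 0 (y ` A))"
  have fin: "finite A" using diag_finite(2)[OF D] by (simp add: A_def)
  have max: "y f \<le> c" if "f \<in> A" for f unfolding c_def using fin that by simp
  have c: "c = 0 \<or> (\<exists>g\<in>A. y g = c)"
    using Max_in[of "insert 0 (y ` A)"] fin unfolding c_def by auto
  have PQ: "y g < y f" if "f \<in> set P" "g \<in> set Q" for f g
    using sorted that by (auto simp: sorted_wrt_append)
  have y_pos: "0 < y f \<and> y f \<le> x (rv f)" if "f \<in> E" for f
    using D that unfolding diag_def by fastforce
  have "gap E rv x y u P Q c"
    unfolding gap_def
  proof (intro conjI ballI impI)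
    show "c \<le> x u" "c = 0 \<or> (\<exists>g\<in>E. y g = c \<and> x u \<le> x (rv g))" using c by (auto simp: A_def)
  next
    fix f assume f: "f \<in> E" "c < y f \<and> y f \<le> x u"
    show "x (rv f) \<le> x u"
    proof (rule ccontr)
      assume "\<not> x (rv f) \<le> x u"
      moreover from this have "f \<notin> set P" using set by auto
      ultimately have "f \<in> A" using f by (simp add: A_def)
      then show False using max f by fastforce
    qed
  next
    fix f assume "f \<in> set P"
    then have f: "f \<in> E" "rv f = u" "f \<in> set P" using set by auto
    show "c < y f"
    proof (cases "c = 0")
      case True
      then show ?thesis using y_pos[OF f(1)] by simp
    next
      case False
      then obtain g where g: "g \<in> E" "y g = c" "y g \<le> x u" "x u \<le> x (rv g)" "g \<notin> set P"
        using c by (auto simp: A_def)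
      show ?thesis
      proof (cases "rv g = u")
        case True
        then have "g \<in> set Q" using g set by auto
        then show ?thesis using PQ f g by blast
      next
        case False
        \<comment> \<open>Now \<open>g\<close> reaches strictly beyond \<open>u\<close>, so an arc
          of \<open>P\<close> that starts before \<open>g\<close> would cross it.\<close>
        have "inj_on x V" "rv g \<in> V" using D g by (auto simp: diag_def bij_betw_def)
        then have "x u < x (rv g)" using False \<open>u \<in> V\<close> g by (metis inj_onD le_neq_implies_less)
        moreover have "y f \<noteq> y g"
          using D f g unfolding diag_def bij_betw_def by (metis inj_onD)
        ultimately show ?thesis
          using D f g unfolding diag_def by (metis linorder_neqE_nat)
      qed
    qed
  next
    fix f assume "f \<in> set Q"
    moreover from this have "f \<notin> set P" using PQ by fastforce
    ultimately have "f \<in> A" using set y_pos by (auto simp: A_def)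
    then show "y f \<le> c" using max by blast
  qed
  then show ?thesis by blast
qed

text \<open>Let \<open>c < d\<close>. The arc starting at \<open>d\<close> reaches at least
  \<open>u\<close>, and by the gap property of \<open>c\<close> it does not go further, so it ends
  at \<open>u\<close>. Being in \<open>P\<close> contradicts the gap property of \<open>d\<close>,
  being in \<open>Q\<close> that of \<open>c\<close>.\<close>

lemma gap_unique:
  assumes D: "diag V E bv rv x y" and "u \<in> V" and set: "set (P @ Q) = {f \<in> E. rv f = u}"
    and c: "gap E rv x y u P Q c" and d: "gap E rv x y u P Q d"
  shows "c = d"
proof -
  have False if c: "gap E rv x y u P Q c" and d: "gap E rv x y u P Q d" and "c < d" for c d
  proof -
    obtain g where g: "g \<in> E" "y g = d" "x u \<le> x (rv g)"
      using d \<open>c < d\<close> unfolding gap_def by auto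
    then have "x (rv g) \<le> x u" using c d \<open>c < d\<close> unfolding gap_def by auto
    then have "x (rv g) = x u" using g by simp
    moreover have "inj_on x V" "rv g \<in> V" using D g by (auto simp: diag_def bij_betw_def)
    ultimately have "rv g = u" using \<open>u \<in> V\<close> by (auto dest: inj_onD)
    then have "g \<in> set P \<or> g \<in> set Q" using g set by auto
    then show False using c d g \<open>c < d\<close> unfolding gap_def by fastforce
  qed
  then show ?thesis using c d by (metis linorder_neqE_nat)
qed

section \<open>The place of a leaf is determined by its colored graph\<close>

context blue_leaf
begin

lemma colored_graph_delete:
  assumes C: "colored_graph V E bv rv bl rl" and PQ: "rl (rv e) = P @ e # Q"
  shows "colored_graph (V - {v}) (E - {e}) bv rv bl (rl(rv e := P @ Q))"
  unfolding colored_graph_def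
proof (intro conjI ballI)
  fix f assume "f \<in> E - {e}"
  then show "bv f \<in> V - {v}" "rv f \<in> V - {v}" using ends' by auto
next
  fix w assume w: "w \<in> V - {v}"
  have c: "distinct (bl w)" "set (bl w) = {e \<in> E. bv e = w}"
    "distinct (rl w)" "set (rl w) = {e \<in> E. rv e = w}"
    using C w by (auto simp: colored_graph_def)
  show "distinct (bl w)" "set (bl w) = {f \<in> E - {e}. bv f = w}" using c w bve by auto
  show "distinct ((rl(rv e := P @ Q)) w)" using c PQ by auto
  show "set ((rl(rv e := P @ Q)) w) = {f \<in> E - {e}. rv f = w}"
  proof (cases "w = rv e")
    case True
    then have "set (P @ e # Q) = {f \<in> E. rv f = rv e}" "e \<notin> set P \<union> set Q"
      using c PQ by auto
    with True show ?thesis by auto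
  qed (use c in auto)
qed

lemma lists_delete:
  assumes "colored_graph V E bv rv bl rl" "rl (rv e) = P @ e # Q"
  shows "set (P @ Q) = {f \<in> E - {e}. rv f = rv e}"
proof -
  have "rv e \<in> V - {v}" using rve by simp
  then have "set ((rl(rv e := P @ Q)) (rv e)) = {f \<in> E - {e}. rv f = rv e}"
    using colored_graph_delete[where P = P and Q = Q, OF assms] unfolding colored_graph_def by blast
  then show ?thesis by simp
qed

lemma leaf_lists:
  assumes "colored_graph V E bv rv bl rl"
  shows "bl v = [e]" "rl v = []"
proof -
  have "{f \<in> E. bv f = v} = {e}" "{f \<in> E. rv f = v} = {}"
    using e bve rve(1) only by blast+
  then have *: "distinct (bl v)" "set (bl v) = {e}" "set (rl v) = {}"
    using assms v unfolding colored_graph_def by simp_all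
  from *(3) show "rl v = []" by simp
  from *(1,2) show "bl v = [e]" by (cases "bl v"; cases "tl (bl v)") auto
qed

text \<open>The two conditions of \<open>gap\<close> on passing arcs express that no lower arc
  crosses the arc of \<open>e\<close>; those on \<open>P\<close> and \<open>Q\<close> express the
  order of the arcs at \<open>rv e\<close>. So the old place of the leaf can be recognized after its
  removal.\<close>

lemma gap_delete:
  assumes C: "colored_graph V E bv rv bl rl" and PQ: "rl (rv e) = P @ e # Q"
    and D: "diag V E bv rv x y" and O: "arcs_ordered V bl rl y"
  defines "x' \<equiv> \<lambda>u. unshift (x v) (x u)" and "y' \<equiv> \<lambda>f. unshift (Suc (x v)) (y f)"
  shows "gap (E - {e}) rv x' y' (rv e) P Q (x v)"
    and "arcs_ordered (V - {v}) bl (rl(rv e := P @ Q)) y'"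
proof -
  note y = adjacent[OF D]
  have del: "diag (V - {v}) (E - {e}) bv rv x' y'"
    "\<And>u. u \<in> V - {v} \<Longrightarrow> x u = shift (x v) (x' u)"
    "\<And>f. f \<in> E - {e} \<Longrightarrow> y f = shift (Suc (x v)) (y' f)"
    using delete[OF D y] unfolding x'_def y'_def by blast+
  have bx: "bij_betw x V {0..card E}" and by_: "bij_betw y E {1..card E}"
    using D by (auto simp: diag_def)
  have rv_neq: "x (rv f) \<noteq> x v" if "f \<in> E" for f
  proof -
    have "rv f \<noteq> v" using only[OF that] rve by auto
    then show ?thesis using bij_betw_imp_inj_on[OF bx] ends[OF that] v by (auto dest: inj_onD)
  qed
  have yx: "y f \<le> x (rv f)" if "f \<in> E" for f using D that by (auto simp: diag_def)
  have su: "x (rv e) = shift (x v) (x' (rv e))" using del(2)[of "rv e"] rve by blast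
  have lt: "x v < x (rv e)" using yx[OF e] y by simp
  have set: "set (P @ e # Q) \<subseteq> E"
    using C rve PQ unfolding colored_graph_def by fastforce
  have sorted: "sorted_wrt (>) (map y (P @ e # Q))"
    using O rve PQ unfolding arcs_ordered_def by metis
  have dist: "distinct (P @ e # Q)" using C rve PQ unfolding colored_graph_def by metis
  show "gap (E - {e}) rv x' y' (rv e) P Q (x v)"
    unfolding gap_def
  proof (intro conjI ballI impI)
    show "x v \<le> x' (rv e)" using lt su by (auto simp: shift_def split: if_splits)
    show "x v = 0 \<or> (\<exists>g\<in>E - {e}. y' g = x v \<and> x' (rv e) \<le> x' (rv g))"
    proof (cases "x v = 0")
      case False
      have "x v \<le> card E" using bij_betwE[OF bx] v by auto
      then have "x v \<in> y ` E" using by_ False by (auto simp: bij_betw_def)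
      \<comment> \<open>The white point just left of \<open>v\<close> has number \<open>x v\<close>.
        Its lower arc passes below \<open>v\<close>, which has no lower arc, and it would cross the
        arc of \<open>e\<close> if it ended before \<open>rv e\<close>.\<close>
      then obtain g where g: "g \<in> E" "y g = x v" by auto
      then have ge: "g \<in> E - {e}" using y by auto
      have "x v < x (rv g)" using yx[OF g(1)] rv_neq[OF g(1)] g by simp
      then have "\<not> x (rv g) < x (rv e)"
        using D g e y unfolding diag_def by (metis Suc_leI lessI)
      then have "x' (rv e) \<le> x' (rv g)"
        using del(2)[of "rv g"] su ends'[OF ge] by (simp add: not_less[symmetric])
      moreover have "y' g = x v" using g by (simp add: y'_def unshift_def)
      ultimately show ?thesis using ge by blast
    qed simp
  next
    fix f assume f: "f \<in> E - {e}" "x v < y' f \<and> y' f \<le> x' (rv e)"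
    then have "Suc (x v) < y f" "y f \<le> x (rv e)"
      using del(3)[OF f(1)] su by (auto simp: shift_def)
    then have "\<not> x (rv e) < x (rv f)"
      using D e f(1) y unfolding diag_def by (metis DiffD1)
    then show "x' (rv f) \<le> x' (rv e)"
      using del(2)[of "rv f"] su ends'[OF f(1)] by (simp add: not_less[symmetric])
  next
    fix f assume f: "f \<in> set P"
    then have "y f > Suc (x v)" "f \<in> E - {e}" using sorted y set dist by (auto simp: sorted_wrt_append)
    then show "x v < y' f" by (auto simp: y'_def unshift_def)
  next
    fix f assume f: "f \<in> set Q"
    then have "y f < Suc (x v)" "f \<in> E - {e}" using sorted y set dist by (auto simp: sorted_wrt_append)
    then show "y' f \<le> x v" by (auto simp: y'_def unshift_def)
  qed
  have mono: "y' f < y' g" if "y f < y g" "f \<in> E - {e}" "g \<in> E - {e}" for f g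
    using that del(3) by (metis shift_less_shift(1))
  have sw: "sorted_wrt (<) (map y' l)" if "sorted_wrt (<) (map y l)" "set l \<subseteq> E - {e}" for l
    using that(1) unfolding sorted_wrt_map
    by (rule sorted_wrt_mono_rel[rotated]) (use that(2) mono in blast)
  have sw': "sorted_wrt (>) (map y' l)" if "sorted_wrt (>) (map y l)" "set l \<subseteq> E - {e}" for l
    using that(1) unfolding sorted_wrt_map
    by (rule sorted_wrt_mono_rel[rotated]) (use that(2) mono in blast)
  have sorted': "sorted_wrt (>) (map y (P @ Q))" using sorted by (auto simp: sorted_wrt_append)
  show "arcs_ordered (V - {v}) bl (rl(rv e := P @ Q)) y'"
    unfolding arcs_ordered_def
  proof (intro ballI conjI)
    fix w assume w: "w \<in> V - {v}"
    note C' = colored_graph_delete[where P = P and Q = Q, OF C PQ, unfolded colored_graph_def]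
    have s: "set (bl w) \<subseteq> E - {e}" "set ((rl(rv e := P @ Q)) w) \<subseteq> E - {e}" using C' w by blast+
    have o: "sorted_wrt (<) (map y (bl w))" "sorted_wrt (>) (map y (rl w))"
      using O w by (auto simp: arcs_ordered_def)
    show "sorted_wrt (<) (map y' (bl w))" using sw o s by blast
    have "sorted_wrt (>) (map y ((rl(rv e := P @ Q)) w))"
      using o(2) sorted' by simp
    then show "sorted_wrt (>) (map y' ((rl(rv e := P @ Q)) w))" using sw' s by blast
  qed
qed

text \<open>The gap is taken from \<open>gap_exists\<close>. Its conditions on passing arcs are what
  \<open>insert\<close> requires, and those on \<open>P\<close> and \<open>Q\<close> put
  \<open>e\<close> at its prescribed position among the lower arcs of \<open>rv e\<close>.\<close>

lemma arrangement_insert: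
  assumes C: "colored_graph V E bv rv bl rl" and PQ: "rl (rv e) = P @ e # Q"
    and D: "diag (V - {v}) (E - {e}) bv rv x' y'"
    and O: "arcs_ordered (V - {v}) bl (rl(rv e := P @ Q)) y'"
  shows "\<exists>x y. diag V E bv rv x y \<and> arcs_ordered V bl rl y"
proof -
  note C' = colored_graph_delete[where P = P and Q = Q, OF C PQ, unfolded colored_graph_def]
  have u: "rv e \<in> V - {v}" using rve by simp
  have sorted: "sorted_wrt (>) (map y' (P @ Q))"
    using O u unfolding arcs_ordered_def by (metis fun_upd_same)
  have set: "set (P @ Q) = {f \<in> E - {e}. rv f = rv e}"
    using lists_delete[OF C PQ] .
  obtain c where c: "gap (E - {e}) rv x' y' (rv e) P Q c"
    using gap_exists[OF D u sorted set] by blast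
  define x where "x = (\<lambda>u. if u = v then c else shift c (x' u))"
  define y where "y = (\<lambda>f. if f = e then Suc c else shift (Suc c) (y' f))"
  have "diag V E bv rv x y"
    unfolding x_def y_def by (rule insert[OF D]) (use c in \<open>auto simp: gap_def\<close>)
  moreover have "arcs_ordered V bl rl y"
    unfolding arcs_ordered_def
  proof (intro ballI)
    fix w assume w: "w \<in> V"
    have sw: "map y l = map (shift (Suc c)) (map y' l)" if "set l \<subseteq> E - {e}" for l
      using that by (auto simp: y_def)
    have shift_lt: "sorted_wrt (<) (map (shift (Suc c)) l)" if "sorted_wrt (<) l" for l
      using that by (simp add: sorted_wrt_map)
    have shift_gt: "sorted_wrt (>) (map (shift (Suc c)) l)" if "sorted_wrt (>) l" for l
      using that by (simp add: sorted_wrt_map)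
    show "sorted_wrt (<) (map y (bl w)) \<and> sorted_wrt (>) (map y (rl w))"
    proof (cases "w = v")
      case True
      then show ?thesis using leaf_lists[OF C] by simp
    next
      case False
      then have w': "w \<in> V - {v}" using w by simp
      have s: "set (bl w) \<subseteq> E - {e}" "set ((rl(rv e := P @ Q)) w) \<subseteq> E - {e}" using C' w' by blast+
      have o: "sorted_wrt (<) (map y' (bl w))" "sorted_wrt (>) (map y' ((rl(rv e := P @ Q)) w))"
        using O w' by (auto simp: arcs_ordered_def)
      have r: "sorted_wrt (>) (map y ((rl(rv e := P @ Q)) w))"
        using shift_gt[OF o(2)] unfolding sw[OF s(2), symmetric] .
      have "sorted_wrt (>) (map y (rl w))"
      proof (cases "w = rv e")
        case True
        have "y f > Suc c" if "f \<in> set P" for f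
        proof -
          have "f \<in> E - {e}" using that set by auto
          then show ?thesis using that c by (auto simp: gap_def y_def shift_def)
        qed
        moreover have "y f < Suc c" if "f \<in> set Q" for f
        proof -
          have "f \<in> E - {e}" using that set by auto
          then show ?thesis using that c by (auto simp: gap_def y_def shift_def)
        qed
        moreover have "y e = Suc c" by (simp add: y_def)
        ultimately show ?thesis
          using r True PQ by (auto simp: sorted_wrt_append)
      qed (use r in simp)
      moreover have "sorted_wrt (<) (map y (bl w))"
        using shift_lt[OF o(1)] unfolding sw[OF s(1), symmetric] .
      ultimately show ?thesis by blast
    qed
  qed
  ultimately show ?thesis by blast
qed

text \<open>Both diagrams shrink to the same smaller one by \<open>IH\<close>, and in each the leaf
  occupies a gap of it, so uniqueness of the gap applies.\<close>

lemma arrangement_determined: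
  assumes C: "colored_graph V E bv rv bl rl" and PQ: "rl (rv e) = P @ e # Q"
    and 1: "diag V E bv rv x1 y1" "arcs_ordered V bl rl y1"
    and 2: "diag V E bv rv x2 y2" "arcs_ordered V bl rl y2"
    and IH: "\<And>x1 y1 x2 y2.
      diag (V - {v}) (E - {e}) bv rv x1 y1 \<Longrightarrow> arcs_ordered (V - {v}) bl (rl(rv e := P @ Q)) y1 \<Longrightarrow>
      diag (V - {v}) (E - {e}) bv rv x2 y2 \<Longrightarrow> arcs_ordered (V - {v}) bl (rl(rv e := P @ Q)) y2 \<Longrightarrow>
      (\<forall>u\<in>V - {v}. x1 u = x2 u) \<and> (\<forall>f\<in>E - {e}. y1 f = y2 f)"
  shows "(\<forall>u\<in>V. x1 u = x2 u) \<and> (\<forall>f\<in>E. y1 f = y2 f)"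
proof -
  note C' = colored_graph_delete[where P = P and Q = Q, OF C PQ, unfolded colored_graph_def]
  note a1 = adjacent[OF 1(1)] and a2 = adjacent[OF 2(1)]
  note d1 = delete[OF 1(1) a1] and d2 = delete[OF 2(1) a2]
  note g1 = gap_delete[where P = P and Q = Q, OF C PQ 1] and g2 = gap_delete[where P = P and Q = Q, OF C PQ 2]
  have eq: "\<And>u. u \<in> V - {v} \<Longrightarrow> unshift (x1 v) (x1 u) = unshift (x2 v) (x2 u)"
    "\<And>f. f \<in> E - {e} \<Longrightarrow> unshift (Suc (x1 v)) (y1 f) = unshift (Suc (x2 v)) (y2 f)"
    using IH[OF d1(1) g1(2) d2(1) g2(2)] by blast+
  have u: "rv e \<in> V - {v}" using rve by simp
  have set: "set (P @ Q) = {f \<in> E - {e}. rv f = rv e}"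
    using lists_delete[OF C PQ] .
  then have sub: "f \<in> E - {e}" if "f \<in> set P \<or> f \<in> set Q" for f using that by auto
  \<comment> \<open>The two reduced diagrams agree, so the place of \<open>v\<close> in the second
    diagram is also a gap of the first reduced one.\<close>
  have "gap (E - {e}) rv (\<lambda>u. unshift (x1 v) (x1 u)) (\<lambda>f. unshift (Suc (x1 v)) (y1 f))
    (rv e) P Q (x2 v)"
    using g2(1) eq u sub ends' unfolding gap_def by simp
  then have v: "x1 v = x2 v"
    using gap_unique[OF d1(1) u set g1(1)] by blast
  then have "x1 u = x2 u" if "u \<in> V - {v}" for u using eq(1)[OF that] d1(2) d2(2) that by metis
  moreover have "y1 f = y2 f" if "f \<in> E - {e}" for f using eq(2)[OF that] v d1(3) d2(3) that by metis
  ultimately show ?thesis using v a1 a2 by (metis Diff_iff singletonD)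
qed

end

section \<open>Induction on colored trees\<close>

lemma pendant_blue_leaf:
  assumes C: "colored_graph V E bv rv bl rl" and T: "is_tree V E (\<lambda>e. {bv e, rv e})"
    and p: "pendant E (\<lambda>e. {bv e, rv e}) v e u" and "v \<in> V" "bv e = v"
  shows "blue_leaf V E bv rv v e" "rv e = u"
proof -
  show u: "rv e = u" using p \<open>bv e = v\<close> by (auto simp: pendant_def doubleton_eq_iff)
  show "blue_leaf V E bv rv v e"
    by unfold_locales
      (use assms u in \<open>auto simp: pendant_def colored_graph_def is_tree_def\<close>)
qed

lemma colored_graph_swap: "colored_graph V E bv rv bl rl \<Longrightarrow> colored_graph V E rv bv rl bl"
  by (auto simp: colored_graph_def)

text \<open>A leaf whose half-edge is red becomes blue after exchanging the colors, which is the
  purpose of \<open>swap\<close>. The red list of the neighbour is split at \<open>e\<close> because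
  the position of \<open>e\<close> between \<open>P\<close> and \<open>Q\<close> is needed to put
  the leaf back.\<close>

lemma colored_tree_induct [consumes 2, case_names single leaf swap]:
  assumes "colored_graph V E bv rv bl rl" "is_tree V E (\<lambda>e. {bv e, rv e})"
    and single: "\<And>V E bv rv bl rl v. V = {v} \<Longrightarrow> E = {} \<Longrightarrow> colored_graph V E bv rv bl rl \<Longrightarrow>
      R V E bv rv bl rl"
    and leaf: "\<And>V E bv rv bl rl v e P Q. blue_leaf V E bv rv v e \<Longrightarrow>
      colored_graph V E bv rv bl rl \<Longrightarrow> rl (rv e) = P @ e # Q \<Longrightarrow>
      R (V - {v}) (E - {e}) bv rv bl (rl(rv e := P @ Q)) \<Longrightarrow> R V E bv rv bl rl"
    and swap: "\<And>V E bv rv bl rl. colored_graph V E bv rv bl rl \<Longrightarrow>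
      R V E rv bv rl bl \<Longrightarrow> R V E bv rv bl rl"
  shows "R V E bv rv bl rl"
  using assms(1,2)
proof (induction "card V" arbitrary: V E bv rv bl rl rule: less_induct)
  case less
  note T = less.prems(2)
  have fin: "finite V" using T by (simp add: is_tree_def)
  show ?case
  proof (cases "card V \<ge> 2")
    case True
    then obtain v e u where p: "v \<in> V" "u \<in> V" "pendant E (\<lambda>e. {bv e, rv e}) v e u"
      using tree_obtains_pendant[OF T] by metis
    have step: "R V E bv rv bl rl"
      if C: "colored_graph V E bv rv bl rl" and T: "is_tree V E (\<lambda>e. {bv e, rv e})"
        and p': "pendant E (\<lambda>e. {bv e, rv e}) v e u" and b: "bv e = v" for bv rv bl rl
    proof -
      note L = pendant_blue_leaf[OF C T p' p(1) b]
      have "e \<in> set (rl (rv e))"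
        using C L(2) p(2) p' unfolding colored_graph_def pendant_def by auto
      then obtain P Q where PQ: "rl (rv e) = P @ e # Q" by (metis split_list)
      have "card (V - {v}) < card V" using fin p(1) by (rule card_Diff1_less)
      from less.hyps[OF this blue_leaf.colored_graph_delete[OF L(1) C PQ] tree_delete_pendant[OF T p']]
      show ?thesis using leaf[OF L(1) C PQ] by blast
    qed
    from p(3) consider "bv e = v" | "rv e = v" by (auto simp: pendant_def doubleton_eq_iff)
    then show ?thesis
    proof cases
      case 1
      then show ?thesis using step less.prems p(3) by blast
    next
      case 2
      have "(\<lambda>e. {bv e, rv e}) = (\<lambda>e. {rv e, bv e})" by (auto simp: insert_commute)
      then show ?thesis
        using step[OF colored_graph_swap[OF less.prems(1)], of ] T p(3) 2 swap[OF less.prems(1)]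
        by (simp add: insert_commute)
    qed
  next
    case False
    then have "card V = 1"
      using T fin by (simp add: is_tree_def not_le less_Suc_eq numeral_2_eq_2)
    then obtain v where "V = {v}" by (auto simp: card_1_singleton_iff)
    moreover have "E = {}" using tree_card[OF T] \<open>card V = 1\<close> T by (simp add: is_tree_def)
    ultimately show ?thesis using single less.prems(1) by blast
  qed
qed

theorem arrangement_exists:
  assumes "colored_graph V E bv rv bl rl" "is_tree V E (\<lambda>e. {bv e, rv e})"
  shows "\<exists>x y. diag V E bv rv x y \<and> arcs_ordered V bl rl y"
  using assms
proof (induction rule: colored_tree_induct)
  case (single V E bv rv bl rl v)
  then have "diag V E bv rv (\<lambda>_. 0) (\<lambda>_. 0)" "arcs_ordered V bl rl (\<lambda>_. 0)"
    by (auto simp: diag_def arcs_ordered_def colored_graph_def bij_betw_def)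
  then show ?case by blast
next
  case (leaf V E bv rv bl rl v e P Q)
  then show ?case using blue_leaf.arrangement_insert by metis
next
  case (swap V E bv rv bl rl)
  then show ?case
    using diag_rotate arcs_ordered_rotate colored_graph_swap by metis
qed

theorem arrangement_unique:
  assumes "colored_graph V E bv rv bl rl" "is_tree V E (\<lambda>e. {bv e, rv e})"
    and "diag V E bv rv x1 y1" "arcs_ordered V bl rl y1"
    and "diag V E bv rv x2 y2" "arcs_ordered V bl rl y2"
  shows "(\<forall>u\<in>V. x1 u = x2 u) \<and> (\<forall>f\<in>E. y1 f = y2 f)"
  using assms
proof (induction arbitrary: x1 y1 x2 y2 rule: colored_tree_induct)
  case (single V E bv rv bl rl v)
  then show ?case by (simp add: diag_def bij_betw_def)
next
  case (leaf V E bv rv bl rl v e P Q)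
  show ?case
    by (rule blue_leaf.arrangement_determined[OF leaf(1-3) leaf(5-8)]) (rule leaf.IH)
next
  case (swap V E bv rv bl rl)
  let ?n = "card E"
  have eq: "(\<forall>u\<in>V. ?n - x1 u = ?n - x2 u) \<and> (\<forall>f\<in>E. Suc ?n - y1 f = Suc ?n - y2 f)"
    by (rule swap.IH) (rule diag_rotate arcs_ordered_rotate swap)+
  \<comment> \<open>Equality of the reflected numbers can be undone only within these bounds, the
    subtraction being truncated.\<close>
  have bounds: "x u \<le> ?n" "f \<in> E \<Longrightarrow> y f \<le> ?n"
    if "diag V E bv rv x y" "u \<in> V" for x y u f
    using that bij_betwE[of x V "{0..?n}"] bij_betwE[of y E "{1..?n}"] by (auto simp: diag_def)
  show ?case
  proof (intro conjI ballI)
    show "x1 u = x2 u" if "u \<in> V" for u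
      using eq that bounds(1)[OF swap.prems(1) that] bounds(1)[OF swap.prems(3) that]
      by (metis diff_diff_cancel)
    show "y1 f = y2 f" if "f \<in> E" for f
    proof -
      have "bv f \<in> V" using swap.hyps that by (simp add: colored_graph_def)
      then show ?thesis
        using eq that bounds(2)[OF swap.prems(1) _ that] bounds(2)[OF swap.prems(3) _ that]
        by (metis diff_diff_cancel le_SucI)
    qed
  qed
qed

section \<open>Trees and conflicts\<close>

definition no_conflict ::
  "'e set \<Rightarrow> ('e \<Rightarrow> 'v) \<Rightarrow> ('e \<Rightarrow> 'v) \<Rightarrow> ('v \<Rightarrow> nat) \<Rightarrow> ('e \<Rightarrow> nat) \<Rightarrow> bool" where
  "no_conflict E bv rv x y \<longleftrightarrow>
     (\<forall>e\<in>E. \<forall>f\<in>E. \<not> (y e < y f \<and> y f \<le> x (rv e) \<and> x (bv f) < y e))"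

text \<open>
  In a conflict \<open>(e, f)\<close> with \<open>y f - y e\<close> minimal, the upper arc of \<open>f\<close> and the lower arc of
  \<open>e\<close> cut off the black points between \<open>e\<close> and \<open>f\<close> from the others.
\<close>

lemma tree_no_conflict:
  assumes D: "diag V E bv rv x y" and T: "is_tree V E (\<lambda>e. {bv e, rv e})"
  shows "no_conflict E bv rv x y"
proof (rule ccontr)
  define conf where
    "conf e f \<longleftrightarrow> e \<in> E \<and> f \<in> E \<and> y e < y f \<and> y f \<le> x (rv e) \<and> x (bv f) < y e" for e f
  assume "\<not> no_conflict E bv rv x y"
  then obtain p where "conf (fst p) (snd p)" by (auto simp: no_conflict_def conf_def)
  from ex_has_least_nat[where P = "\<lambda>p. conf (fst p) (snd p)" and m = "\<lambda>p. y (snd p) - y (fst p)", OF this]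
  obtain e f where ef: "conf e f" and min: "\<And>e' f'. conf e' f' \<Longrightarrow> y f - y e \<le> y f' - y e'"
    by (metis fst_conv snd_conv)
  have e: "e \<in> E" and f: "f \<in> E" and c: "y e < y f" "y f \<le> x (rv e)" "x (bv f) < y e"
    using ef by (auto simp: conf_def)
  have bx: "bij_betw x V {0..card E}" and by_: "bij_betw y E {1..card E}"
    using D by (auto simp: diag_def)
  have arc: "bv g \<in> V \<and> rv g \<in> V \<and> x (bv g) < y g \<and> y g \<le> x (rv g)" if "g \<in> E" for g
    using D that by (auto simp: diag_def)
  have upper: "\<not> (x (bv g) < x (bv h) \<and> x (bv h) < y g \<and> y g < y h)"
    and lower: "\<not> (y g < y h \<and> y h \<le> x (rv g) \<and> x (rv g) < x (rv h))"
    if "g \<in> E" "h \<in> E" for g h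
    using D that unfolding diag_def by blast+
  have inj: "g = h" if "y g = y h" "g \<in> E" "h \<in> E" for g h
    using by_ that by (auto simp: bij_betw_def dest: inj_onD)
  define B where "B = {u \<in> V. y e \<le> x u \<and> x u < y f}"
  \<comment> \<open>An upper arc of \<open>g\<close> starting in \<open>B\<close> cannot cross that
    of \<open>f\<close>, so the white point of \<open>g\<close> lies between \<open>e\<close> and
    \<open>f\<close>; were the red end of \<open>g\<close> beyond \<open>f\<close>, then
    \<open>(g, f)\<close> would be a closer conflict. The converse is symmetric, with the closer
    conflict \<open>(e, g)\<close>.\<close>
  have closed: "bv g \<in> B \<longleftrightarrow> rv g \<in> B" if g: "g \<in> E" for g
  proof
    assume "bv g \<in> B"
    then have b: "y e \<le> x (bv g)" "x (bv g) < y f" by (auto simp: B_def)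
    have "g \<noteq> f" using b c by auto
    moreover have "\<not> y f < y g" using upper[OF f g] b c by auto
    ultimately have yg: "y e < y g" "y g < y f" using b arc[OF g] inj[OF _ g f] by linarith+
    have "\<not> y f \<le> x (rv g)"
    proof
      assume "y f \<le> x (rv g)"
      then have "conf g f" using g f yg c by (simp add: conf_def)
      from min[OF this] yg show False by simp
    qed
    then show "rv g \<in> B" using yg arc[OF g] by (simp add: B_def)
  next
    assume "rv g \<in> B"
    then have b: "y e \<le> x (rv g)" "x (rv g) < y f" by (auto simp: B_def)
    have "g \<noteq> e" using b c by auto
    moreover have "\<not> y g < y e" using lower[OF g e] b c by auto
    ultimately have yg: "y e < y g" "y g < y f" using b arc[OF g] inj[OF _ g e] by linarith+
    have "\<not> x (bv g) < y e"
    proof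
      assume "x (bv g) < y e"
      then have "conf e g" using g e yg c by (simp add: conf_def)
      from min[OF this] yg show False by simp
    qed
    then show "bv g \<in> B" using yg arc[OF g] by (simp add: B_def)
  qed
  \<comment> \<open>The black point right after \<open>e\<close> lies in \<open>B\<close> and the
    black point 0 does not, although a walk joins them.\<close>
  have ye: "1 \<le> y e" "y e \<le> card E" using bij_betwE[OF by_] e by auto
  then have "y e \<in> x ` V" "0 \<in> x ` V" using bx by (auto simp: bij_betw_def)
  then obtain u w where u: "u \<in> V" "x u = y e" and w: "w \<in> V" "x w = 0" by force
  have "(u, w) \<in> {(x, y). \<exists>g\<in>E. {bv g, rv g} = {x, y}}\<^sup>*"
    using T u w unfolding is_tree_def by blast
  then have "w \<in> B"
  proof (induction rule: rtrancl_induct)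
    case base
    show ?case using u c by (simp add: B_def)
  next
    case (step a b)
    then show ?case using closed by (auto simp: doubleton_eq_iff)
  qed
  then show False using w ye by (simp add: B_def)
qed

lemma no_conflict_leaf:
  assumes D: "diag V E bv rv x y" and N: "no_conflict E bv rv x y" and "E \<noteq> {}"
  obtains v e where "v \<in> V" "e \<in> E" "bv e = v \<or> rv e = v"
    "\<forall>f\<in>E. bv f = v \<or> rv f = v \<longrightarrow> f = e"
proof -
  note fin = diag_finite[OF D]
  have bx: "bij_betw x V {0..card E}" and by_: "bij_betw y E {1..card E}"
    using D by (auto simp: diag_def)
  have arc: "bv g \<in> V \<and> rv g \<in> V \<and> x (bv g) < y g \<and> y g \<le> x (rv g)" if "g \<in> E" for g
    using D that by (auto simp: diag_def)
  have inj: "a = b" if "x a = x b" "a \<in> V" "b \<in> V" for a b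
    using bx that by (auto simp: bij_betw_def dest: inj_onD)
  have wh: "\<exists>g\<in>E. y g = t" if "1 \<le> t" "t \<le> card E" for t
  proof -
    have "t \<in> y ` E" using by_ that by (simp add: bij_betw_def)
    then show ?thesis by auto
  qed
  \<comment> \<open>If \<open>v\<close> had no arc, the lower arc of its left white neighbour and
    the upper arc of its right one would both pass \<open>v\<close> and be in conflict. At the left
    end, the upper arc of white point 1 can only reach black point 0; at the right end, the lower
    arc of the last white point has to end at \<open>v\<close>.\<close>
  have deg: "\<exists>e\<in>E. bv e = v \<or> rv e = v" if v: "v \<in> V" for v
  proof (rule ccontr)
    assume no: "\<not> ?thesis"
    have "card E > 0" using \<open>E \<noteq> {}\<close> fin by (simp add: card_gt_0_iff)
    have xv: "x v \<le> card E" using bij_betwE[OF bx] v by auto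
    have nb: "x (bv g) \<noteq> x v" "x (rv g) \<noteq> x v" if "g \<in> E" for g
      using no inj arc[OF that] v that by metis+
    have "x v \<noteq> 0"
    proof
      assume "x v = 0"
      obtain g where "g \<in> E" "y g = 1" using wh[of 1] \<open>card E > 0\<close> by auto
      then show False using nb(1)[of g] arc[of g] \<open>x v = 0\<close> by simp
    qed
    then obtain h where h: "h \<in> E" "y h = x v" using wh[of "x v"] xv by auto
    then have hx: "x v < x (rv h)" using nb(2)[of h] arc[of h] by simp
    moreover have "x (rv h) \<le> card E" using bij_betwE[OF bx] arc[OF h(1)] by auto
    ultimately obtain g where g: "g \<in> E" "y g = Suc (x v)" using wh[of "Suc (x v)"] by auto
    then have "x (bv g) < x v" using nb(1)[of g] arc[of g] by simp
    then show False using N g h hx unfolding no_conflict_def by fastforce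
  qed
  let ?d = "\<lambda>v. card {e \<in> E. bv e = v} + card {e \<in> E. rv e = v}"
  have "(\<Sum>v\<in>V. card {e \<in> E. bv e = v}) = card E" "(\<Sum>v\<in>V. card {e \<in> E. rv e = v}) = card E"
    using sum.group[OF fin(2,1), of bv "\<lambda>_. 1::nat"] sum.group[OF fin(2,1), of rv "\<lambda>_. 1::nat"] arc
    by (simp_all add: image_subset_iff)
  then have sum: "sum ?d V = 2 * card E" by (simp add: sum.distrib)
  \<comment> \<open>The degrees add up to \<open>2 * card E\<close> over \<open>card E + 1\<close>
    vertices, so their average is below 2.\<close>
  have "\<exists>v\<in>V. ?d v < 2"
  proof (rule ccontr)
    assume "\<not> ?thesis"
    then have "sum (\<lambda>_. 2) V \<le> sum ?d V" by (intro sum_mono) (simp add: not_less)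
    with sum fin show False by simp
  qed
  then obtain v where v: "v \<in> V" "?d v < 2" by blast
  obtain e where e: "e \<in> E" "bv e = v \<or> rv e = v" using deg v by blast
  let ?A = "{e \<in> E. bv e = v \<or> rv e = v}"
  have "?A = {e \<in> E. bv e = v} \<union> {e \<in> E. rv e = v}" by auto
  then have "card ?A \<le> Suc 0" using v(2) card_Un_le[of "{e \<in> E. bv e = v}" "{e \<in> E. rv e = v}"] by simp
  then have "\<forall>f\<in>E. bv f = v \<or> rv f = v \<longrightarrow> f = e"
    using e fin(2) card_le_Suc0_iff_eq[of ?A] by auto
  with v e that show thesis by blast
qed

text \<open>The half turn exchanges the two arcs of a conflict, so a conflict \<open>(e, f)\<close>
  after it comes from the conflict \<open>(f, e)\<close> before it.\<close>

lemma no_conflict_rotate: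
  assumes D: "diag V E bv rv x y" and N: "no_conflict E bv rv x y"
  shows "no_conflict E rv bv (\<lambda>v. card E - x v) (\<lambda>e. Suc (card E) - y e)"
  unfolding no_conflict_def
proof (intro ballI)
  fix e f assume ef: "e \<in> E" "f \<in> E"
  have "x (bv g) \<le> card E \<and> x (rv g) \<le> card E \<and> 1 \<le> y g \<and> y g \<le> card E" if "g \<in> E" for g
    using D that bij_betwE[of x V "{0..card E}"] bij_betwE[of y E "{1..card E}"]
    by (auto simp: diag_def)
  note ef[THEN this]
  moreover have "\<not> (y f < y e \<and> y e \<le> x (rv f) \<and> x (bv e) < y f)"
    using N ef by (auto simp: no_conflict_def)
  ultimately show "\<not> (Suc (card E) - y e < Suc (card E) - y f \<and>
      Suc (card E) - y f \<le> card E - x (bv e) \<and> card E - x (rv f) < Suc (card E) - y e)"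
    by linarith
qed

theorem no_conflict_tree:
  assumes "diag V E bv rv x y" "no_conflict E bv rv x y"
  shows "is_tree V E (\<lambda>e. {bv e, rv e})"
  using assms
proof (induction "card V" arbitrary: V E bv rv x y rule: less_induct)
  case less
  note D = less.prems(1)
  note fin = diag_finite[OF D]
  show ?case
  proof (cases "E = {}")
    case True
    then have "card V = 1" using fin by simp
    then obtain v where "V = {v}" by (auto simp: card_1_singleton_iff)
    then show ?thesis using True by (auto simp: is_tree_def is_cycle_def)
  next
    case False
    obtain v e where ve: "v \<in> V" "e \<in> E" "bv e = v \<or> rv e = v"
      "\<forall>f\<in>E. bv f = v \<or> rv f = v \<longrightarrow> f = e"
      using no_conflict_leaf[OF less.prems False] .
    have step: "is_tree V E (\<lambda>e. {bv e, rv e})"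
      if D: "diag V E bv rv x y" and N: "no_conflict E bv rv x y" and b: "bv e = v"
        and only: "\<And>f. f \<in> E \<Longrightarrow> bv f = v \<or> rv f = v \<Longrightarrow> f = e" for bv rv x y
    proof -
      have ends: "bv f \<in> V \<and> rv f \<in> V" if "f \<in> E" for f using D that by (auto simp: diag_def)
      \<comment> \<open>The white point separates the two ends of its edge, so the edge is not a
        loop.\<close>
      have "x (bv e) < x (rv e)" using D ve(2) by (fastforce simp: diag_def)
      then have "rv e \<noteq> v" using b by auto
      interpret blue_leaf V E bv rv v e
        by unfold_locales (use ve fin ends only b \<open>rv e \<noteq> v\<close> in blast)+
      note del = delete[OF D adjacent[OF D]]
      have "no_conflict (E - {e}) bv rv (\<lambda>u. unshift (x v) (x u)) (\<lambda>f. unshift (Suc (x v)) (y f))"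
        unfolding no_conflict_def
      proof (intro ballI)
        fix f g assume fg: "f \<in> E - {e}" "g \<in> E - {e}"
        have "\<not> (y f < y g \<and> y g \<le> x (rv f) \<and> x (bv g) < y f)"
          using N fg by (auto simp: no_conflict_def)
        then show "\<not> (unshift (Suc (x v)) (y f) < unshift (Suc (x v)) (y g) \<and>
            unshift (Suc (x v)) (y g) \<le> unshift (x v) (x (rv f)) \<and>
            unshift (x v) (x (bv g)) < unshift (Suc (x v)) (y f))"
          using del(3)[OF fg(1)] del(3)[OF fg(2)] del(2)[of "rv f"] del(2)[of "bv g"]
            ends'[OF fg(1)] ends'[OF fg(2)] shift_less_shift by metis
      qed
      from less.hyps[OF card_Diff1_less[OF fin(1) ve(1)] del(1) this]
      have "is_tree (insert v (V - {v})) (insert e (E - {e})) (\<lambda>e. {bv e, rv e})"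
        by (rule tree_insert_pendant) (use rve bve in auto)
      then show ?thesis using ve(1,2) by (simp add: insert_absorb)
    qed
    show ?thesis
    proof (cases "bv e = v")
      case True
      then show ?thesis using step less.prems ve(4) by blast
    next
      case False
      then have "is_tree V E (\<lambda>e. {rv e, bv e})"
        using step[OF diag_rotate no_conflict_rotate] less.prems ve(3,4) by blast
      then show ?thesis by (simp add: insert_commute)
    qed
  qed
qed

section \<open>The Tamari order\<close>

text \<open>The black ends of the upper and the lower arc at the white point number \<open>t\<close>.\<close>

definition leftmost :: "bintree \<Rightarrow> nat \<Rightarrow> nat" where
  "leftmost T t = t - 1 - left_size T t"

definition rightmost :: "bintree \<Rightarrow> nat \<Rightarrow> nat" where
  "rightmost T t = t + right_size T t"

section \<open>The arcs of a single binary tree\<close>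

lemma length_infix_subtrees [simp]: "length (infix_subtrees T) = size T"
  by (induction T rule: infix_subtrees.induct) auto

lemma sizes_Node:
  shows "1 \<le> t \<Longrightarrow> t \<le> size A \<Longrightarrow> left_size (Node A x B) t = left_size A t"
    and "left_size (Node A x B) (Suc (size A)) = size A"
    and "1 \<le> t \<Longrightarrow> left_size (Node A x B) (Suc (size A + t)) = left_size B t"
    and "1 \<le> t \<Longrightarrow> t \<le> size A \<Longrightarrow> right_size (Node A x B) t = right_size A t"
    and "right_size (Node A x B) (Suc (size A)) = size B"
    and "1 \<le> t \<Longrightarrow> right_size (Node A x B) (Suc (size A + t)) = right_size B t"
  unfolding left_size_def right_size_def by (auto simp: nth_append nth_Cons')

lemma Node_index_cases:
  assumes "1 \<le> t" "t \<le> size (Node A x B)"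
  obtains (left) "t \<le> size A" | (root) "t = Suc (size A)"
    | (right) r where "t = Suc (size A + r)" "1 \<le> r" "r \<le> size B"
proof -
  consider "t \<le> size A" | "t = Suc (size A)" | "Suc (size A) < t" by linarith
  then show thesis
  proof cases
    case 3
    with assms right[of "t - Suc (size A)"] show thesis by simp
  qed (use left root in auto)
qed

text \<open>This makes the truncated subtraction in \<open>leftmost\<close> exact.\<close>

lemma left_size_less: "1 \<le> t \<Longrightarrow> t \<le> size T \<Longrightarrow> left_size T t < t"
proof (induction T arbitrary: t)
  case (Node A x B)
  show ?case
    using Node.prems
  proof (cases rule: Node_index_cases)
    case (right r)
    then show ?thesis using Node.IH(2)[of r] by (simp add: sizes_Node)
  qed (use Node in \<open>simp_all add: sizes_Node\<close>)
qed simp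

lemma leftmost_Node [simp]:
  shows "1 \<le> t \<Longrightarrow> t \<le> size A \<Longrightarrow> leftmost (Node A x B) t = leftmost A t"
    and "leftmost (Node A x B) (Suc (size A)) = 0"
    and "1 \<le> t \<Longrightarrow> t \<le> size B \<Longrightarrow>
      leftmost (Node A x B) (Suc (size A + t)) = Suc (size A + leftmost B t)"
  using left_size_less[of t B] by (auto simp: leftmost_def sizes_Node)

lemma rightmost_Node [simp]:
  shows "1 \<le> t \<Longrightarrow> t \<le> size A \<Longrightarrow> rightmost (Node A x B) t = rightmost A t"
    and "rightmost (Node A x B) (Suc (size A)) = Suc (size A + size B)"
    and "1 \<le> t \<Longrightarrow> rightmost (Node A x B) (Suc (size A + t)) = Suc (size A + rightmost B t)"
  by (auto simp: rightmost_def sizes_Node)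

lemma leftmost_less: "1 \<le> t \<Longrightarrow> leftmost T t < t"
  by (auto simp: leftmost_def)

lemma rightmost_ge: "t \<le> rightmost T t"
  by (simp add: rightmost_def)

lemma rightmost_le: "1 \<le> t \<Longrightarrow> t \<le> size T \<Longrightarrow> rightmost T t \<le> size T"
proof (induction T arbitrary: t)
  case (Node A x B)
  show ?case
    using Node.prems
  proof (cases rule: Node_index_cases)
    case (right r)
    then show ?thesis using Node.IH(2)[of r] by simp
  qed (use Node in \<open>fastforce+\<close>)
qed simp

lemma infix_subtrees_mirror: "infix_subtrees (mirror T) = rev (map mirror (infix_subtrees T))"
  by (induction T rule: infix_subtrees.induct) auto

text \<open>Mirroring reverses the infix order and exchanges left with right subtrees. Statements on
  lower arcs are derived from those on upper arcs in this way.\<close>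

lemma rightmost_mirror:
  assumes "1 \<le> t" "t \<le> size T"
  shows "rightmost (mirror T) t = size T - leftmost T (Suc (size T) - t)"
    and "leftmost (mirror T) t = size T - rightmost T (Suc (size T) - t)"
proof -
  have lr: "left (mirror S) = mirror (right S)" "right (mirror S) = mirror (left S)" for S :: bintree
    by (cases S; simp)+
  have nth: "infix_subtrees (mirror T) ! (t - 1) = mirror (infix_subtrees T ! (Suc (size T) - t - 1))"
    using assms by (simp add: infix_subtrees_mirror rev_nth)
  have l: "left_size (mirror T) t = right_size T (Suc (size T) - t)"
    and r: "right_size (mirror T) t = left_size T (Suc (size T) - t)"
    unfolding left_size_def right_size_def nth lr by simp_all
  show "rightmost (mirror T) t = size T - leftmost T (Suc (size T) - t)"
    using left_size_less[of "Suc (size T) - t" T] assms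
    unfolding rightmost_def leftmost_def r by linarith
  show "leftmost (mirror T) t = size T - rightmost T (Suc (size T) - t)"
    using assms by (auto simp: rightmost_def leftmost_def l)
qed

text \<open>The arc of the root ends at 0 and spans all arcs of the left subtree, while the arcs of
  the right subtree end no further left than just after the root.\<close>

lemma leftmost_noncrossing:
  assumes "1 \<le> s" "t \<le> size T"
  shows "\<not> (leftmost T s < leftmost T t \<and> leftmost T t < s \<and> s < t)"
  using assms
proof (induction T arbitrary: s t)
  case (Node A x B)
  show ?case
  proof
    assume c: "leftmost (Node A x B) s < leftmost (Node A x B) t \<and>
      leftmost (Node A x B) t < s \<and> s < t"
    then have s: "1 \<le> s" "s \<le> size (Node A x B)" and t: "1 \<le> t" "t \<le> size (Node A x B)"
      using Node.prems by auto
    from t show False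
    proof (cases rule: Node_index_cases)
      case left
      then show False using c Node.IH(1)[of s t] s t leftmost_Node(1)[of s A x B] by fastforce
    next
      case root
      then show False using c by simp
    next
      case (right r)
      from s show False
      proof (cases rule: Node_index_cases)
        case (right q)
        then show False using c Node.IH(2)[of q r] \<open>t = Suc (size A + r)\<close> \<open>1 \<le> r\<close> \<open>r \<le> size B\<close>
            leftmost_Node(3)[OF right(2,3), of A x] right(1) by auto
      qed (use c right in simp_all)
    qed
  qed
qed simp

lemma rightmost_noncrossing:
  assumes "1 \<le> s" "t \<le> size T"
  shows "\<not> (s < t \<and> t \<le> rightmost T s \<and> rightmost T s < rightmost T t)"
proof
  let ?n = "size T"
  assume c: "s < t \<and> t \<le> rightmost T s \<and> rightmost T s < rightmost T t"
  have "rightmost T r = ?n - leftmost (mirror T) (Suc ?n - r)"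
    "leftmost (mirror T) (Suc ?n - r) < Suc ?n - r" if "1 \<le> r" "r \<le> ?n" for r
    using rightmost_mirror(1)[of r "mirror T"] leftmost_less[of "Suc ?n - r"] that by auto
  then have "rightmost T s = ?n - leftmost (mirror T) (Suc ?n - s)"
    "leftmost (mirror T) (Suc ?n - s) < Suc ?n - s"
    "rightmost T t = ?n - leftmost (mirror T) (Suc ?n - t)"
    "leftmost (mirror T) (Suc ?n - t) < Suc ?n - t"
    using c assms by auto
  moreover have "\<not> (leftmost (mirror T) (Suc ?n - t) < leftmost (mirror T) (Suc ?n - s) \<and>
      leftmost (mirror T) (Suc ?n - s) < Suc ?n - t \<and> Suc ?n - t < Suc ?n - s)"
    by (rule leftmost_noncrossing) (use c assms in auto)
  ultimately show False
    using c assms by linarith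
qed

text \<open>A rotation of \<open>((A, B), C)\<close> changes a single entry of the bracket vector:
  the right subtree of the node between \<open>A\<close> and \<open>B\<close> grows from
  \<open>B\<close> to \<open>(B, C)\<close>.\<close>

lemma right_rotation_mono:
  assumes "right_rotation T T'"
  shows "size T' = size T \<and> (\<forall>t. 1 \<le> t \<and> t \<le> size T \<longrightarrow> rightmost T t \<le> rightmost T' t)"
  using assms
proof (induction rule: right_rotation.induct)
  case (here A B C)
  have "rightmost (Node (Node A () B) () C) t \<le> rightmost (Node A () (Node B () C)) t"
    if t: "1 \<le> t" "t \<le> size (Node (Node A () B) () C)" for t
    using t
  proof (cases rule: Node_index_cases)
    case left
    from t(1) left show ?thesis
    proof (cases rule: Node_index_cases)
      case left
      then show ?thesis using t(1) by simp
    qed simp_all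
  next
    case root
    then show ?thesis
      using rightmost_Node(3)[of "Suc (size B)" A "()" "Node B () C"]
        rightmost_Node(2)[of "Node A () B" "()" C] by simp
  next
    case (right r)
    then show ?thesis
      using rightmost_Node(3)[of "Suc (size B + r)" A "()" "Node B () C"]
        rightmost_Node(3)[of r "Node A () B" "()" C] by (simp add: add.assoc)
  qed
  then show ?case by simp
next
  case (in_left A A' B)
  have "rightmost (Node A () B) t \<le> rightmost (Node A' () B) t"
    if t: "1 \<le> t" "t \<le> size (Node A () B)" for t
    using t
  proof (cases rule: Node_index_cases)
    case root
    then show ?thesis using rightmost_Node(2)[of A' "()" B] in_left.IH by simp
  next
    case (right r)
    then show ?thesis using rightmost_Node(3)[of r A' "()" B] in_left.IH by simp
  qed (use in_left t in auto)
  then show ?case using in_left by simp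
next
  case (in_right B B' A)
  have "rightmost (Node A () B) t \<le> rightmost (Node A () B') t"
    if t: "1 \<le> t" "t \<le> size (Node A () B)" for t
    using t by (cases rule: Node_index_cases) (use in_right t in auto)
  then show ?case using in_right by simp
qed

lemma tamari_le_mono:
  assumes "tamari_le T T'"
  shows "size T' = size T \<and> (\<forall>t. 1 \<le> t \<and> t \<le> size T \<longrightarrow> rightmost T t \<le> rightmost T' t)"
  using assms unfolding tamari_le_def
proof (induction rule: rtranclp_induct)
  case (step S U)
  then show ?case using right_rotation_mono[OF step.hyps(2)] by (auto intro: order_trans)
qed simp

text \<open>A conflict would put the \<open>t\<close>-th node into the right subtree of the
  \<open>s\<close>-th one and at the same time the \<open>s\<close>-th node into the left subtree of
  the \<open>t\<close>-th one.\<close>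

lemma leftmost_rightmost_consistent:
  assumes "1 \<le> s" "s < t" "t \<le> size T"
  shows "\<not> (t \<le> rightmost T s \<and> leftmost T t < s)"
  using assms
proof (induction T arbitrary: s t)
  case (Node A x B)
  have s: "1 \<le> s" "s \<le> size (Node A x B)" and t: "1 \<le> t" "t \<le> size (Node A x B)"
    using Node.prems by auto
  from t show ?case
  proof (cases rule: Node_index_cases)
    case left
    then show ?thesis using Node.IH(1)[of s t] Node.prems by simp
  next
    case root
    then show ?thesis using Node.prems rightmost_le[of s A] by simp
  next
    case (right r)
    from s show ?thesis
    proof (cases rule: Node_index_cases)
      case (right q)
      then show ?thesis
        using Node.prems Node.IH(2)[of q r] \<open>t = Suc (size A + r)\<close> \<open>1 \<le> r\<close> \<open>r \<le> size B\<close> by simp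
    qed (use right in simp_all)
  qed
qed simp

lemma tamari_le_left: "tamari_le A A' \<Longrightarrow> tamari_le (Node A () B) (Node A' () B)"
  unfolding tamari_le_def
  by (induction rule: rtranclp_induct) (auto intro: rtranclp.rtrancl_into_rtrancl in_left)

lemma tamari_le_right: "tamari_le B B' \<Longrightarrow> tamari_le (Node A () B) (Node A () B')"
  unfolding tamari_le_def
  by (induction rule: rtranclp_induct) (auto intro: rtranclp.rtrancl_into_rtrancl in_right)

lemma tamari_le_trans: "tamari_le A B \<Longrightarrow> tamari_le B C \<Longrightarrow> tamari_le A C"
  by (simp add: tamari_le_def)

text \<open>The hypothesis on \<open>rightmost\<close> says that the \<open>p\<close>-th node lies on the left branch.\<close>

lemma rotate_to_root:
  assumes "1 \<le> p" "p \<le> size T" "\<And>s. 1 \<le> s \<Longrightarrow> s < p \<Longrightarrow> rightmost T s < p"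
  shows "\<exists>A B. Suc (size A) = p \<and> tamari_le T (Node A () B) \<and>
    (\<forall>t. 1 \<le> t \<and> t \<le> size T \<and> t \<noteq> p \<longrightarrow> rightmost (Node A () B) t = rightmost T t)"
  using assms
proof (induction T)
  case (Node L x R)
  have x: "x = ()" by simp
  have "\<not> Suc (size L) < p"
    using Node.prems(2) Node.prems(3)[of "Suc (size L)"] by fastforce
  then consider "p = Suc (size L)" | "p \<le> size L" by linarith
  then show ?case
  proof cases
    case 1
    then show ?thesis unfolding x tamari_le_def by blast
  next
    case 2
    have "rightmost L s < p" if "1 \<le> s" "s < p" for s
      using Node.prems(3)[OF that] that 2 by simp
    from Node.IH(1)[OF Node.prems(1) 2 this] obtain A B where
      AB: "Suc (size A) = p" "tamari_le L (Node A () B)"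
      "\<And>t. 1 \<le> t \<Longrightarrow> t \<le> size L \<Longrightarrow> t \<noteq> p \<Longrightarrow> rightmost (Node A () B) t = rightmost L t"
      by auto
    have sz: "size L = Suc (size A + size B)" using tamari_le_mono[OF AB(2)] by simp
    have "tamari_le (Node L () R) (Node (Node A () B) () R)" using AB(2) by (rule tamari_le_left)
    \<comment> \<open>By induction the \<open>p\<close>-th node has become the left child of the
      root. One more rotation lifts it, and this changes \<open>rightmost\<close> only at
      \<open>p\<close>.\<close>
    moreover have "tamari_le (Node (Node A () B) () R) (Node A () (Node B () R))"
      unfolding tamari_le_def using right_rotation.here by blast
    ultimately have "tamari_le (Node L x R) (Node A () (Node B () R))"
      unfolding x by (rule tamari_le_trans)
    moreover have "rightmost (Node A () (Node B () R)) t = rightmost (Node L x R) t"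
      if "1 \<le> t" "t \<le> size (Node L x R)" "t \<noteq> p" for t
      using that(1,2)
    proof (cases rule: Node_index_cases)
      case left
      have "rightmost (Node A () (Node B () R)) t = rightmost (Node A () B) t"
      proof -
        have "t \<le> size (Node A () B)" using left sz by simp
        with that(1) show ?thesis by (cases rule: Node_index_cases) (use that AB(1) in simp_all)
      qed
      then show ?thesis using AB(3)[of t] that left by simp
    next
      case root
      then show ?thesis
        using sz rightmost_Node(3)[of "Suc (size B)" A "()" "Node B () R"]
          rightmost_Node(2)[of L "()" R] by simp
    next
      case (right r)
      then show ?thesis
        using sz rightmost_Node(3)[of "Suc (size B + r)" A "()" "Node B () R"]
          rightmost_Node(3)[of r L "()" R] by (simp add: add.assoc)
    qed
    ultimately show ?thesis using AB(1) by blast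
  qed
qed simp

text \<open>The upper arc of the root of \<open>T'\<close> ends at 0, so absence of conflicts with
  it says that in \<open>T\<close> no lower arc passes below position \<open>p\<close>. Hence
  rotations bring the \<open>p\<close>-th node of \<open>T\<close> to the root. They leave
  \<open>rightmost\<close> unchanged elsewhere, so the two pairs of subtrees are again free of
  conflicts.\<close>

lemma no_conflict_tamari_le:
  assumes "size T = size T'"
    and "\<And>s t. 1 \<le> s \<Longrightarrow> s < t \<Longrightarrow> t \<le> size T' \<Longrightarrow> \<not> (t \<le> rightmost T s \<and> leftmost T' t < s)"
  shows "tamari_le T T'"
  using assms
proof (induction T' arbitrary: T)
  case Leaf
  then show ?case by (simp add: tamari_le_def)
next
  case (Node A' x B')
  define p where "p = Suc (size A')"
  have x: "x = ()" by simp
  have p: "1 \<le> p" "p \<le> size T" using Node.prems by (auto simp: p_def)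
  have lp: "leftmost (Node A' x B') p = 0" by (simp add: p_def)
  have "rightmost T s < p" if "1 \<le> s" "s < p" for s
    using Node.prems(2)[of s p] that lp by (auto simp: p_def)
  from rotate_to_root[OF p this] obtain A B where
    AB: "Suc (size A) = p" "tamari_le T (Node A () B)"
    "\<And>t. 1 \<le> t \<Longrightarrow> t \<le> size T \<Longrightarrow> t \<noteq> p \<Longrightarrow> rightmost (Node A () B) t = rightmost T t"
    by auto
  have sz: "size A = size A'" "size B = size B'"
    using AB(1) tamari_le_mono[OF AB(2)] Node.prems(1) by (auto simp: p_def)
  have "tamari_le A A'"
  proof (rule Node.IH(1)[OF sz(1)])
    fix s t assume st: "1 \<le> s" "s < t" "t \<le> size A'"
    have "rightmost T s = rightmost A s"
      using AB(3)[of s] st p sz by (simp add: p_def)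
    moreover have "leftmost (Node A' x B') t = leftmost A' t"
      using st by simp
    ultimately show "\<not> (t \<le> rightmost A s \<and> leftmost A' t < s)"
      using Node.prems(2)[of s t] st by simp
  qed
  moreover have "tamari_le B B'"
  proof (rule Node.IH(2)[OF sz(2)])
    fix s t assume st: "1 \<le> s" "s < t" "t \<le> size B'"
    have "rightmost T (p + s) = p + rightmost B s"
      using AB(3)[of "p + s"] st sz Node.prems(1) rightmost_Node(3)[of s A "()" B] by (simp add: p_def)
    moreover have "leftmost (Node A' x B') (p + t) = p + leftmost B' t"
      using st by (simp add: p_def)
    ultimately show "\<not> (t \<le> rightmost B s \<and> leftmost B' t < s)"
      using Node.prems(2)[of "p + s" "p + t"] st by (auto simp: p_def)
  qed
  ultimately have "tamari_le (Node A () B) (Node A' x B')"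
    unfolding x using tamari_le_left tamari_le_right tamari_le_trans by blast
  then show ?case using AB(2) tamari_le_trans by blast
qed

text \<open>From left to right: \<open>rightmost\<close> only grows along the order, so a conflict
  of \<open>T\<close> with \<open>T'\<close> would be a conflict of \<open>T'\<close> with
  itself.\<close>

theorem tamari_le_iff_no_conflict:
  assumes "size T = size T'"
  shows "tamari_le T T' \<longleftrightarrow>
    (\<forall>s t. 1 \<le> s \<and> s < t \<and> t \<le> size T' \<longrightarrow> \<not> (t \<le> rightmost T s \<and> leftmost T' t < s))"
proof (intro iffI allI impI)
  fix s t assume le: "tamari_le T T'" and st: "1 \<le> s \<and> s < t \<and> t \<le> size T'"
  have "s \<le> size T" using st assms by simp
  then have "rightmost T s \<le> rightmost T' s" using tamari_le_mono[OF le] st by blast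
  moreover have "\<not> (t \<le> rightmost T' s \<and> leftmost T' t < s)"
    using leftmost_rightmost_consistent st by blast
  ultimately show "\<not> (t \<le> rightmost T s \<and> leftmost T' t < s)" by linarith
next
  assume "\<forall>s t. 1 \<le> s \<and> s < t \<and> t \<le> size T' \<longrightarrow> \<not> (t \<le> rightmost T s \<and> leftmost T' t < s)"
  then show "tamari_le T T'" by (intro no_conflict_tamari_le[OF assms]) blast
qed

text \<open>The root has to be the last position \<open>r\<close> with \<open>b r = 0\<close>;
  earlier positions form the left subtree and later ones the right subtree. A later arc cannot cross
  that of \<open>r\<close>, which gives \<open>r \<le> b t\<close> for \<open>t > r\<close>, so
  subtracting \<open>r\<close> is exact.\<close>

lemma exists_leftmost:
  assumes "\<And>t. 1 \<le> t \<Longrightarrow> t \<le> n \<Longrightarrow> b t < t"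
    and "\<And>s t. 1 \<le> s \<Longrightarrow> t \<le> n \<Longrightarrow> \<not> (b s < b t \<and> b t < s \<and> s < t)"
  shows "\<exists>T. size T = n \<and> (\<forall>t. 1 \<le> t \<and> t \<le> n \<longrightarrow> leftmost T t = b t)"
  using assms
proof (induction n arbitrary: b rule: less_induct)
  case (less n)
  show ?case
  proof (cases "n = 0")
    case True
    then show ?thesis by (intro exI[of _ Leaf]) auto
  next
    case False
    define r where "r = Max {t. 1 \<le> t \<and> t \<le> n \<and> b t = 0}"
    have fin: "finite {t. 1 \<le> t \<and> t \<le> n \<and> b t = 0}" by (rule finite_subset[of _ "{..n}"]) auto
    have "b 1 = 0" using less.prems(1)[of 1] False by simp
    then have "{t. 1 \<le> t \<and> t \<le> n \<and> b t = 0} \<noteq> {}" using False by (auto intro: exI[of _ 1])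
    from Max_in[OF fin this] have r: "1 \<le> r" "r \<le> n" "b r = 0" by (auto simp: r_def)
    have max: "b t \<noteq> 0" if "r < t" "t \<le> n" for t
    proof
      assume "b t = 0"
      then have "t \<le> r" unfolding r_def using that by (intro Max_ge[OF fin]) auto
      then show False using that by simp
    qed
    have ge: "r \<le> b t" if "r < t" "t \<le> n" for t
      using max[OF that] less.prems(2)[of r t] r that by auto
    obtain A where A: "size A = r - 1" "\<And>t. 1 \<le> t \<Longrightarrow> t \<le> r - 1 \<Longrightarrow> leftmost A t = b t"
    proof -
      have "\<exists>A. size A = r - 1 \<and> (\<forall>t. 1 \<le> t \<and> t \<le> r - 1 \<longrightarrow> leftmost A t = b t)"
        by (rule less.IH) (use less.prems r in auto)
      then show thesis using that by blast
    qed
    have "\<exists>B. size B = n - r \<and> (\<forall>t. 1 \<le> t \<and> t \<le> n - r \<longrightarrow> leftmost B t = b (r + t) - r)"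
    proof (rule less.IH)
      show "n - r < n" using r by simp
      show "b (r + t) - r < t" if "1 \<le> t" "t \<le> n - r" for t
        using less.prems(1)[of "r + t"] that r by linarith
      show "\<not> (b (r + s) - r < b (r + t) - r \<and> b (r + t) - r < s \<and> s < t)"
        if "1 \<le> s" "t \<le> n - r" for s t
      proof
        assume c: "b (r + s) - r < b (r + t) - r \<and> b (r + t) - r < s \<and> s < t"
        have "r \<le> b (r + s)" "r \<le> b (r + t)" using c that r by (auto intro!: ge)
        moreover have "\<not> (b (r + s) < b (r + t) \<and> b (r + t) < r + s \<and> r + s < r + t)"
          by (rule less.prems(2)) (use that r in auto)
        ultimately show False using c by linarith
      qed
    qed
    then obtain B where B: "size B = n - r"
      "\<And>t. 1 \<le> t \<Longrightarrow> t \<le> n - r \<Longrightarrow> leftmost B t = b (r + t) - r" by blast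
    have "leftmost (Node A () B) t = b t" if "1 \<le> t" "t \<le> n" for t
    proof -
      have "t \<le> size (Node A () B)" using that A B r by simp
      with that(1) show ?thesis
      proof (cases rule: Node_index_cases)
        case (right q)
        have "Suc (size A) = r" using A(1) r by simp
        then have "leftmost (Node A () B) t = r + leftmost B q" "t = r + q"
          using right leftmost_Node(3)[OF right(2,3), of A "()"] by auto
        then show ?thesis using B(2)[of q] B(1) right r ge[of "r + q"] by auto
      next
        case root
        then show ?thesis using leftmost_Node(2)[of A "()" B] A(1) r by simp
      qed (use A r that in auto)
    qed
    moreover have "size (Node A () B) = n" using A B r by simp
    ultimately show ?thesis by blast
  qed
qed

text \<open>Both roots are at the same position: otherwise the later one would sit at a position of
  the right subtree of the other tree, where \<open>leftmost\<close> is positive.\<close>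

lemma leftmost_inject:
  assumes "size T = size T'" "\<And>t. 1 \<le> t \<Longrightarrow> t \<le> size T \<Longrightarrow> leftmost T t = leftmost T' t"
  shows "T = T'"
  using assms
proof (induction T arbitrary: T')
  case (Node A x B)
  then obtain A' x' B' where T': "T' = Node A' x' B'" by (cases T') auto
  have False if "size A < size A'" "size (Node A x B) = size (Node A' x' B')"
    "leftmost (Node A x B) (Suc (size A')) = leftmost (Node A' x' B') (Suc (size A'))"
    for A x B A' x' B'
  proof -
    have "1 \<le> Suc (size A')" "Suc (size A') \<le> size (Node A x B)" using that by auto
    then show False
    proof (cases rule: Node_index_cases)
      case (right r)
      then show False using that(3) leftmost_Node(2)[of A' x' B'] by simp
    qed (use that in simp_all)
  qed
  from this[of A A' x B x' B'] this[of A' A x' B' x B] have s: "size A = size A'"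
    using Node.prems(1) Node.prems(2)[of "Suc (size A)"] Node.prems(2)[of "Suc (size A')"] T'
    by (cases "size A" "size A'" rule: linorder_cases) auto
  have "A = A'"
  proof (rule Node.IH(1)[OF s])
    fix t assume t: "1 \<le> t" "t \<le> size A"
    then show "leftmost A t = leftmost A' t"
      using Node.prems(2)[of t] s T' by simp
  qed
  moreover have "B = B'"
  proof (rule Node.IH(2))
    show sB: "size B = size B'" using s Node.prems(1) T' by simp
    fix t assume t: "1 \<le> t" "t \<le> size B"
    then show "leftmost B t = leftmost B' t"
      using Node.prems(2)[of "Suc (size A + t)"] leftmost_Node(3)[of t B' A' x']
        leftmost_Node(3)[of t B A x] s sB T' by simp
  qed
  ultimately show ?case using T' by simp
qed simp

lemma exists_rightmost:
  assumes b: "\<And>t. 1 \<le> t \<Longrightarrow> t \<le> n \<Longrightarrow> t \<le> b t \<and> b t \<le> n"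
    and nc: "\<And>s t. 1 \<le> s \<Longrightarrow> t \<le> n \<Longrightarrow> \<not> (s < t \<and> t \<le> b s \<and> b s < b t)"
  shows "\<exists>T. size T = n \<and> (\<forall>t. 1 \<le> t \<and> t \<le> n \<longrightarrow> rightmost T t = b t)"
proof -
  \<comment> \<open>These are the prescribed arcs after reflecting the axis; the mirror image of the
    resulting tree is the one sought.\<close>
  have "\<exists>T. size T = n \<and> (\<forall>t. 1 \<le> t \<and> t \<le> n \<longrightarrow> leftmost T t = n - b (Suc n - t))"
  proof (rule exists_leftmost)
    fix t assume "1 \<le> t" "t \<le> n"
    moreover from this have "Suc n - t \<le> b (Suc n - t) \<and> b (Suc n - t) \<le> n" by (intro b) auto
    ultimately show "n - b (Suc n - t) < t" by linarith
  next
    fix s t :: nat assume st: "1 \<le> s" "t \<le> n"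
    show "\<not> (n - b (Suc n - s) < n - b (Suc n - t) \<and> n - b (Suc n - t) < s \<and> s < t)"
    proof
      assume c: "n - b (Suc n - s) < n - b (Suc n - t) \<and> n - b (Suc n - t) < s \<and> s < t"
      have "b (Suc n - s) \<le> n" "b (Suc n - t) \<le> n" using c st b by auto
      moreover have "\<not> (Suc n - t < Suc n - s \<and> Suc n - s \<le> b (Suc n - t) \<and>
          b (Suc n - t) < b (Suc n - s))"
        by (rule nc) (use c st in auto)
      ultimately show False using c st by linarith
    qed
  qed
  then obtain T where T: "size T = n" "\<And>t. 1 \<le> t \<Longrightarrow> t \<le> n \<Longrightarrow> leftmost T t = n - b (Suc n - t)"
    by blast
  have "rightmost (mirror T) t = b t" if "1 \<le> t" "t \<le> n" for t
  proof -
    have "Suc n - (Suc n - t) = t" "1 \<le> Suc n - t" "Suc n - t \<le> n" using that by auto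
    then have "leftmost T (Suc n - t) = n - b t" using T(2)[of "Suc n - t"] by simp
    then show ?thesis
      using rightmost_mirror(1)[of t T] T(1) that b[OF that] by simp
  qed
  then show ?thesis using T(1) by (intro exI[of _ "mirror T"]) auto
qed

lemma rightmost_inject:
  assumes "size T = size T'" "\<And>t. 1 \<le> t \<Longrightarrow> t \<le> size T \<Longrightarrow> rightmost T t = rightmost T' t"
  shows "T = T'"
proof -
  have "mirror T = mirror T'"
    by (rule leftmost_inject) (use assms rightmost_mirror(2) in auto)
  then show ?thesis by (metis mirror_mirror)
qed

section \<open>Half-edge maps of colored graphs\<close>

lemma cycle_of_list_nth:
  assumes "distinct zs" "i < length zs"
  shows "cycle_of_list zs (zs ! i) = zs ! (Suc i mod length zs)"
proof -
  have "map (cycle_of_list zs) zs ! i = rotate 1 zs ! i"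
    using cyclic_rotation[OF assms(1), of 1] by simp
  then show ?thesis using assms(2) by (simp add: nth_rotate del: rotate_Suc One_nat_def) simp
qed

lemma funpow_cyclic_list:
  assumes "\<And>i. i < length zs \<Longrightarrow> f (zs ! i) = zs ! (Suc i mod length zs)" "j < length zs"
  shows "(f ^^ m) (zs ! j) = zs ! ((j + m) mod length zs)"
proof (induction m)
  case (Suc m)
  have "(j + m) mod length zs < length zs" using assms(2) by (intro mod_less_divisor) auto
  then show ?case using Suc assms(1) by (simp add: mod_Suc_eq)
qed (use assms(2) in simp)

lemma orbit_cyclic_list:
  assumes "\<And>i. i < length zs \<Longrightarrow> f (zs ! i) = zs ! (Suc i mod length zs)" "z \<in> set zs"
  shows "orbit f z = set zs"
proof -
  obtain j where j: "j < length zs" "z = zs ! j" using assms(2) by (metis in_set_conv_nth)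
  have l: "length zs > 0" using j by auto
  have "(\<exists>m>0. w = (f ^^ m) z) \<longleftrightarrow> (\<exists>i<length zs. w = zs ! i)" for w
  proof
    assume "\<exists>m>0. w = (f ^^ m) z"
    then obtain m where "w = (f ^^ m) z" by blast
    then show "\<exists>i<length zs. w = zs ! i"
      using funpow_cyclic_list[OF assms(1) j(1)] j(2) l by (metis mod_less_divisor)
  next
    assume "\<exists>i<length zs. w = zs ! i"
    then obtain i where i: "i < length zs" "w = zs ! i" by blast
    \<comment> \<open>Going once past the end of the list keeps the exponent positive, as the orbit
      requires, even for \<open>i = j\<close>.\<close>
    have "(j + (length zs - j + i)) mod length zs = i" using i j by simp
    then have "(f ^^ (length zs - j + i)) z = w"
      using funpow_cyclic_list[OF assms(1) j(1), where m = "length zs - j + i"] i j(2) by simp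
    then show "\<exists>m>0. w = (f ^^ m) z" using j by (intro exI[of _ "length zs - j + i"]) auto
  qed
  then show ?thesis unfolding orbit_altdef set_conv_nth by auto
qed

text \<open>The half-edges of \<open>gamma_map\<close> for arbitrary vertex and edge sets. Vertices
  and edges of abstract blossoming trees are also named by reals, so that one label type serves both
  sides of the bijection.\<close>

definition labels :: "real set \<Rightarrow> real set \<Rightarrow> diagram_half_edge set" where
  "labels V E = (\<Union>w\<in>E. {Upper_half w, Lower_half w}) \<union>
     (\<Union>b\<in>V. {Left_bud b, Left_bud_tip b, Right_bud b, Right_bud_tip b})"

lemma in_labels [simp]:
  "Upper_half w \<in> labels V E \<longleftrightarrow> w \<in> E"
  "Lower_half w \<in> labels V E \<longleftrightarrow> w \<in> E"
  "Left_bud b \<in> labels V E \<longleftrightarrow> b \<in> V"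
  "Right_bud b \<in> labels V E \<longleftrightarrow> b \<in> V"
  "Left_bud_tip b \<in> labels V E \<longleftrightarrow> b \<in> V"
  "Right_bud_tip b \<in> labels V E \<longleftrightarrow> b \<in> V"
  by (auto simp: labels_def)

definition around :: "(real \<Rightarrow> real list) \<Rightarrow> (real \<Rightarrow> real list) \<Rightarrow> real \<Rightarrow> diagram_half_edge list" where
  "around bl rl v = Right_bud v # map Upper_half (bl v) @ Left_bud v # map Lower_half (rl v)"

fun label_rot ::
  "(real \<Rightarrow> real) \<Rightarrow> (real \<Rightarrow> real) \<Rightarrow> (real \<Rightarrow> real list) \<Rightarrow> (real \<Rightarrow> real list) \<Rightarrow>
   diagram_half_edge \<Rightarrow> diagram_half_edge" where
  "label_rot bv rv bl rl (Upper_half w) = cycle_of_list (around bl rl (bv w)) (Upper_half w)"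
| "label_rot bv rv bl rl (Lower_half w) = cycle_of_list (around bl rl (rv w)) (Lower_half w)"
| "label_rot bv rv bl rl (Left_bud b) = cycle_of_list (around bl rl b) (Left_bud b)"
| "label_rot bv rv bl rl (Right_bud b) = cycle_of_list (around bl rl b) (Right_bud b)"
| "label_rot bv rv bl rl (Left_bud_tip b) = Left_bud_tip b"
| "label_rot bv rv bl rl (Right_bud_tip b) = Right_bud_tip b"

text \<open>The half-edge map \<open>X\<close> consists of a colored graph with two buds added at each vertex.\<close>

definition realizes ::
  "real set \<Rightarrow> real set \<Rightarrow> (real \<Rightarrow> real) \<Rightarrow> (real \<Rightarrow> real) \<Rightarrow> (real \<Rightarrow> real list) \<Rightarrow>
   (real \<Rightarrow> real list) \<Rightarrow> (diagram_half_edge \<Rightarrow> 'h) \<Rightarrow> 'h half_edge_map \<Rightarrow> bool" where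
  "realizes V E bv rv bl rl g X \<longleftrightarrow>
     bij_betw g (labels V E) (half_edges X) \<and>
     (\<forall>h\<in>labels V E. rot X (g h) = g (label_rot bv rv bl rl h) \<and>
        opp X (g h) = g (gamma_opp h) \<and> half_color X (g h) = gamma_color h)"

lemma gamma_opp_labels: "h \<in> labels V E \<Longrightarrow> gamma_opp h \<in> labels V E"
  by (cases h) auto

lemma gamma_opp_opp [simp]: "gamma_opp (gamma_opp h) = h" "gamma_opp h \<noteq> h"
  by (cases h; simp)+

context
  fixes V E :: "real set" and bv rv :: "real \<Rightarrow> real" and bl rl :: "real \<Rightarrow> real list"
  assumes C: "colored_graph V E bv rv bl rl"
begin

lemma around_set:
  assumes "v \<in> V"
  shows "set (around bl rl v) = {Right_bud v, Left_bud v} \<union>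
    Upper_half ` {e \<in> E. bv e = v} \<union> Lower_half ` {e \<in> E. rv e = v}"
proof -
  have "set (bl v) = {e \<in> E. bv e = v}" "set (rl v) = {e \<in> E. rv e = v}"
    using C assms unfolding colored_graph_def by blast+
  then show ?thesis by (auto simp: around_def)
qed

lemma around_distinct: "v \<in> V \<Longrightarrow> distinct (around bl rl v)"
  using C by (auto simp: around_def colored_graph_def distinct_map inj_on_def)

lemma around_labels: "v \<in> V \<Longrightarrow> set (around bl rl v) \<subseteq> labels V E"
  by (auto simp: around_set)

lemma label_rot_around:
  assumes "v \<in> V" "h \<in> set (around bl rl v)"
  shows "label_rot bv rv bl rl h = cycle_of_list (around bl rl v) h"
  using assms by (auto simp: around_set)

lemma label_rot_nth:
  assumes "v \<in> V" "i < length (around bl rl v)"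
  shows "label_rot bv rv bl rl (around bl rl v ! i) =
    around bl rl v ! (Suc i mod length (around bl rl v))"
  using label_rot_around[OF assms(1) nth_mem[OF assms(2)]]
    cycle_of_list_nth[OF around_distinct[OF assms(1)] assms(2)] by simp

lemma label_cases:
  assumes "h \<in> labels V E"
  obtains v where "v \<in> V" "h \<in> set (around bl rl v)"
  | v where "v \<in> V" "h = Left_bud_tip v \<or> h = Right_bud_tip v"
proof (cases h)
  case (Upper_half w)
  then have "bv w \<in> V" "h \<in> set (around bl rl (bv w))"
    using assms C by (auto simp: around_set colored_graph_def)
  with that(1) show thesis by blast
next
  case (Lower_half w)
  then have "rv w \<in> V" "h \<in> set (around bl rl (rv w))"
    using assms C by (auto simp: around_set colored_graph_def)
  with that(1) show thesis by blast
next
  case (Left_bud w)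
  then show thesis using assms that(1)[of w] by (auto simp: around_set)
next
  case (Right_bud w)
  then show thesis using assms that(1)[of w] by (auto simp: around_set)
qed (use assms that in auto)

lemma around_rot_set:
  assumes "v \<in> V" "h \<in> set (around bl rl v)"
  shows "label_rot bv rv bl rl h \<in> set (around bl rl v)"
proof -
  obtain i where "i < length (around bl rl v)" "h = around bl rl v ! i"
    using assms(2) by (metis in_set_conv_nth)
  moreover from this have "Suc i mod length (around bl rl v) < length (around bl rl v)"
    by (intro mod_less_divisor) auto
  ultimately show ?thesis using label_rot_nth[OF assms(1)] by simp
qed

lemma label_rot_labels: "h \<in> labels V E \<Longrightarrow> label_rot bv rv bl rl h \<in> labels V E"
  using around_rot_set around_labels by (elim label_cases) auto

text \<open>Every label is a tip or occurs in the list around some vertex, so the rotation has to be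
  checked only along these lists.\<close>

lemma realizesI:
  assumes "bij_betw g (labels V E) (half_edges X)"
    and "\<And>h. h \<in> labels V E \<Longrightarrow> opp X (g h) = g (gamma_opp h)"
    and "\<And>h. h \<in> labels V E \<Longrightarrow> half_color X (g h) = gamma_color h"
    and "\<And>v. v \<in> V \<Longrightarrow> rot X (g (Left_bud_tip v)) = g (Left_bud_tip v)"
    and "\<And>v. v \<in> V \<Longrightarrow> rot X (g (Right_bud_tip v)) = g (Right_bud_tip v)"
    and rot: "\<And>v i. v \<in> V \<Longrightarrow> i < length (around bl rl v) \<Longrightarrow>
      rot X (g (around bl rl v ! i)) = g (around bl rl v ! (Suc i mod length (around bl rl v)))"
  shows "realizes V E bv rv bl rl g X"
proof -
  have "rot X (g h) = g (label_rot bv rv bl rl h)" if "h \<in> labels V E" for h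
    using that
  proof (cases rule: label_cases)
    case (1 v)
    then obtain i where "i < length (around bl rl v)" "h = around bl rl v ! i"
      by (metis in_set_conv_nth)
    then show ?thesis using rot[OF 1(1)] label_rot_nth[OF 1(1)] by simp
  qed (use assms in auto)
  then show ?thesis using assms by (simp add: realizes_def)
qed

lemma realizes_iso:
  assumes "realizes V E bv rv bl rl g X" "map_iso X Y"
  obtains f where "realizes V E bv rv bl rl f Y"
proof -
  from assms(2) obtain f where bij: "bij_betw f (half_edges X) (half_edges Y)"
    and f: "\<And>h. h \<in> half_edges X \<Longrightarrow> f (rot X h) = rot Y (f h) \<and> f (opp X h) = opp Y (f h) \<and>
      half_color Y (f h) = half_color X h"
    unfolding map_iso_def by blast
  have g: "bij_betw g (labels V E) (half_edges X)" using assms by (simp add: realizes_def)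
  then have in_X: "g h \<in> half_edges X" if "h \<in> labels V E" for h using that bij_betwE by blast
  have "realizes V E bv rv bl rl (f \<circ> g) Y"
    unfolding realizes_def
  proof (intro conjI ballI)
    show "bij_betw (f \<circ> g) (labels V E) (half_edges Y)" using bij_betw_trans[OF g bij] .
    fix h assume h: "h \<in> labels V E"
    have X: "rot X (g h) = g (label_rot bv rv bl rl h)" "opp X (g h) = g (gamma_opp h)"
      "half_color X (g h) = gamma_color h" using assms(1) h by (auto simp: realizes_def)
    show "rot Y ((f \<circ> g) h) = (f \<circ> g) (label_rot bv rv bl rl h)"
      "opp Y ((f \<circ> g) h) = (f \<circ> g) (gamma_opp h)"
      "half_color Y ((f \<circ> g) h) = gamma_color h"
      using f[OF in_X[OF h]] X by auto
  qed
  then show thesis using that by blast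
qed

text \<open>Composing \<open>f\<close> with the inverse of \<open>g\<close> gives the isomorphism.
  Together with \<open>realizes_iso\<close>, the realizations of one colored graph form an
  isomorphism class.\<close>

lemma realizes_map_iso:
  assumes X: "realizes V E bv rv bl rl g X" and Y: "realizes V E bv rv bl rl f Y"
  shows "map_iso X Y"
proof -
  let ?i = "the_inv_into (labels V E) g"
  have g: "bij_betw g (labels V E) (half_edges X)" and f: "bij_betw f (labels V E) (half_edges Y)"
    using X Y by (auto simp: realizes_def)
  have i: "?i (g h) = h" if "h \<in> labels V E" for h
    using g that by (simp add: bij_betw_def the_inv_into_f_f)
  have "bij_betw (f \<circ> ?i) (half_edges X) (half_edges Y)"
    using bij_betw_trans[OF bij_betw_the_inv_into[OF g] f] .
  moreover have "(f \<circ> ?i) (rot X x) = rot Y ((f \<circ> ?i) x) \<and> (f \<circ> ?i) (opp X x) = opp Y ((f \<circ> ?i) x) \<and>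
      half_color Y ((f \<circ> ?i) x) = half_color X x" if x: "x \<in> half_edges X" for x
  proof -
    obtain h where h: "h \<in> labels V E" "x = g h" using g x unfolding bij_betw_def by blast
    then show ?thesis using X Y i label_rot_labels[OF h(1)] gamma_opp_labels[OF h(1)]
      by (simp add: realizes_def)
  qed
  ultimately show ?thesis unfolding map_iso_def by blast
qed

end

section \<open>Half-edge maps of colored trees are bicolored blossoming trees\<close>

locale realization =
  fixes V E :: "real set" and bv rv :: "real \<Rightarrow> real" and bl rl :: "real \<Rightarrow> real list"
    and g :: "diagram_half_edge \<Rightarrow> 'h" and X :: "'h half_edge_map"
  assumes C: "colored_graph V E bv rv bl rl" and T: "is_tree V E (\<lambda>e. {bv e, rv e})"
    and nonempty: "E \<noteq> {}" and R: "realizes V E bv rv bl rl g X"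
begin

definition node :: "real \<Rightarrow> 'h set" where
  "node v = g ` set (around bl rl v)"

definition tips :: "diagram_half_edge set" where
  "tips = Left_bud_tip ` V \<union> Right_bud_tip ` V"

definition plain :: "real \<Rightarrow> 'h set" where
  "plain e = {g (Upper_half e), g (Lower_half e)}"

definition bud :: "diagram_half_edge \<Rightarrow> 'h set" where
  "bud t = {g t, g (gamma_opp t)}"

lemma g: "bij_betw g (labels V E) (half_edges X)"
  using R by (simp add: realizes_def)

lemma g_eq [simp]: "h \<in> labels V E \<Longrightarrow> h' \<in> labels V E \<Longrightarrow> g h = g h' \<longleftrightarrow> h = h'"
  using g by (auto simp: bij_betw_def dest: inj_onD)

lemma half_edges_eq: "half_edges X = g ` labels V E"
  using g by (simp add: bij_betw_def)

lemma X_g [simp]: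
  assumes "h \<in> labels V E"
  shows "rot X (g h) = g (label_rot bv rv bl rl h)" "opp X (g h) = g (gamma_opp h)"
    "half_color X (g h) = gamma_color h"
  using R assms by (auto simp: realizes_def)

lemma ends: "e \<in> E \<Longrightarrow> bv e \<in> V \<and> rv e \<in> V"
  using C by (simp add: colored_graph_def)

lemma fin: "finite V" "finite E"
  using T by (auto simp: is_tree_def)

lemma tips_labels: "tips \<subseteq> labels V E"
  by (auto simp: tips_def)

lemma vertex_node:
  assumes "v \<in> V" "h \<in> set (around bl rl v)"
  shows "vertex_of X (g h) = node v"
proof -
  let ?zs = "map g (around bl rl v)"
  have "orbit (rot X) (g h) = set ?zs"
  proof (rule orbit_cyclic_list)
    fix i assume i: "i < length ?zs"
    then have "around bl rl v ! i \<in> labels V E" using around_labels[OF C assms(1)] by auto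
    moreover have "Suc i mod length ?zs < length ?zs" using i by (intro mod_less_divisor) auto
    ultimately show "rot X (?zs ! i) = ?zs ! (Suc i mod length ?zs)"
      using i label_rot_nth[OF C assms(1)] by simp
  qed (use assms in auto)
  then show ?thesis by (simp add: vertex_of_def node_def)
qed

lemma vertex_tip: "t \<in> tips \<Longrightarrow> vertex_of X (g t) = {g t}"
  unfolding vertex_of_def orbit_eq_singleton_iff by (auto simp: tips_def)

lemma vertex_half:
  "e \<in> E \<Longrightarrow> vertex_of X (g (Upper_half e)) = node (bv e)"
  "e \<in> E \<Longrightarrow> vertex_of X (g (Lower_half e)) = node (rv e)"
  "v \<in> V \<Longrightarrow> vertex_of X (g (Left_bud v)) = node v"
  "v \<in> V \<Longrightarrow> vertex_of X (g (Right_bud v)) = node v"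
  using ends by (auto intro!: vertex_node simp: around_set[OF C])

lemma node_card: "v \<in> V \<Longrightarrow> card (node v) = length (around bl rl v)"
proof -
  assume v: "v \<in> V"
  have "inj_on g (set (around bl rl v))"
    using g around_labels[OF C v] inj_on_subset unfolding bij_betw_def by blast
  then show ?thesis
    using around_distinct[OF C v] by (simp add: node_def card_image distinct_card)
qed

lemma node_card_ge: "v \<in> V \<Longrightarrow> card (node v) \<ge> 2"
  by (simp add: node_card around_def)

lemma node_buds: "v \<in> V \<Longrightarrow> g (Left_bud v) \<in> node v" "v \<in> V \<Longrightarrow> g (Right_bud v) \<in> node v"
  by (auto simp: node_def around_def)

lemma node_inj: "inj_on node V"
proof
  fix v w assume vw: "v \<in> V" "w \<in> V" "node v = node w"
  then have "g (Left_bud v) \<in> node w" using node_buds by blast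
  then obtain h where "h \<in> set (around bl rl w)" "g (Left_bud v) = g h" by (auto simp: node_def)
  then have "Left_bud v \<in> set (around bl rl w)"
    using around_labels[OF C vw(2)] vw(1) by (metis g_eq in_labels(3) subsetD)
  then show "v = w" using vw by (auto simp: around_set[OF C])
qed

lemma vertices_eq: "vertices X = node ` V \<union> (\<lambda>t. {g t}) ` tips"
proof
  show "vertices X \<subseteq> node ` V \<union> (\<lambda>t. {g t}) ` tips"
  proof
    fix x assume "x \<in> vertices X"
    then obtain h where h: "h \<in> labels V E" "x = vertex_of X (g h)"
      by (auto simp: vertices_def half_edges_eq)
    from C h(1) show "x \<in> node ` V \<union> (\<lambda>t. {g t}) ` tips"
    proof (cases rule: label_cases)
      case (1 v)
      then show ?thesis using h vertex_node by auto
    next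
      case (2 v)
      then have "h \<in> tips" by (auto simp: tips_def)
      then show ?thesis using h vertex_tip by auto
    qed
  qed
  have "node v \<in> vertices X" if "v \<in> V" for v
    using that vertex_half(3)[OF that] unfolding vertices_def half_edges_eq
    by (metis imageI in_labels(3))
  moreover have "{g t} \<in> vertices X" if "t \<in> tips" for t
    using that vertex_tip[OF that] tips_labels unfolding vertices_def half_edges_eq
    by (metis imageI subsetD)
  ultimately show "node ` V \<union> (\<lambda>t. {g t}) ` tips \<subseteq> vertices X" by auto
qed

lemma nodes_eq: "nodes X = node ` V"
  using node_card_ge by (auto simp: nodes_def vertices_eq)

lemma leaves_eq: "leaves X = (\<lambda>t. {g t}) ` tips"
  using node_card_ge by (fastforce simp: leaves_def vertices_eq)

lemma node_not_leaf: "v \<in> V \<Longrightarrow> node v \<notin> leaves X"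
  using node_card_ge[of v] by (auto simp: leaves_def)

lemma plain_ends: "e \<in> E \<Longrightarrow> edge_ends X (plain e) = {node (bv e), node (rv e)}"
  by (simp add: edge_ends_def plain_def vertex_half)

definition base :: "diagram_half_edge \<Rightarrow> real" where
  "base t = (case t of Left_bud_tip v \<Rightarrow> v | Right_bud_tip v \<Rightarrow> v)"

lemma base: "t \<in> tips \<Longrightarrow> base t \<in> V"
  by (auto simp: tips_def base_def)

lemma bud_ends: "t \<in> tips \<Longrightarrow> edge_ends X (bud t) = {{g t}, node (base t)}"
proof -
  assume t: "t \<in> tips"
  then obtain v where v: "v \<in> V" "t = Left_bud_tip v \<or> t = Right_bud_tip v" by (auto simp: tips_def)
  have "vertex_of X (g (gamma_opp t)) = node (base t)"
    using v by (auto simp: base_def vertex_half)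
  then show ?thesis using vertex_tip[OF t] by (simp add: edge_ends_def bud_def)
qed

lemma edges_eq: "edges X = plain ` E \<union> bud ` tips"
proof
  show "edges X \<subseteq> plain ` E \<union> bud ` tips"
  proof
    fix x assume "x \<in> edges X"
    then obtain h where h: "h \<in> labels V E" "x = {g h, g (gamma_opp h)}"
      by (auto simp: edges_def half_edges_eq)
    show "x \<in> plain ` E \<union> bud ` tips"
      using h by (cases h) (auto simp: plain_def bud_def tips_def insert_commute image_Un image_image)
  qed
  have "{g h, g (gamma_opp h)} \<in> edges X" if "h \<in> labels V E" for h
    using that by (force simp: edges_def half_edges_eq)
  from this[of "Upper_half _"] this[OF subsetD[OF tips_labels]]
  show "plain ` E \<union> bud ` tips \<subseteq> edges X" by (auto simp: plain_def bud_def)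
qed

lemma plain_no_leaf: "e \<in> E \<Longrightarrow> edge_ends X (plain e) \<inter> leaves X = {}"
  using node_not_leaf ends by (simp add: plain_ends)

lemma bud_leaf: "t \<in> tips \<Longrightarrow> edge_ends X (bud t) \<inter> leaves X \<noteq> {}"
  by (auto simp: bud_ends leaves_eq)

lemma plain_edges_eq: "plain_edges X = plain ` E"
  unfolding plain_edges_def edges_eq using plain_no_leaf bud_leaf by blast

lemma bud_edges_eq: "bud_edges X = bud ` tips"
  unfolding bud_edges_def edges_eq using plain_no_leaf bud_leaf by blast

lemma plain_inj: "inj_on plain E"
  by (rule inj_onI) (auto simp: plain_def doubleton_eq_iff)

lemma in_plain_edges: "h \<in> labels V E \<Longrightarrow> g h \<in> \<Union> (plain_edges X) \<longleftrightarrow> gamma_color h \<noteq> None"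
  by (cases h) (auto simp: plain_edges_eq plain_def)

lemma in_bud_edges: "h \<in> labels V E \<Longrightarrow> g h \<in> \<Union> (bud_edges X) \<longleftrightarrow> gamma_color h = None"
  using tips_labels by (cases h) (force simp: bud_edges_eq bud_def tips_def)+

lemma is_tree_X: "is_tree (vertices X) (edges X) (edge_ends X)"
proof -
  have "is_tree (node ` V) (plain ` E) (edge_ends X)"
    by (rule is_tree_isomorphic[OF T node_inj plain_inj]) (simp add: plain_ends)
  \<comment> \<open>A leaf is a singleton; its element together with the opposite half is the bud
    edge. This expresses the edge as a function of the leaf.\<close>
  let ?b = "\<lambda>l. {the_elem l, opp X (the_elem l)}"
  have b: "?b {g t} = bud t" if "t \<in> tips" for t
    using that tips_labels by (auto simp: bud_def)
  have bud_inj: "t = s" if "t \<in> tips" "s \<in> tips" "bud t = bud s" for t s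
    using that by (auto simp: tips_def bud_def doubleton_eq_iff)
  have "?b ` leaves X = bud ` tips"
    unfolding leaves_eq image_image by (rule image_cong) (use b in auto)
  moreover have "is_tree (node ` V \<union> leaves X) (plain ` E \<union> ?b ` leaves X) (edge_ends X)"
  proof (rule tree_insert_pendants)
    show "is_tree (node ` V) (plain ` E) (edge_ends X)" by fact
    show "finite (leaves X)" using fin by (simp add: leaves_eq tips_def)
    show "inj_on ?b (leaves X)"
    proof
      fix l m assume "l \<in> leaves X" "m \<in> leaves X" and e: "?b l = ?b m"
      then obtain t s where ts: "t \<in> tips" "l = {g t}" "s \<in> tips" "m = {g s}"
        by (auto simp: leaves_eq)
      then have "bud t = bud s" using b[of t] b[of s] e by simp
      then show "l = m" using bud_inj ts by blast
    qed
    show "leaves X \<inter> node ` V = {}" using node_not_leaf by auto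
    show "?b ` leaves X \<inter> plain ` E = {}"
    proof -
      have "bud t \<noteq> plain e" if "t \<in> tips" "e \<in> E" for t e
        using that by (auto simp: tips_def bud_def plain_def doubleton_eq_iff)
      then show ?thesis unfolding \<open>?b ` leaves X = bud ` tips\<close> by auto
    qed
    show "\<exists>u\<in>node ` V. edge_ends X (?b l) = {l, u}" if l: "l \<in> leaves X" for l
    proof -
      obtain t where t: "t \<in> tips" "l = {g t}" using l by (auto simp: leaves_eq)
      then show ?thesis using b[OF t(1)] bud_ends[OF t(1)] base[OF t(1)] by auto
    qed
  qed
  ultimately show ?thesis by (simp add: vertices_eq edges_eq leaves_eq)
qed

text \<open>On a finite set surjectivity suffices, and a half-edge that lies in its own orbit is
  either fixed or the successor of an element of that orbit.\<close>

lemma rot_bij: "bij_betw (rot X) (half_edges X) (half_edges X)"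
proof -
  have sub: "rot X ` half_edges X \<subseteq> half_edges X"
    using label_rot_labels[OF C] by (auto simp: half_edges_eq)
  have fin: "finite (half_edges X)" using fin by (auto simp: half_edges_eq labels_def)
  have "half_edges X \<subseteq> rot X ` half_edges X"
  proof
    fix x assume "x \<in> half_edges X"
    then obtain h where h: "h \<in> labels V E" "x = g h" by (auto simp: half_edges_eq)
    from C h(1) show "x \<in> rot X ` half_edges X"
    proof (cases rule: label_cases)
      case (1 v)
      have "x \<in> node v" using 1 h by (simp add: node_def)
      then have "x \<in> orbit (rot X) x" using vertex_node[OF 1] h by (simp add: vertex_of_def)
      then show ?thesis
      proof cases
        case base
        then show ?thesis using \<open>x \<in> half_edges X\<close> by (metis imageI)
      next
        case (step y)
        then have "y \<in> node v" using vertex_node[OF 1] h by (simp add: vertex_of_def)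
        then have "y \<in> half_edges X" using around_labels[OF C 1(1)] by (auto simp: node_def half_edges_eq)
        then show ?thesis using step by blast
      qed
    next
      case (2 v)
      then have "rot X x = x" using h by auto
      then show ?thesis using \<open>x \<in> half_edges X\<close> by (metis imageI)
    qed
  qed
  then show ?thesis
    using sub fin by (simp add: bij_betw_def finite_surj_inj subset_antisym)
qed

lemma node_pow:
  assumes v: "v \<in> V" and i: "i < length (around bl rl v)"
  shows "(rot X ^^ i) (g (Right_bud v)) = g (around bl rl v ! i)"
proof -
  let ?a = "around bl rl v"
  have "(rot X ^^ i) (map g ?a ! 0) = map g ?a ! ((0 + i) mod length (map g ?a))"
  proof (rule funpow_cyclic_list)
    fix j assume j: "j < length (map g ?a)"
    then have "?a ! j \<in> labels V E" using around_labels[OF C v] by auto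
    moreover have "Suc j mod length ?a < length ?a" using j by (intro mod_less_divisor) auto
    ultimately show "rot X (map g ?a ! j) = map g ?a ! (Suc j mod length (map g ?a))"
      using j label_rot_nth[OF C v] by simp
  qed (simp add: around_def)
  moreover have "?a ! 0 = Right_bud v" "?a \<noteq> []" by (simp_all add: around_def)
  ultimately show ?thesis using i by simp
qed

theorem blossoming_tree_X: "blossoming_tree X"
  unfolding blossoming_tree_def plane_tree_def
proof (intro conjI ballI)
  show "finite (half_edges X)" using fin by (auto simp: half_edges_eq labels_def)
  show "bij_betw (rot X) (half_edges X) (half_edges X)" by (rule rot_bij)
  show "is_tree (vertices X) (edges X) (edge_ends X)" by (rule is_tree_X)
  fix x assume "x \<in> half_edges X"
  then obtain h where "h \<in> labels V E" "x = g h" by (auto simp: half_edges_eq)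
  then show "opp X x \<in> half_edges X" "opp X x \<noteq> x" "opp X (opp X x) = x"
    using gamma_opp_labels by (auto simp: half_edges_eq)
next
  have "card (nodes X) = Suc (card E)"
    using tree_card[OF T] node_inj by (simp add: nodes_eq card_image)
  moreover have "card E \<ge> 1" using nonempty fin by (simp add: Suc_le_eq card_gt_0_iff)
  ultimately show "card (nodes X) \<ge> 2" by simp
next
  fix n assume "n \<in> nodes X"
  then obtain v where v: "v \<in> V" "n = node v" by (auto simp: nodes_eq)
  let ?L = "{l \<in> leaves X. \<exists>e\<in>edges X. edge_ends X e = {n, l}}"
  have "?L = {{g (Left_bud_tip v)}, {g (Right_bud_tip v)}}"
  proof
    show "?L \<subseteq> {{g (Left_bud_tip v)}, {g (Right_bud_tip v)}}"
    proof
      fix l assume "l \<in> ?L"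
      then obtain e where l: "l \<in> leaves X" "e \<in> edges X" "edge_ends X e = {n, l}" by blast
      consider w where "w \<in> E" "e = plain w" | t where "t \<in> tips" "e = bud t"
        using l by (auto simp: edges_eq)
      then show "l \<in> {{g (Left_bud_tip v)}, {g (Right_bud_tip v)}}"
      proof cases
        case 1
        then have "l \<in> {node (bv w), node (rv w)}" using l plain_ends by auto
        then show ?thesis using node_not_leaf ends[OF 1(1)] l by auto
      next
        case 2
        then have eq: "{{g t}, node (base t)} = {node v, l}" using l bud_ends v by simp
        have "{g t} \<noteq> node v" using node_card_ge[OF v(1)] by (auto dest: arg_cong[of _ _ card])
        then have "l = {g t}" "node (base t) = node v" using eq by (auto simp: doubleton_eq_iff)
        then have "base t = v" using node_inj base[OF 2(1)] v by (auto dest: inj_onD)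
        then show ?thesis using 2 \<open>l = {g t}\<close> by (auto simp: tips_def base_def)
      qed
    qed
    have "{g t} \<in> ?L" if "t \<in> tips" "base t = v" for t
      using that bud_ends[OF that(1)] v by (auto simp: leaves_eq edges_eq insert_commute)
    from this[of "Left_bud_tip v"] this[of "Right_bud_tip v"]
    show "{{g (Left_bud_tip v)}, {g (Right_bud_tip v)}} \<subseteq> ?L"
      using v by (auto simp: tips_def base_def)
  qed
  then show "card ?L = 2" using v by simp
qed

theorem card_plain_edges: "card (plain_edges X) = card E"
  by (simp add: plain_edges_eq card_image plain_inj)

theorem bicolored_X: "bicolored X"
  unfolding bicolored_def
proof (intro conjI ballI)
  fix x assume "x \<in> half_edges X"
  then obtain h where h: "h \<in> labels V E" "x = g h" by (auto simp: half_edges_eq)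
  then show "(half_color X x \<noteq> None) = (x \<in> \<Union> (plain_edges X))"
    using in_plain_edges[OF h(1)] by simp
next
  fix x assume "x \<in> \<Union> (plain_edges X)"
  then obtain e where "e \<in> E" "x \<in> plain e" by (auto simp: plain_edges_eq)
  then show "half_color X x \<noteq> half_color X (opp X x)" by (auto simp: plain_def)
next
  fix n assume "n \<in> nodes X"
  then obtain v where v: "v \<in> V" "n = node v" by (auto simp: nodes_eq)
  let ?a = "around bl rl v" and ?p = "g (Right_bud v)" and ?k = "Suc (length (bl v))"
  have len: "length ?a = Suc (?k + length (rl v))" by (simp add: around_def)
  note pow = node_pow[OF v(1)]
  have lab: "?a ! i \<in> labels V E" if "i < length ?a" for i
    using around_labels[OF C v(1)] that by auto
  show "buds_separate_colors X n"
    unfolding buds_separate_colors_def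
  \<comment> \<open>The turn starts at the right bud; after all blue half-edges, the left bud comes
    at position \<open>?k\<close>.\<close>
  proof (intro bexI[of _ ?p] exI[of _ ?k] conjI allI impI)
    show "?p \<in> n" using v node_buds by simp
    show "0 < ?k" "?k < card n" using v len by (auto simp: node_card)
    show "?p \<in> \<Union> (bud_edges X)" using in_bud_edges[of "Right_bud v"] v by simp
    have "?a ! ?k = Left_bud v" by (simp add: around_def nth_append)
    then show "(rot X ^^ ?k) ?p \<in> \<Union> (bud_edges X)"
      using pow[of ?k] len in_bud_edges[of "Left_bud v"] v by simp
  next
    fix i assume i: "0 < i \<and> i < ?k"
    then have "?a ! i = Upper_half (bl v ! (i - 1))" by (auto simp: around_def nth_append nth_Cons')
    then show "half_color X ((rot X ^^ i) ?p) = Some Blue"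
      using pow[of i] lab[of i] i len by simp
  next
    fix i assume i: "?k < i \<and> i < card n"
    then have l: "i < length ?a" using v by (simp add: node_card)
    then have "?a ! i = Lower_half (rl v ! (i - ?k - 1))"
      using i len by (auto simp: around_def nth_append nth_Cons')
    then show "half_color X ((rot X ^^ i) ?p) = Some Red"
      using pow[OF l] lab[OF l] by simp
  qed
qed

end

section \<open>Recovering the colored graph from its half-edge map\<close>

context realization
begin

text \<open>Once the right bud is known, iterating the rotation of \<open>X\<close> recovers the
  whole list and thus both linear orders at \<open>v\<close>.\<close>

lemma node_list:
  assumes v: "v \<in> V"
  shows "map g (around bl rl v) =
    map (\<lambda>i. (rot X ^^ i) (g (Right_bud v))) [0..<card (vertex_of X (g (Right_bud v)))]"
proof (rule nth_equalityI)
  show "length (map g (around bl rl v)) =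
    length (map (\<lambda>i. (rot X ^^ i) (g (Right_bud v))) [0..<card (vertex_of X (g (Right_bud v)))])"
    using v by (simp add: vertex_half node_card)
qed (use v in \<open>simp add: vertex_half node_card node_pow\<close>)

lemma rot_right_bud:
  assumes v: "v \<in> V"
  shows "rot X (g (Right_bud v)) = g (case bl v of [] \<Rightarrow> Left_bud v | e # _ \<Rightarrow> Upper_half e)"
proof -
  have "label_rot bv rv bl rl (around bl rl v ! 0) = around bl rl v ! (Suc 0 mod length (around bl rl v))"
    by (rule label_rot_nth[OF C v]) (simp add: around_def)
  then show ?thesis using v by (simp add: around_def nth_append split: list.split)
qed

lemma rot_left_bud:
  assumes v: "v \<in> V"
  shows "rot X (g (Left_bud v)) = g (case rl v of [] \<Rightarrow> Right_bud v | e # _ \<Rightarrow> Lower_half e)"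
proof -
  let ?k = "Suc (length (bl v))"
  have "label_rot bv rv bl rl (around bl rl v ! ?k) =
      around bl rl v ! (Suc ?k mod length (around bl rl v))"
    by (rule label_rot_nth[OF C v]) (simp add: around_def)
  then show ?thesis using v by (simp add: around_def nth_append split: list.split)
qed

text \<open>With an edge at every vertex, colors and rotation tell the right bud from the left one;
  see \<open>common_vertex\<close>.\<close>

lemma not_isolated:
  assumes v: "v \<in> V"
  shows "bl v \<noteq> [] \<or> rl v \<noteq> []"
proof -
  have "card E \<ge> 1" using nonempty fin by (simp add: Suc_le_eq card_gt_0_iff)
  then have "card V \<ge> 2" using tree_card[OF T] by simp
  then obtain w where w: "w \<in> V" "w \<noteq> v"
  proof -
    have "\<not> card V \<le> Suc 0" using \<open>card V \<ge> 2\<close> by simp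
    then have "\<exists>w\<in>V. w \<noteq> v" unfolding card_le_Suc0_iff_eq[OF fin(1)] using v by metis
    then show thesis using that by blast
  qed
  have "(v, w) \<in> {(x, y). \<exists>e\<in>E. {bv e, rv e} = {x, y}}\<^sup>*"
    using T v w unfolding is_tree_def by blast
  then obtain u e where "e \<in> E" "{bv e, rv e} = {v, u}"
    using w(2) by (auto elim: converse_rtranclE)
  then have "e \<in> E" "bv e = v \<or> rv e = v" by (auto simp: doubleton_eq_iff)
  moreover have "set (bl v) = {e \<in> E. bv e = v}" "set (rl v) = {e \<in> E. rv e = v}"
    using C v unfolding colored_graph_def by blast+
  ultimately show ?thesis by (metis (mono_tags, lifting) empty_iff list.set(1) mem_Collect_eq)
qed

lemma Blue_half_edge:
  assumes "x \<in> half_edges X" "half_color X x = Some Blue"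
  obtains e where "e \<in> E" "x = g (Upper_half e)"
proof -
  obtain h where h: "h \<in> labels V E" "x = g h" using assms by (auto simp: half_edges_eq)
  then have "gamma_color h = Some Blue" using assms by simp
  with h that show thesis by (cases h) auto
qed

lemma bud_half_edge:
  assumes "x \<in> half_edges X" "half_color X x = None" "card (vertex_of X x) \<noteq> 1"
  obtains v where "v \<in> V" "x = g (Right_bud v) \<or> x = g (Left_bud v)"
proof -
  obtain h where h: "h \<in> labels V E" "x = g h" using assms by (auto simp: half_edges_eq)
  then have c: "gamma_color h = None" using assms by simp
  have "h \<notin> tips" using vertex_tip[of h] h assms(3) by auto
  with c h that show thesis by (cases h) (auto simp: tips_def)
qed

end

lemma common_edge:
  assumes S: "realization V E bv rv bl rl g X" and S': "realization V' E' bv' rv' bl' rl' g' X"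
    and e: "e \<in> E"
  shows "\<exists>e'\<in>E'. g (Upper_half e) = g' (Upper_half e')"
proof -
  interpret S: realization V E bv rv bl rl g X by fact
  interpret S': realization V' E' bv' rv' bl' rl' g' X by fact
  show ?thesis using S'.Blue_half_edge[of "g (Upper_half e)"] e
    by (metis S.X_g(3) S.half_edges_eq gamma_color.simps(1) imageI in_labels(1))
qed

text \<open>Buds carry no color and have to be told apart by what follows them. After a right bud
  comes a blue half-edge, or else the other bud and then a red one; after a left bud comes a red
  half-edge, or else the other bud and then no red one.\<close>

lemma common_vertex:
  assumes S: "realization V E bv rv bl rl g X" and S': "realization V' E' bv' rv' bl' rl' g' X"
    and v: "v \<in> V"
  shows "\<exists>v'\<in>V'. g (Right_bud v) = g' (Right_bud v')"
proof -
  interpret S: realization V E bv rv bl rl g X by fact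
  interpret S': realization V' E' bv' rv' bl' rl' g' X by fact
  let ?x = "g (Right_bud v)"
  have x: "?x \<in> half_edges X" "half_color X ?x = None" "card (vertex_of X ?x) \<noteq> 1"
    using v S.node_card_ge[OF v] by (auto simp: S.half_edges_eq S.vertex_half)
  have subE: "set (bl v) \<subseteq> E" "set (rl v) \<subseteq> E"
    using S.C v by (auto simp: colored_graph_def)
  obtain v' where v': "v' \<in> V'" "?x = g' (Right_bud v') \<or> ?x = g' (Left_bud v')"
    using S'.bud_half_edge[OF x] by blast
  have subE': "set (bl' v') \<subseteq> E'" "set (rl' v') \<subseteq> E'"
    using S'.C v' by (auto simp: colored_graph_def)
  have False if l: "?x = g' (Left_bud v')"
  proof (cases "bl v")
    case Nil
    then obtain r rs where r: "rl v = r # rs" using S.not_isolated[OF v] by (cases "rl v") auto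
    have c1: "half_color X (rot X ?x) = None" "half_color X (rot X (rot X ?x)) = Some Red"
      using v Nil r subE by (auto simp: S.rot_right_bud S.rot_left_bud simp del: S.X_g(1))
    have "rl' v' = []"
      using c1(1) v' subE' unfolding l by (auto simp: S'.rot_left_bud simp del: S'.X_g(1) split: list.splits)
    then show False
      using c1(2) v' subE' unfolding l
      by (auto simp: S'.rot_left_bud S'.rot_right_bud simp del: S'.X_g(1) split: list.splits)
  next
    case (Cons b bs)
    then have "half_color X (rot X ?x) = Some Blue"
      using v subE by (simp add: S.rot_right_bud del: S.X_g(1))
    then show False
      using v' subE' unfolding l
      by (auto simp: S'.rot_left_bud simp del: S'.X_g(1) split: list.splits)
  qed
  with v' show ?thesis by blast
qed

lemma realizations_isomorphic:
  assumes "realization V E bv rv bl rl g X" "realization V' E' bv' rv' bl' rl' g' X"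
  obtains i j where "bij_betw i V V'" "bij_betw j E E'"
    "\<forall>v\<in>V. bl' (i v) = map j (bl v) \<and> rl' (i v) = map j (rl v)"
proof -
  interpret S: realization V E bv rv bl rl g X by fact
  interpret S': realization V' E' bv' rv' bl' rl' g' X by fact
  obtain j where j: "\<And>e. e \<in> E \<Longrightarrow> j e \<in> E' \<and> g (Upper_half e) = g' (Upper_half (j e))"
    using common_edge[OF assms] by metis
  obtain i where i: "\<And>v. v \<in> V \<Longrightarrow> i v \<in> V' \<and> g (Right_bud v) = g' (Right_bud (i v))"
    using common_vertex[OF assms] by metis
  have lower: "g (Lower_half e) = g' (Lower_half (j e))" if e: "e \<in> E" for e
    using j[OF e] e S.X_g(2)[of "Upper_half e"] S'.X_g(2)[of "Upper_half (j e)"] by simp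
  have bi: "bij_betw i V V'"
    unfolding bij_betw_def
  proof (intro conjI inj_onI subset_antisym subsetI)
    fix u v assume "u \<in> V" "v \<in> V" "i u = i v"
    then show "u = v" using i[of u] i[of v] S.g_eq[of "Right_bud u" "Right_bud v"] by simp
  next
    fix v' assume v': "v' \<in> V'"
    then obtain v where v: "v \<in> V" "g' (Right_bud v') = g (Right_bud v)"
      using common_vertex[OF assms(2,1)] by blast
    then have "i v = v'" using i[OF v(1)] v' S'.g_eq[of "Right_bud v'" "Right_bud (i v)"] by simp
    then show "v' \<in> i ` V" using v by blast
  qed (use i in auto)
  have bj: "bij_betw j E E'"
    unfolding bij_betw_def
  proof (intro conjI inj_onI subset_antisym subsetI)
    fix u v assume "u \<in> E" "v \<in> E" "j u = j v"
    then show "u = v" using j[of u] j[of v] S.g_eq[of "Upper_half u" "Upper_half v"] by simp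
  next
    fix v' assume v': "v' \<in> E'"
    then obtain v where v: "v \<in> E" "g' (Upper_half v') = g (Upper_half v)"
      using common_edge[OF assms(2,1)] by blast
    then have "j v = v'" using j[OF v(1)] v' S'.g_eq[of "Upper_half v'" "Upper_half (j v)"] by simp
    then show "v' \<in> j ` E" using v by blast
  qed (use j in auto)
  have lists: "bl' (i v) = map j (bl v) \<and> rl' (i v) = map j (rl v)" if v: "v \<in> V" for v
  proof -
    have iv: "i v \<in> V'" "g (Right_bud v) = g' (Right_bud (i v))" using i v by auto
    have subE: "set (bl v) \<subseteq> E" "set (rl v) \<subseteq> E"
      using S.C v by (auto simp: colored_graph_def)
    have subE': "set (bl' (i v)) \<subseteq> E'" "set (rl' (i v)) \<subseteq> E'"
      using S'.C iv by (auto simp: colored_graph_def)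
    have eq: "map g (around bl rl v) = map g' (around bl' rl' (i v))"
      using S.node_list[OF v] S'.node_list[OF iv(1)] iv(2) by simp
    have "map (half_color X) (map g (around bl rl v)) = map gamma_color (around bl rl v)"
      using around_labels[OF S.C v] by auto
    moreover have "map (half_color X) (map g' (around bl' rl' (i v))) = map gamma_color (around bl' rl' (i v))"
      using around_labels[OF S'.C iv(1)] by auto
    ultimately have "map gamma_color (around bl rl v) = map gamma_color (around bl' rl' (i v))"
      using eq by simp
    then have c: "map (\<lambda>_. Some Blue) (bl v) @ None # map (\<lambda>_. Some Red) (rl v) =
        map (\<lambda>_. Some Blue) (bl' (i v)) @ None # map (\<lambda>_. Some Red) (rl' (i v))"
      by (simp add: around_def comp_def)
    \<comment> \<open>The left bud is the first uncolored entry after the right one, so the sequence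
      of colors determines the number of blue half-edges.\<close>
    have "length (takeWhile (\<lambda>c. c \<noteq> None) (map (\<lambda>_. Some Blue) b @ None # r)) = length b"
      for b r and b' :: "real list"
      by (induction b) auto
    from this[of "bl v"] this[of "bl' (i v)"] have len: "length (bl v) = length (bl' (i v))"
      using c by metis
    have "map (g \<circ> Upper_half) (bl v) = map (g' \<circ> Upper_half) (bl' (i v))"
      "map (g \<circ> Lower_half) (rl v) = map (g' \<circ> Lower_half) (rl' (i v))"
      using eq len by (auto simp: around_def)
    moreover have "map (g \<circ> Upper_half) (bl v) = map (g' \<circ> Upper_half) (map j (bl v))"
      "map (g \<circ> Lower_half) (rl v) = map (g' \<circ> Lower_half) (map j (rl v))"
      using subE j lower by (auto simp: subset_iff)
    moreover have "inj_on (g' \<circ> Upper_half) E'" "inj_on (g' \<circ> Lower_half) E'"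
      by (auto intro!: inj_onI)
    moreover have "set (map j (bl v)) \<subseteq> E'" "set (map j (rl v)) \<subseteq> E'"
      using subE j by auto
    ultimately show ?thesis
      using subE' inj_on_map_eq_map[OF inj_on_subset] by (metis Un_least)
  qed
  show thesis using that[OF bi bj] lists by blast
qed

section \<open>Colored graphs of blossoming trees\<close>

locale bicolored_blossoming =
  fixes X :: "nat half_edge_map"
  assumes blossoming: "blossoming_tree X" and bicol: "bicolored X"
begin

abbreviation "H \<equiv> half_edges X"

lemma plane: "finite H" "bij_betw (rot X) H H" "is_tree (vertices X) (edges X) (edge_ends X)"
  using blossoming by (auto simp: blossoming_tree_def plane_tree_def)

lemma opp: "h \<in> H \<Longrightarrow> opp X h \<in> H" "h \<in> H \<Longrightarrow> opp X h \<noteq> h" "h \<in> H \<Longrightarrow> opp X (opp X h) = h"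
  using blossoming by (auto simp: blossoming_tree_def plane_tree_def)

lemma rot_H: "h \<in> H \<Longrightarrow> rot X h \<in> H"
  using plane(2) bij_betwE by blast

text \<open>An orbit starts only after one step, and \<open>rot X\<close> is arbitrary outside
  \<open>H\<close>. Restricted to \<open>H\<close> it is a permutation of a finite set, which
  returns to its starting point.\<close>

lemma self_orbit:
  assumes "h \<in> H"
  shows "h \<in> orbit (rot X) h"
proof -
  let ?f = "perm_restrict (rot X) H"
  have "?f permutes H"
    using plane(2) by (intro bij_imp_permutes) (simp_all add: perm_restrict_def cong: bij_betw_cong)
  then have "permutation ?f" using plane(1) permutation_permutes by blast
  then have "h \<in> orbit ?f h" by (rule permutation_self_in_orbit)
  moreover have "orbit (rot X) h = orbit ?f h"
    by (rule orbit_cong0[OF assms]) (auto simp: perm_restrict_def rot_H)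
  ultimately show ?thesis by simp
qed

lemma vertex_self: "h \<in> H \<Longrightarrow> h \<in> vertex_of X h"
  by (simp add: self_orbit vertex_of_def)

lemma vertex_subset: "h \<in> H \<Longrightarrow> vertex_of X h \<subseteq> H"
proof
  fix x assume h: "h \<in> H" and "x \<in> vertex_of X h"
  from this(2)[unfolded vertex_of_def] show "x \<in> H"
    by induction (use h rot_H in auto)
qed

lemma vertex_eq:
  assumes "h \<in> H" "x \<in> vertex_of X h"
  shows "vertex_of X x = vertex_of X h"
  using assms orbit_swap[OF self_orbit[OF assms(1)]] orbit_trans
  unfolding vertex_of_def by (meson subsetI subset_antisym)

lemma vertexD:
  assumes "n \<in> vertices X" "h \<in> n"
  shows "h \<in> H" "vertex_of X h = n"
proof -
  obtain x where x: "x \<in> H" "n = vertex_of X x" using assms(1) by (auto simp: vertices_def)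
  show "h \<in> H" "vertex_of X h = n"
    using vertex_eq[OF x(1)] vertex_subset[OF x(1)] assms(2) x(2) by blast+
qed

lemma vertex_finite: "n \<in> vertices X \<Longrightarrow> finite n"
  using vertex_subset plane(1) finite_subset unfolding vertices_def by blast

lemma vertex_in: "h \<in> H \<Longrightarrow> vertex_of X h \<in> vertices X"
  by (simp add: vertices_def)

lemma vertex_list:
  assumes "h \<in> H"
  shows "vertex_of X h = (\<lambda>i. (rot X ^^ i) h) ` {..<card (vertex_of X h)}"
    and "inj_on (\<lambda>i. (rot X ^^ i) h) {..<card (vertex_of X h)}"
    and "(rot X ^^ card (vertex_of X h)) h = h"
proof -
  let ?m = "funpow_dist1 (rot X) h h"
  note s = self_orbit[OF assms]
  have e: "vertex_of X h = (\<lambda>i. (rot X ^^ i) h) ` {..<?m}"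
    using orbit_conv_funpow_dist1[OF s] by (simp add: vertex_of_def lessThan_atLeast0)
  have i: "inj_on (\<lambda>i. (rot X ^^ i) h) {..<?m}"
    using inj_on_funpow_dist1[OF s] by (simp add: lessThan_atLeast0)
  have m: "card (vertex_of X h) = ?m" unfolding e using i by (simp add: card_image)
  show "vertex_of X h = (\<lambda>i. (rot X ^^ i) h) ` {..<card (vertex_of X h)}"
    "inj_on (\<lambda>i. (rot X ^^ i) h) {..<card (vertex_of X h)}" unfolding m using e i by blast+
  show "(rot X ^^ card (vertex_of X h)) h = h" unfolding m by (rule funpow_dist1_prop[OF s])
qed

lemma leaf_or_node: "n \<in> vertices X \<Longrightarrow> n \<notin> leaves X \<longleftrightarrow> n \<in> nodes X"
proof -
  assume n: "n \<in> vertices X"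
  then have "n \<noteq> {}" using vertex_self by (auto simp: vertices_def)
  then have "card n \<noteq> 0" using vertex_finite[OF n] by simp
  then show ?thesis using n by (auto simp: leaves_def nodes_def)
qed

lemma leaf_vertex:
  assumes "h \<in> H" "vertex_of X h \<in> leaves X"
  shows "vertex_of X h = {h}"
  using assms vertex_self[OF assms(1)] by (auto simp: leaves_def card_1_singleton_iff)

lemma in_edge: "e \<in> edges X \<Longrightarrow> h \<in> e \<Longrightarrow> h \<in> H \<and> e = {h, opp X h}"
  using opp by (auto simp: edges_def insert_commute)

lemma edge_of: "h \<in> H \<Longrightarrow> {h, opp X h} \<in> edges X"
  by (auto simp: edges_def)

lemma in_bud_edges:
  assumes "h \<in> H"
  shows "h \<in> \<Union> (bud_edges X) \<longleftrightarrow>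
    vertex_of X h \<in> leaves X \<or> vertex_of X (opp X h) \<in> leaves X"
proof
  assume "h \<in> \<Union> (bud_edges X)"
  then obtain e where e: "e \<in> edges X" "edge_ends X e \<inter> leaves X \<noteq> {}" "h \<in> e"
    by (auto simp: bud_edges_def)
  then have "e = {h, opp X h}" using in_edge by blast
  with e(2) show "vertex_of X h \<in> leaves X \<or> vertex_of X (opp X h) \<in> leaves X"
    by (auto simp: edge_ends_def)
next
  assume "vertex_of X h \<in> leaves X \<or> vertex_of X (opp X h) \<in> leaves X"
  then have "{h, opp X h} \<in> bud_edges X"
    using edge_of[OF assms] by (auto simp: bud_edges_def edge_ends_def)
  then show "h \<in> \<Union> (bud_edges X)" by blast
qed

lemma color_None:
  assumes "h \<in> H"
  shows "half_color X h = None \<longleftrightarrow> h \<in> \<Union> (bud_edges X)"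
proof -
  have "h \<in> \<Union> (plain_edges X) \<longleftrightarrow> h \<notin> \<Union> (bud_edges X)"
  proof -
    have "h \<in> \<Union> (plain_edges X) \<longleftrightarrow> {h, opp X h} \<in> plain_edges X"
      "h \<in> \<Union> (bud_edges X) \<longleftrightarrow> {h, opp X h} \<in> bud_edges X"
      using in_edge unfolding plain_edges_def bud_edges_def by blast+
    then show ?thesis using edge_of[OF assms] unfolding plain_edges_def bud_edges_def by blast
  qed
  then show ?thesis using bicol assms unfolding bicolored_def by blast
qed

text \<open>An edge between two leaves would be a connected component of its own, but the tree is
  connected and has nodes.\<close>

lemma leaf_opp:
  assumes h: "h \<in> H" "vertex_of X h \<in> leaves X"
  shows "vertex_of X (opp X h) \<in> nodes X"
proof (rule ccontr)
  assume "\<not> ?thesis"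
  then have o: "vertex_of X (opp X h) \<in> leaves X" using leaf_or_node vertex_in opp(1) h(1) by blast
  let ?h = "opp X h"
  have single: "vertex_of X h = {h}" "vertex_of X ?h = {?h}"
    using leaf_vertex h o opp(1) by blast+
  have "card (nodes X) \<ge> 2" using blossoming by (simp add: blossoming_tree_def)
  then have "nodes X \<noteq> {}" by auto
  then obtain n where n: "n \<in> nodes X" by blast
  then have "({h}, n) \<in> {(x, y). \<exists>e\<in>edges X. edge_ends X e = {x, y}}\<^sup>*"
  proof -
    have "{h} \<in> vertices X" "n \<in> vertices X"
      using vertex_in[OF h(1)] single n by (simp_all add: nodes_def)
    then show ?thesis using plane(3) unfolding is_tree_def by blast
  qed
  then have "n \<in> {{h}, {?h}}"
  proof (induction rule: rtrancl_induct)
    case (step a b)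
    then obtain e where e: "e \<in> edges X" "edge_ends X e = {a, b}" by auto
    then obtain x where x: "x \<in> H" "e = {x, opp X x}" by (auto simp: edges_def)
    then have ab: "{vertex_of X x, vertex_of X (opp X x)} = {a, b}"
      using e by (simp add: edge_ends_def)
    have "x \<in> {h, ?h}"
    proof -
      have "a = vertex_of X x \<or> a = vertex_of X (opp X x)" using ab by (auto simp: doubleton_eq_iff)
      then have "x \<in> a \<or> opp X x \<in> a" using vertex_self x opp by auto
      then have "x \<in> {h, ?h} \<or> opp X x \<in> {h, ?h}" using step by auto
      then show ?thesis using opp(3)[OF x(1)] opp(3)[OF h(1)] by (metis insert_iff singletonD)
    qed
    then have "{vertex_of X x, vertex_of X (opp X x)} = {{h}, {?h}}"
      using single opp(3)[OF h(1)] by (elim insertE) (simp_all add: insert_commute)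
    then have "{a, b} = {{h}, {?h}}" using ab by simp
    then show ?case by blast
  qed simp
  then show False using n by (auto simp: nodes_def)
qed

definition separates :: "nat set \<Rightarrow> nat \<Rightarrow> nat \<Rightarrow> bool" where
  "separates v p k \<longleftrightarrow> p \<in> v \<and> 0 < k \<and> k < card v \<and>
     p \<in> \<Union> (bud_edges X) \<and> (rot X ^^ k) p \<in> \<Union> (bud_edges X) \<and>
     (\<forall>i. 0 < i \<and> i < k \<longrightarrow> half_color X ((rot X ^^ i) p) = Some Blue) \<and>
     (\<forall>i. k < i \<and> i < card v \<longrightarrow> half_color X ((rot X ^^ i) p) = Some Red)"

text \<open>A bud that can serve as the right bud of \<open>v\<close>. The other bud is then at
  position \<open>blues v\<close>, one more than the number of blue half-edges at
  \<open>v\<close>.\<close>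

definition first :: "nat set \<Rightarrow> nat" where
  "first v = (SOME p. \<exists>k. separates v p k)"

definition blues :: "nat set \<Rightarrow> nat" where
  "blues v = (SOME k. separates v (first v) k)"

definition turn :: "nat set \<Rightarrow> nat \<Rightarrow> nat" where
  "turn v i = (rot X ^^ i) (first v)"

lemma separates_first: "v \<in> nodes X \<Longrightarrow> separates v (first v) (blues v)"
proof -
  assume "v \<in> nodes X"
  then have "buds_separate_colors X v" using bicol unfolding bicolored_def by blast
  then have "\<exists>p k. separates v p k"
    unfolding buds_separate_colors_def separates_def by (simp add: Bex_def)
  then have "\<exists>k. separates v (first v) k" unfolding first_def by (rule someI_ex)
  then show ?thesis unfolding blues_def by (rule someI_ex)
qed

context
  fixes v assumes v: "v \<in> nodes X"
begin

lemma first_in: "first v \<in> v" "first v \<in> H" "vertex_of X (first v) = v"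
  using separates_first[OF v] vertexD[of v "first v"] v by (auto simp: separates_def nodes_def)

lemma blues: "0 < blues v" "blues v < card v"
  using separates_first[OF v] by (auto simp: separates_def)

lemma turn_image: "v = turn v ` {..<card v}" and turn_inj: "inj_on (turn v) {..<card v}"
  and turn_card: "turn v (card v) = turn v 0" and turn_Suc: "rot X (turn v i) = turn v (Suc i)"
  using vertex_list[OF first_in(2)] by (auto simp: first_in turn_def[abs_def])

lemma turn_in: "i < card v \<Longrightarrow> turn v i \<in> v"
  using turn_image by blast

lemma turn_H: "i < card v \<Longrightarrow> turn v i \<in> H" and turn_vertex: "i < card v \<Longrightarrow> vertex_of X (turn v i) = v"
  using vertexD[of v "turn v i"] v turn_in by (auto simp: nodes_def)

lemma turn_color:
  assumes "i < card v"
  shows "half_color X (turn v i) =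
    (if i = 0 \<or> i = blues v then None else if i < blues v then Some Blue else Some Red)"
proof -
  have "half_color X (turn v i) = None" if "i = 0 \<or> i = blues v"
    using that separates_first[OF v] color_None[OF turn_H[OF assms]]
    by (auto simp: separates_def turn_def)
  then show ?thesis using separates_first[OF v] assms by (auto simp: separates_def turn_def)
qed

lemma bud_opp:
  assumes "i = 0 \<or> i = blues v"
  shows "vertex_of X (opp X (turn v i)) = {opp X (turn v i)}"
proof -
  have i: "i < card v" using assms blues by auto
  have "half_color X (turn v i) = None" using turn_color[OF i] assms by auto
  then have "v \<in> leaves X \<or> vertex_of X (opp X (turn v i)) \<in> leaves X"
    using color_None[OF turn_H[OF i]] in_bud_edges[OF turn_H[OF i]] turn_vertex[OF i] by simp
  moreover have "v \<notin> leaves X" using v by (auto simp: nodes_def leaves_def)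
  ultimately show ?thesis using leaf_vertex opp(1) turn_H[OF i] by blast
qed

end

text \<open>A half-edge at a leaf has its opposite half at a node by \<open>leaf_opp\<close>; that
  half is uncolored, hence one of the two buds in the turn around the node.\<close>

lemma half_edge_cases:
  assumes "h \<in> H"
  obtains (node) v i where "v \<in> nodes X" "i < card v" "h = turn v i"
  | (tip) v i where "v \<in> nodes X" "i = 0 \<or> i = blues v" "h = opp X (turn v i)"
proof (cases "vertex_of X h \<in> nodes X")
  case True
  then show thesis using node turn_image[OF True] vertex_self[OF assms] by blast
next
  case False
  then have l: "vertex_of X h \<in> leaves X" using leaf_or_node vertex_in assms by blast
  let ?v = "vertex_of X (opp X h)"
  have n: "?v \<in> nodes X" using leaf_opp[OF assms l] .
  have o: "opp X h \<in> H" "opp X (opp X h) = h" using opp assms by auto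
  then obtain i where i: "i < card ?v" "opp X h = turn ?v i"
    using turn_image[OF n] vertex_self by blast
  have "half_color X (opp X h) = None" using color_None[OF o(1)] in_bud_edges[OF o(1)] o(2) l by simp
  then have "i = 0 \<or> i = blues ?v" using turn_color[OF n i(1)] i(2) by (auto split: if_splits)
  moreover have "h = opp X (turn ?v i)" using i o by simp
  ultimately show thesis using tip[OF n] by blast
qed

lemma opp_color:
  assumes "h \<in> H"
  shows "half_color X (opp X h) =
    (case half_color X h of None \<Rightarrow> None | Some Blue \<Rightarrow> Some Red | Some Red \<Rightarrow> Some Blue)"
proof -
  note o = opp[OF assms]
  have n: "half_color X (opp X h) = None \<longleftrightarrow> half_color X h = None"
    using color_None[OF assms] color_None[OF o(1)] in_bud_edges[OF assms] in_bud_edges[OF o(1)] o(3)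
    by auto
  show ?thesis
  proof (cases "half_color X h")
    case (Some c)
    then have "h \<in> \<Union> (plain_edges X)" using bicol assms unfolding bicolored_def by (metis option.distinct(1))
    then have "half_color X h \<noteq> half_color X (opp X h)" using bicol unfolding bicolored_def by blast
    then show ?thesis using n Some
      by (cases c; cases "half_color X (opp X h)") (metis color.exhaust option.simps color.simps(3,4) not_None_eq)+
  qed (use n in simp)
qed

end

section \<open>Reading a colored tree off a blossoming tree\<close>

context bicolored_blossoming
begin

text \<open>
  The vertex \<open>v\<close> of the colored graph is represented by its right bud \<open>first v\<close>, an edge by its
  blue half, both coerced to real numbers in order to serve as labels.
\<close>

definition dec :: "real \<Rightarrow> nat" where
  "dec r = nat \<lfloor>r\<rfloor>"

lemma dec [simp]: "dec (real m) = m"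
  by (simp add: dec_def)

definition node_of :: "real \<Rightarrow> nat set" where
  "node_of r = vertex_of X (dec r)"

definition V :: "real set" where
  "V = (\<lambda>v. real (first v)) ` nodes X"

definition E :: "real set" where
  "E = real ` {h \<in> H. half_color X h = Some Blue}"

definition bv :: "real \<Rightarrow> real" where
  "bv r = real (first (node_of r))"

definition rv :: "real \<Rightarrow> real" where
  "rv r = real (first (vertex_of X (opp X (dec r))))"

definition bl :: "real \<Rightarrow> real list" where
  "bl r = map (\<lambda>i. real (turn (node_of r) i)) [1..<blues (node_of r)]"

text \<open>Edges are named by their blue halves, so the red half-edges at a node enter through
  their opposites.\<close>

definition rl :: "real \<Rightarrow> real list" where
  "rl r = map (\<lambda>i. real (opp X (turn (node_of r) i))) [Suc (blues (node_of r))..<card (node_of r)]"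

fun half :: "diagram_half_edge \<Rightarrow> nat" where
  "half (Upper_half r) = dec r"
| "half (Lower_half r) = opp X (dec r)"
| "half (Right_bud r) = dec r"
| "half (Left_bud r) = turn (node_of r) (blues (node_of r))"
| "half (Right_bud_tip r) = opp X (dec r)"
| "half (Left_bud_tip r) = opp X (turn (node_of r) (blues (node_of r)))"

lemma turn_0: "turn v 0 = first v"
  by (simp add: turn_def)

lemma node_of_first [simp]: "v \<in> nodes X \<Longrightarrow> node_of (real (first v)) = v"
  by (simp add: node_of_def first_in)

lemma first_inj: "inj_on (\<lambda>v. real (first v)) (nodes X)"
  by (rule inj_onI) (metis first_in(3) of_nat_eq_iff)

lemma turn_eq_iff:
  assumes "v \<in> nodes X" "w \<in> nodes X" "i < card v" "j < card w"
  shows "turn v i = turn w j \<longleftrightarrow> v = w \<and> i = j"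
  using turn_vertex[OF assms(1,3)] turn_vertex[OF assms(2,4)] turn_inj[OF assms(1)] assms
  by (auto dest: inj_onD)

lemma half_around:
  assumes v: "v \<in> nodes X"
  shows "map half (around bl rl (real (first v))) = map (turn v) [0..<card v]"
proof -
  note b = blues[OF v]
  have r: "map (half \<circ> Lower_half) (rl (real (first v))) = map (turn v) [Suc (blues v)..<card v]"
    using v opp(3) turn_H[OF v] by (auto simp: rl_def)
  have u: "map (half \<circ> Upper_half) (bl (real (first v))) = map (turn v) [1..<blues v]"
    using v by (auto simp: bl_def)
  have "[0..<card v] = 0 # [1..<blues v] @ blues v # [Suc (blues v)..<card v]"
    using b upt_add_eq_append[of 0 "blues v" "card v - blues v"] upt_conv_Cons[of 0 "blues v"]
      upt_conv_Cons[of "blues v" "card v"] by simp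
  then show ?thesis using v r u by (simp add: around_def turn_0)
qed

lemma colored: "colored_graph V E bv rv bl rl"
  unfolding colored_graph_def
proof (intro conjI ballI)
  fix e assume "e \<in> E"
  then obtain h where h: "h \<in> H" "half_color X h = Some Blue" "e = real h" by (auto simp: E_def)
  have "vertex_of X h \<notin> leaves X" "vertex_of X (opp X h) \<notin> leaves X"
    using color_None[OF h(1)] in_bud_edges[OF h(1)] h(2) by auto
  then have "vertex_of X h \<in> nodes X" "vertex_of X (opp X h) \<in> nodes X"
    using leaf_or_node vertex_in h(1) opp(1) by blast+
  then show "bv e \<in> V" "rv e \<in> V" by (auto simp: bv_def rv_def V_def node_of_def h)
next
  fix r assume "r \<in> V"
  then obtain v where v: "v \<in> nodes X" "r = real (first v)" by (auto simp: V_def)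
  note b = blues[OF v(1)]
  have node: "node_of r = v" using v by simp
  have inj: "inj_on (turn v) A" if "A \<subseteq> {..<card v}" for A
    using turn_inj[OF v(1)] that inj_on_subset by blast
  have "inj_on (turn v) {1..<blues v}" by (rule inj) (use b in auto)
  then have "inj_on (\<lambda>i. real (turn v i)) {1..<blues v}" by (auto simp: inj_on_def)
  then show "distinct (bl r)" by (simp add: bl_def node distinct_map)
  have "inj_on (\<lambda>i. real (opp X (turn v i))) {Suc (blues v)..<card v}"
  proof
    fix i j assume ij: "i \<in> {Suc (blues v)..<card v}" "j \<in> {Suc (blues v)..<card v}"
      "real (opp X (turn v i)) = real (opp X (turn v j))"
    then have "opp X (opp X (turn v i)) = opp X (opp X (turn v j))" by simp
    moreover have "turn v i \<in> H" "turn v j \<in> H" using turn_H[OF v(1)] ij by auto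
    ultimately have "turn v i = turn v j" by (simp only: opp(3))
    then show "i = j" using turn_eq_iff[OF v(1) v(1)] ij by simp
  qed
  then show "distinct (rl r)" by (simp add: rl_def node distinct_map)
  have first_eq: "first w = first v \<longleftrightarrow> w = v" if "w \<in> nodes X" for w
    using first_in(3)[OF that] first_in(3)[OF v(1)] by metis
  have nd: "vertex_of X h \<in> nodes X" if "h \<in> H" "half_color X h \<noteq> None" for h
    using that color_None[OF that(1)] in_bud_edges[OF that(1)] leaf_or_node[OF vertex_in[OF that(1)]]
    by metis
  show "set (bl r) = {e \<in> E. bv e = r}"
  proof (intro subset_antisym subsetI)
    fix e assume "e \<in> set (bl r)"
    then obtain i where i: "1 \<le> i" "i < blues v" "e = real (turn v i)" by (auto simp: bl_def node)
    have "half_color X (turn v i) = Some Blue" using turn_color[OF v(1), of i] i b by simp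
    then show "e \<in> {e \<in> E. bv e = r}"
      using i b v(2) turn_H[OF v(1), of i] turn_vertex[OF v(1), of i]
      by (auto simp: E_def bv_def node_of_def)
  next
    fix e assume "e \<in> {e \<in> E. bv e = r}"
    then obtain h where h: "h \<in> H" "half_color X h = Some Blue" "e = real h"
      "first (vertex_of X h) = first v" by (auto simp: E_def bv_def node_of_def v)
    then have "vertex_of X h = v" using first_eq nd by simp
    then obtain i where i: "i < card v" "h = turn v i"
      using turn_image[OF v(1)] vertex_self[OF h(1)] by blast
    then have "i \<noteq> 0" "i < blues v" using turn_color[OF v(1) i(1)] h(2) by (auto split: if_splits)
    then show "e \<in> set (bl r)" using h(3) i by (auto simp: bl_def node)
  qed
  show "set (rl r) = {e \<in> E. rv e = r}"
  proof (intro subset_antisym subsetI)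
    fix e assume "e \<in> set (rl r)"
    then obtain i where i: "blues v < i" "i < card v" "e = real (opp X (turn v i))"
      by (auto simp: rl_def node Suc_le_eq)
    have "half_color X (turn v i) = Some Red" using turn_color[OF v(1), of i] i by simp
    then have "half_color X (opp X (turn v i)) = Some Blue"
      using opp_color[OF turn_H[OF v(1) i(2)]] by simp
    then show "e \<in> {e \<in> E. rv e = r}"
      using i v(2) opp turn_H[OF v(1), of i] turn_vertex[OF v(1), of i]
      by (auto simp: E_def rv_def)
  next
    fix e assume "e \<in> {e \<in> E. rv e = r}"
    then obtain h where h: "h \<in> H" "half_color X h = Some Blue" "e = real h"
      "first (vertex_of X (opp X h)) = first v" by (auto simp: E_def rv_def v)
    have o: "half_color X (opp X h) = Some Red" using opp_color[OF h(1)] h(2) by simp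
    then have "vertex_of X (opp X h) = v" using first_eq nd h opp(1) by simp
    then obtain i where i: "i < card v" "opp X h = turn v i"
      using turn_image[OF v(1)] vertex_self opp(1) h(1) by blast
    then have "blues v < i" using turn_color[OF v(1) i(1)] o by (auto split: if_splits)
    moreover have "h = opp X (turn v i)" using i opp(3)[OF h(1)] by simp
    ultimately show "e \<in> set (rl r)" using h(3) i by (auto simp: rl_def node)
  qed
qed

lemma half_bij: "bij_betw half (labels V E) H"
proof -
  \<comment> \<open>The inverse of \<open>half\<close>. The color tells the halves of plain edges;
    among uncolored half-edges, being at a node separates buds from tips, and comparison with
    \<open>first\<close> separates right from left.\<close>
  define lab where "lab h =
    (case half_color X h of Some Blue \<Rightarrow> Upper_half (real h) | Some Red \<Rightarrow> Lower_half (real (opp X h))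
     | None \<Rightarrow> if vertex_of X h \<in> nodes X
         then let r = real (first (vertex_of X h)) in if real h = r then Right_bud r else Left_bud r
         else let r = real (first (vertex_of X (opp X h))) in
           if real (opp X h) = r then Right_bud_tip r else Left_bud_tip r)" for h
  have tip: "vertex_of X (opp X (turn v i)) \<notin> nodes X" if "v \<in> nodes X" "i = 0 \<or> i = blues v" for v i
    using bud_opp[OF that] by (simp add: nodes_def)
  have lab_bud: "lab (turn v i) = (if i = 0 then Right_bud (real (first v)) else Left_bud (real (first v)))"
    "lab (opp X (turn v i)) = (if i = 0 then Right_bud_tip (real (first v)) else Left_bud_tip (real (first v)))"
    if v: "v \<in> nodes X" and i: "i = 0 \<or> i = blues v" for v i
  proof -
    have c: "i < card v" "0 < card v" using blues[OF v] i by auto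
    have eq: "turn v i = first v \<longleftrightarrow> i = 0" using turn_eq_iff[OF v v c] turn_0 by simp
    have col: "half_color X (turn v i) = None" using turn_color[OF v c(1)] i by auto
    show "lab (turn v i) = (if i = 0 then Right_bud (real (first v)) else Left_bud (real (first v)))"
      using turn_vertex[OF v c(1)] col v eq by (simp add: lab_def)
    show "lab (opp X (turn v i)) = (if i = 0 then Right_bud_tip (real (first v)) else Left_bud_tip (real (first v)))"
      using turn_vertex[OF v c(1)] opp_color[OF turn_H[OF v c(1)]] col tip[OF v i] eq
        opp(3)[OF turn_H[OF v c(1)]] by (simp add: lab_def)
  qed
  show ?thesis
  proof (rule bij_betw_byWitness[where f' = lab])
    show "\<forall>a\<in>labels V E. lab (half a) = a"
    proof
      fix a assume a: "a \<in> labels V E"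
      show "lab (half a) = a"
      proof (cases a)
        case (Upper_half r)
        then show ?thesis using a by (auto simp: E_def lab_def)
      next
        case (Lower_half r)
        then show ?thesis using a opp opp_color by (auto simp: E_def lab_def)
      next
        case (Left_bud r)
        then show ?thesis using a lab_bud(1) blues by (auto simp: V_def)
      next
        case (Left_bud_tip r)
        then show ?thesis using a lab_bud(2) blues by (auto simp: V_def)
      next
        case (Right_bud r)
        then show ?thesis using a lab_bud(1)[of _ 0] by (auto simp: V_def turn_0)
      next
        case (Right_bud_tip r)
        then show ?thesis using a lab_bud(2)[of _ 0] by (auto simp: V_def turn_0)
      qed
    qed
    have "half (lab h) = h \<and> lab h \<in> labels V E" if h: "h \<in> H" for h
    proof (cases "half_color X h")
      case None
      from h show ?thesis
      proof (cases rule: half_edge_cases)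
        case (node v i)
        then have i: "i = 0 \<or> i = blues v" using turn_color None by (auto split: if_splits)
        show ?thesis using lab_bud(1)[OF node(1) i] node i by (auto simp: V_def turn_0)
      next
        case (tip v i)
        then show ?thesis using lab_bud(2)[OF tip(1,2)] by (auto simp: V_def turn_0)
      qed
    next
      case (Some c)
      then show ?thesis using h opp opp_color by (cases c) (auto simp: lab_def E_def)
    qed
    then show "\<forall>h\<in>H. half (lab h) = h" "lab ` H \<subseteq> labels V E" by auto
    show "half ` labels V E \<subseteq> H"
    proof
      fix x assume "x \<in> half ` labels V E"
      then obtain a where a: "a \<in> labels V E" "x = half a" by blast
      show "x \<in> H"
        using a opp(1) first_in(2) turn_H blues by (cases a) (auto simp: V_def E_def)
    qed
  qed
qed

lemma realized: "realizes V E bv rv bl rl half X"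
proof (rule realizesI[OF colored half_bij])
  fix h assume h: "h \<in> labels V E"
  have fo: "opp X (opp X (first v)) = first v" if "v \<in> nodes X" for v using that first_in opp by blast
  have ft: "opp X (opp X (turn v (blues v))) = turn v (blues v)" if "v \<in> nodes X" for v
    using that turn_H blues opp by blast
  show "opp X (half h) = half (gamma_opp h)"
    using h opp(3) fo ft by (cases h) (auto simp: V_def E_def)
  have "half_color X (first v) = None" "half_color X (opp X (first v)) = None"
    "half_color X (turn v (blues v)) = None" "half_color X (opp X (turn v (blues v))) = None"
    if v: "v \<in> nodes X" for v
  proof -
    have c: "0 < card v" "blues v < card v" using blues[OF v] by auto
    show "half_color X (first v) = None" "half_color X (turn v (blues v)) = None"
      using turn_color[OF v c(1)] turn_color[OF v c(2)] by (auto simp: turn_0)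
    then show "half_color X (opp X (first v)) = None" "half_color X (opp X (turn v (blues v))) = None"
      using opp_color[OF first_in(2)[OF v]] opp_color[OF turn_H[OF v c(2)]] by auto
  qed
  then show "half_color X (half h) = gamma_color h"
    using h opp_color by (cases h) (auto simp: V_def E_def)
next
  fix r assume "r \<in> V"
  then obtain v where v: "v \<in> nodes X" "r = real (first v)" by (auto simp: V_def)
  show "rot X (half (Left_bud_tip r)) = half (Left_bud_tip r)"
    "rot X (half (Right_bud_tip r)) = half (Right_bud_tip r)"
    using bud_opp[OF v(1), of "blues v"] bud_opp[OF v(1), of 0] v
    by (auto simp: vertex_of_def orbit_eq_singleton_iff turn_0)
  fix i assume i: "i < length (around bl rl r)"
  let ?l = "length (around bl rl r)"
  have m: "map half (around bl rl r) = map (turn v) [0..<card v]" using half_around[OF v(1)] v(2) by simp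
  from arg_cong[OF this, of length] have l: "?l = card v" by simp
  have nth: "half (around bl rl r ! j) = turn v j" if "j < card v" for j
    using arg_cong[OF m, of "\<lambda>l. l ! j"] that l by simp
  have "Suc i mod ?l < ?l" using i by (intro mod_less_divisor) auto
  then show "rot X (half (around bl rl r ! i)) = half (around bl rl r ! (Suc i mod ?l))"
    using nth[of i] nth[of "Suc i mod ?l"] i l turn_Suc[OF v(1)] turn_card[OF v(1)]
    by (cases "Suc i = card v") auto
qed

text \<open>Stripping the plane tree of its leaves leaves the nodes and the plain edges; renaming
  nodes by their first buds and edges by their blue halves gives the colored graph.\<close>

lemma tree: "is_tree V E (\<lambda>e. {bv e, rv e})"
proof -
  let ?b = "\<lambda>l. {the_elem l, opp X (the_elem l)}"
  have leafD: "\<exists>h\<in>H. l = {h} \<and> vertex_of X h = {h}" if l: "l \<in> leaves X" for l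
  proof -
    obtain h where h: "h \<in> H" "l = vertex_of X h" using l by (auto simp: leaves_def vertices_def)
    then show ?thesis using leaf_vertex l by blast
  qed
  have fin: "finite (leaves X)" using plane(3) by (auto simp: is_tree_def leaves_def)
  have "is_tree (vertices X - leaves X) (edges X - ?b ` leaves X) (edge_ends X)"
  proof (rule tree_delete_pendants[OF fin plane(3)])
    show "inj_on ?b (leaves X)"
    proof
      fix l m assume lm: "l \<in> leaves X" "m \<in> leaves X" "?b l = ?b m"
      obtain a b where ab: "a \<in> H" "l = {a}" "vertex_of X a = {a}" "b \<in> H" "m = {b}" "vertex_of X b = {b}"
        using leafD lm by metis
      have "vertex_of X (opp X a) \<in> nodes X" using leaf_opp[OF ab(1)] ab lm by simp
      then have "opp X a \<noteq> b" using ab by (auto simp: nodes_def)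
      then show "l = m" using lm(3) ab by (auto simp: doubleton_eq_iff)
    qed
    fix l assume l: "l \<in> leaves X"
    obtain h where h: "h \<in> H" "l = {h}" "vertex_of X h = {h}" using leafD l by blast
    let ?u = "vertex_of X (opp X h)"
    have u: "?u \<in> nodes X" using leaf_opp[OF h(1)] h l by simp
    then have un: "?u \<notin> leaves X" by (auto simp: nodes_def leaves_def)
    have only: "e = {h, opp X h}" if e: "e \<in> edges X" "l \<in> edge_ends X e" for e
    proof -
      obtain x where x: "x \<in> e" "vertex_of X x = l" using e by (auto simp: edge_ends_def)
      then have "x \<in> H" using in_edge e by blast
      then have "x = h" using vertex_self[of x] x h by auto
      then show ?thesis using in_edge e x by blast
    qed
    have "pendant (edges X) (edge_ends X) l (?b l) ?u"
      unfolding pendant_def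
    proof (intro conjI ballI impI)
      have b: "?b l = {h, opp X h}" using h by simp
      show "?b l \<in> edges X" using edge_of[OF h(1)] b by simp
      show "edge_ends X (?b l) = {l, ?u}" using h by (simp add: edge_ends_def)
      show "?u \<noteq> l" using un l by blast
      show "e = ?b l" if "e \<in> edges X" "l \<in> edge_ends X e" for e using only[OF that] b by simp
    qed
    then show "\<exists>u. u \<notin> leaves X \<and> pendant (edges X) (edge_ends X) l (?b l) u" using un by blast
  qed
  moreover have "vertices X - leaves X = nodes X"
    using leaf_or_node by (auto simp: nodes_def)
  moreover have "edges X - ?b ` leaves X = plain_edges X"
  proof (intro subset_antisym subsetI)
    fix e assume e: "e \<in> edges X - ?b ` leaves X"
    have "edge_ends X e \<inter> leaves X = {}"
    proof (rule ccontr)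
      assume "edge_ends X e \<inter> leaves X \<noteq> {}"
      then obtain x where x: "x \<in> e" "vertex_of X x \<in> leaves X" by (auto simp: edge_ends_def)
      then have "x \<in> H" "e = {x, opp X x}" using in_edge e by blast+
      then have "e = ?b (vertex_of X x)" using leaf_vertex[OF \<open>x \<in> H\<close> x(2)] by simp
      then show False using e x by blast
    qed
    then show "e \<in> plain_edges X" using e by (simp add: plain_edges_def)
  next
    fix e assume e: "e \<in> plain_edges X"
    have "e \<noteq> ?b l" if "l \<in> leaves X" for l
    proof
      assume "e = ?b l"
      obtain h where h: "h \<in> H" "l = {h}" "vertex_of X h = {h}" using leafD \<open>l \<in> leaves X\<close> by blast
      then have "l \<in> edge_ends X e" using \<open>e = ?b l\<close> by (simp add: edge_ends_def)
      then show False using e that by (auto simp: plain_edges_def)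
    qed
    then show "e \<in> edges X - ?b ` leaves X" using e by (auto simp: plain_edges_def)
  qed
  ultimately have T: "is_tree (nodes X) (plain_edges X) (edge_ends X)" by simp
  let ?f = "\<lambda>v. real (first v)"
  define blue where "blue e = (THE h. h \<in> e \<and> half_color X h = Some Blue)" for e
  have plainD: "\<exists>h\<in>H. e = {h, opp X h} \<and> half_color X h = Some Blue \<and> blue e = h" if e: "e \<in> plain_edges X" for e
  proof -
    obtain x where x: "x \<in> H" "e = {x, opp X x}" using e by (auto simp: plain_edges_def edges_def)
    have "x \<in> \<Union> (plain_edges X)" using x e by auto
    then have c: "half_color X x \<noteq> None" using bicol x(1) unfolding bicolored_def by blast
    have "\<exists>h\<in>H. e = {h, opp X h} \<and> half_color X h = Some Blue"
    proof (cases "half_color X x = Some Blue")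
      case False
      then have "half_color X x = Some Red" using c by (metis color.exhaust not_None_eq)
      then have "half_color X (opp X x) = Some Blue" using opp_color[OF x(1)] by simp
      then show ?thesis using x opp by (metis insert_commute)
    qed (use x in blast)
    then obtain h where h: "h \<in> H" "e = {h, opp X h}" "half_color X h = Some Blue" by blast
    have "blue e = h"
      unfolding blue_def using h opp_color[OF h(1)] by (intro the_equality) auto
    with h show ?thesis by blast
  qed
  have "is_tree (?f ` nodes X) ((\<lambda>e. real (blue e)) ` plain_edges X) (\<lambda>e. {bv e, rv e})"
  proof (rule is_tree_isomorphic[OF T])
    show "inj_on ?f (nodes X)" by (rule first_inj)
    show "inj_on (\<lambda>e. real (blue e)) (plain_edges X)"
    proof
      fix e e' assume "e \<in> plain_edges X" "e' \<in> plain_edges X" "real (blue e) = real (blue e')"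
      then show "e = e'" using plainD by (metis of_nat_eq_iff)
    qed
    fix e assume "e \<in> plain_edges X"
    then obtain h where "e = {h, opp X h}" "blue e = h" using plainD by blast
    then show "{bv (real (blue e)), rv (real (blue e))} = ?f ` edge_ends X e"
      by (simp add: edge_ends_def bv_def rv_def node_of_def)
  qed
  moreover have "(\<lambda>e. real (blue e)) ` plain_edges X = E"
  proof (intro subset_antisym subsetI)
    fix r assume "r \<in> (\<lambda>e. real (blue e)) ` plain_edges X"
    then show "r \<in> E" using plainD by (fastforce simp: E_def)
  next
    fix r assume "r \<in> E"
    then obtain h where h: "h \<in> H" "half_color X h = Some Blue" "r = real h" by (auto simp: E_def)
    then have "h \<in> \<Union> (plain_edges X)" using bicol unfolding bicolored_def by (metis option.distinct(1))
    then obtain e where e: "e \<in> plain_edges X" "h \<in> e" by blast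
    then obtain h' where h': "h' \<in> H" "e = {h', opp X h'}" "half_color X h' = Some Blue" "blue e = h'"
      using plainD by blast
    then have "h = h'" using e h opp_color[OF h'(1)] by auto
    then show "r \<in> (\<lambda>e. real (blue e)) ` plain_edges X"
      using e(1) h(3) h'(4) by (intro image_eqI[of _ _ e]) simp_all
  qed
  ultimately show ?thesis by (simp add: V_def)
qed

theorem realization_half: "realization V E bv rv bl rl half X"
proof
  have "card V = card (nodes X)"
    unfolding V_def by (rule card_image[OF first_inj])
  then have "card V \<ge> 2" using blossoming by (simp add: blossoming_tree_def)
  then show "E \<noteq> {}" using tree_card[OF tree] by auto
qed (rule colored tree realized)+

end

section \<open>Arc-diagrams\<close>

text \<open>The altitude theorem for the right triangle over the diameter from \<open>a\<close> to
  \<open>b\<close>. Heights of two semicircles at the same abscissa are then compared through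
  products.\<close>

lemma in_upper_semicircle:
  assumes "a < b"
  shows "z \<in> upper_semicircle (a, b) \<longleftrightarrow> Im z > 0 \<and> (Im z)\<^sup>2 = (Re z - a) * (b - Re z)"
proof -
  have "cmod (z - complex_of_real ((a + b) / 2)) = (b - a) / 2 \<longleftrightarrow>
      (cmod (z - complex_of_real ((a + b) / 2)))\<^sup>2 = ((b - a) / 2)\<^sup>2"
    using assms by (simp add: power2_eq_iff_nonneg)
  also have "\<dots> \<longleftrightarrow> (Re z - (a + b) / 2)\<^sup>2 + (Im z)\<^sup>2 = ((b - a) / 2)\<^sup>2"
    by (simp add: cmod_power2)
  also have "\<dots> \<longleftrightarrow> (Im z)\<^sup>2 = (Re z - a) * (b - Re z)"
    by (auto simp: power2_eq_square field_simps)
  finally show ?thesis by (simp add: upper_semicircle_def)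
qed

lemma upper_semicircles_cross:
  assumes "a < c" "c < b" "b < d"
  shows "\<not> disjnt (upper_semicircle (a, b)) (upper_semicircle (c, d))"
proof -
  define s where "s = (c + d) - (a + b)"
  \<comment> \<open>The abscissa \<open>p\<close> solves
    \<open>(p - a) * (b - p) = (p - c) * (d - p)\<close>, where the squares cancel, leaving an
    equation linear in \<open>p\<close> with slope \<open>s\<close>.\<close>
  have s: "s > 0" using assms by (simp add: s_def)
  define p where "p = (c * d - a * b) / s"
  have ps: "p * s = c * d - a * b" using s by (simp add: p_def)
  have "(p - c) * s = (c - a) * (b - c)" "(b - p) * s = (b - c) * (d - b)"
    using ps by (auto simp: s_def algebra_simps)
  then have "(p - c) * s > 0" "(b - p) * s > 0"
    using assms by simp_all
  then have p: "c < p" "p < b" using s by (simp_all add: zero_less_mult_iff)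
  define q where "q = sqrt ((p - a) * (b - p))"
  have pos: "(p - a) * (b - p) > 0" using p assms by simp
  have eq: "(p - a) * (b - p) = (p - c) * (d - p)" using ps by (simp add: s_def algebra_simps)
  have "Complex p q \<in> upper_semicircle (a, b)" "Complex p q \<in> upper_semicircle (c, d)"
    using pos eq assms by (simp_all add: in_upper_semicircle q_def)
  then show ?thesis by (auto simp: disjnt_def)
qed

text \<open>Semicircles side by side share no abscissa. Of two nested ones the inner is strictly
  lower, even if they share one end. By symmetry the arc with the smaller left end is taken first,
  the longer one in case of a tie.\<close>

lemma upper_semicircles_disjnt:
  assumes "a < b" "c < d" "\<not> (a < c \<and> c < b \<and> b < d)" "\<not> (c < a \<and> a < d \<and> d < b)" "(a, b) \<noteq> (c, d)"
  shows "disjnt (upper_semicircle (a, b)) (upper_semicircle (c, d))"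
proof -
  have False if "a < b" "c < d" "\<not> (a < c \<and> c < b \<and> b < d)" "(a, b) \<noteq> (c, d)" "a \<le> c" "a = c \<longrightarrow> d \<le> b"
    and z: "z \<in> upper_semicircle (a, b)" "z \<in> upper_semicircle (c, d)" for a b c d z
  proof -
    let ?p = "Re z"
    have e: "(?p - a) * (b - ?p) = (?p - c) * (d - ?p)" "(?p - a) * (b - ?p) > 0"
      "(?p - c) * (d - ?p) > 0"
      using z that(1,2) by (auto simp: in_upper_semicircle) (metis zero_less_power)+
    have p: "a < ?p" "?p < b" "c < ?p" "?p < d"
      using e(2,3) that(1,2) by (auto simp: zero_less_mult_iff)
    then have "d \<le> b" using that(3,5,6) by auto
    then have "(?p - c) * (d - ?p) < (?p - a) * (b - ?p)"
    proof (cases "a = c")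
      case True
      then have "d < b" using \<open>d \<le> b\<close> that(4) by auto
      then show ?thesis using True p by simp
    next
      case False
      then show ?thesis using p that(5) \<open>d \<le> b\<close>
        by (intro mult_less_le_imp_less) auto
    qed
    then show False using e(1) by simp
  qed
  note * = this
  show ?thesis
    unfolding disjnt_def
  proof (intro equals0I)
    fix z assume "z \<in> upper_semicircle (a, b) \<inter> upper_semicircle (c, d)"
    then have z: "z \<in> upper_semicircle (a, b)" "z \<in> upper_semicircle (c, d)" by auto
    consider "a \<le> c \<and> (a = c \<longrightarrow> d \<le> b)" | "c \<le> a \<and> (c = a \<longrightarrow> b \<le> d)" by linarith
    then show False
      using *[OF assms(1,2,3,5) _ _ z] *[OF assms(2,1,4) _ _ _ z(2,1)] assms(5) by cases auto
  qed
qed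

text \<open>Complex conjugation reflects the lower half-plane to the upper one, so crossings of
  lower arcs need no separate computation.\<close>

lemma lower_semicircle_eq: "lower_semicircle p = cnj ` upper_semicircle p"
proof -
  obtain a b where p: "p = (a, b)" by (cases p)
  have "cmod (cnj z - complex_of_real r) = cmod (z - complex_of_real r)" for z r
    by (metis complex_cnj_complex_of_real complex_cnj_diff complex_mod_cnj)
  then have "z \<in> lower_semicircle p \<longleftrightarrow> cnj z \<in> upper_semicircle p" for z
    by (simp only: p lower_semicircle_def upper_semicircle_def prod.case mem_Collect_eq cnj.simps
        neg_0_less_iff_less)
  moreover have "z \<in> cnj ` A \<longleftrightarrow> cnj z \<in> A" for z A by (metis complex_cnj_cnj image_iff)
  ultimately show ?thesis by blast
qed

lemma lower_semicircles_disjnt_iff: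
  "disjnt (lower_semicircle p) (lower_semicircle q) \<longleftrightarrow>
    disjnt (upper_semicircle p) (upper_semicircle q)"
proof -
  have "inj cnj" by (metis complex_cnj_cnj injI)
  then show ?thesis
    by (metis lower_semicircle_eq disjnt_def image_Int image_is_empty)
qed

section \<open>Points and arcs of a diagram by number\<close>

definition black_index :: "real \<Rightarrow> nat" where
  "black_index b = nat \<lfloor>b\<rfloor>"

definition white_index :: "real \<Rightarrow> nat" where
  "white_index w = nat \<lceil>w\<rceil>"

definition white :: "nat \<Rightarrow> real" where
  "white t = real t - 1 / 2"

lemma black_index [simp]: "black_index (real k) = k"
  by (simp add: black_index_def)

lemma white_index [simp]: "1 \<le> t \<Longrightarrow> white_index (white t) = t"
proof -
  have "\<lceil>real t - 1 / 2\<rceil> = int t" by linarith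
  then show ?thesis by (simp add: white_index_def white_def)
qed

lemma white_eq_iff [simp]: "white s = white t \<longleftrightarrow> s = t"
  by (simp add: white_def)

text \<open>The white point number \<open>t\<close> lies at \<open>t - 1/2\<close>. This is the
  origin of the mixture of strict and weak inequalities in \<open>diag\<close>.\<close>

lemma white_less_iff [simp]:
  "white s < white t \<longleftrightarrow> s < t" "real k < white t \<longleftrightarrow> k < t" "white t < real k \<longleftrightarrow> t \<le> k"
  unfolding white_def by linarith+

lemma white_points_eq: "white_points n = white ` {1..n}"
  by (simp add: white_points_def white_def)

lemma black_bij: "bij_betw black_index (black_points n) {0..n}"
  by (rule bij_betw_byWitness[where f' = real]) (auto simp: black_points_def)

lemma white_bij: "bij_betw white_index (white_points n) {1..n}"
  by (rule bij_betw_byWitness[where f' = white]) (auto simp: white_points_eq)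

lemma white_card: "card (white_points n) = n"
  using bij_betw_same_card[OF white_bij] by simp

lemma black_pointE:
  assumes "b \<in> black_points n"
  obtains k where "k \<le> n" "b = real k" "black_index b = k"
  using assms by (auto simp: black_points_def)

lemma white_pointE:
  assumes "w \<in> white_points n"
  obtains t where "1 \<le> t" "t \<le> n" "w = white t" "white_index w = t"
  using assms by (auto simp: white_points_eq)

definition blue_end :: "arc_diagram \<Rightarrow> real \<Rightarrow> real" where
  "blue_end M w = (THE b. (b, w) \<in> upper_arcs M)"

definition red_end :: "arc_diagram \<Rightarrow> real \<Rightarrow> real" where
  "red_end M w = (THE b. (w, b) \<in> lower_arcs M)"

definition blue_list :: "arc_diagram \<Rightarrow> real \<Rightarrow> real list" where
  "blue_list M b = sorted_list_of_set {w. (b, w) \<in> upper_arcs M}"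

definition red_list :: "arc_diagram \<Rightarrow> real \<Rightarrow> real list" where
  "red_list M b = rev (sorted_list_of_set {w. (w, b) \<in> lower_arcs M})"

context
  fixes n M assumes M: "meandering_diagram n M"
begin

lemma upper_arcs_iff: "(b, w) \<in> upper_arcs M \<longleftrightarrow> w \<in> white_points n \<and> b = blue_end M w"
  and lower_arcs_iff: "(w, b) \<in> lower_arcs M \<longleftrightarrow> w \<in> white_points n \<and> b = red_end M w"
proof -
  have w: "(\<exists>!x. (x, w) \<in> upper_arcs M) \<and> (\<exists>!y. (w, y) \<in> lower_arcs M)" if "w \<in> white_points n" for w
    using M that unfolding meandering_diagram_def by blast
  have sub: "w \<in> white_points n" if "(b, w) \<in> upper_arcs M \<or> (w, b) \<in> lower_arcs M" for b w
    using M that unfolding meandering_diagram_def by blast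
  show "(b, w) \<in> upper_arcs M \<longleftrightarrow> w \<in> white_points n \<and> b = blue_end M w"
  proof (cases "w \<in> white_points n")
    case True
    then have "\<exists>!b. (b, w) \<in> upper_arcs M" using w by blast
    from theI'[OF this] the1_equality[OF this] True show ?thesis
      unfolding blue_end_def by blast
  qed (use sub in blast)
  show "(w, b) \<in> lower_arcs M \<longleftrightarrow> w \<in> white_points n \<and> b = red_end M w"
  proof (cases "w \<in> white_points n")
    case True
    then have "\<exists>!b. (w, b) \<in> lower_arcs M" using w by blast
    from theI'[OF this] the1_equality[OF this] True show ?thesis
      unfolding red_end_def by blast
  qed (use sub in blast)
qed

lemma arc_ends:
  assumes "w \<in> white_points n"
  shows "blue_end M w \<in> black_points n" "blue_end M w < w"
    "red_end M w \<in> black_points n" "w < red_end M w"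
  using M assms upper_arcs_iff[of "blue_end M w" w] lower_arcs_iff[of w "red_end M w"]
  unfolding meandering_diagram_def by blast+

lemma underlying_ends_eq: "w \<in> white_points n \<Longrightarrow> underlying_ends M w = {blue_end M w, red_end M w}"
  by (auto simp: underlying_ends_def upper_arcs_iff lower_arcs_iff)

lemma diagram_size_eq: "diagram_size M = n"
  using M by (simp add: meandering_diagram_def)

lemma diagram_diag:
  "diag (black_points n) (white_points n) (blue_end M) (red_end M) black_index white_index"
  unfolding diag_def white_card
proof (intro conjI ballI)
  show "bij_betw black_index (black_points n) {0..n}" "bij_betw white_index (white_points n) {1..n}"
    by (rule black_bij white_bij)+
  fix e assume e: "e \<in> white_points n"
  obtain t where t: "e = white t" "white_index e = t" using e by (rule white_pointE)
  obtain i where i: "blue_end M e = real i" "black_index (blue_end M e) = i"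
    using arc_ends(1)[OF e] by (rule black_pointE)
  obtain j where j: "red_end M e = real j" "black_index (red_end M e) = j"
    using arc_ends(3)[OF e] by (rule black_pointE)
  show "blue_end M e \<in> black_points n" "red_end M e \<in> black_points n" by (rule arc_ends[OF e])+
  show "black_index (blue_end M e) < white_index e" "white_index e \<le> black_index (red_end M e)"
    using arc_ends[OF e] i j t by auto
  fix f assume f: "f \<in> white_points n"
  obtain t' where t': "f = white t'" "white_index f = t'" using f by (rule white_pointE)
  obtain i' where i': "blue_end M f = real i'" "black_index (blue_end M f) = i'"
    using arc_ends(1)[OF f] by (rule black_pointE)
  obtain j' where j': "red_end M f = real j'" "black_index (red_end M f) = j'"
    using arc_ends(3)[OF f] by (rule black_pointE)
  show "\<not> (black_index (blue_end M e) < black_index (blue_end M f) \<and>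
      black_index (blue_end M f) < white_index e \<and> white_index e < white_index f)"
  proof
    assume c: "black_index (blue_end M e) < black_index (blue_end M f) \<and>
      black_index (blue_end M f) < white_index e \<and> white_index e < white_index f"
    then have "\<not> disjnt (upper_semicircle (blue_end M e, e)) (upper_semicircle (blue_end M f, f))"
      using i i' t t' by (intro upper_semicircles_cross) auto
    moreover have "(blue_end M e, e) \<in> upper_arcs M" "(blue_end M f, f) \<in> upper_arcs M" "e \<noteq> f"
      using e f c by (auto simp: upper_arcs_iff)
    ultimately show False
      using M unfolding meandering_diagram_def non_crossing_def pairwise_def by blast
  qed
  show "\<not> (white_index e < white_index f \<and> white_index f \<le> black_index (red_end M e) \<and>
      black_index (red_end M e) < black_index (red_end M f))"
  proof
    assume c: "white_index e < white_index f \<and> white_index f \<le> black_index (red_end M e) \<and>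
      black_index (red_end M e) < black_index (red_end M f)"
    then have "\<not> disjnt (lower_semicircle (e, red_end M e)) (lower_semicircle (f, red_end M f))"
      unfolding lower_semicircles_disjnt_iff
      using j j' t t' by (intro upper_semicircles_cross) auto
    moreover have "(e, red_end M e) \<in> lower_arcs M" "(f, red_end M f) \<in> lower_arcs M" "e \<noteq> f"
      using e f c by (auto simp: lower_arcs_iff)
    ultimately show False
      using M unfolding meandering_diagram_def non_crossing_def pairwise_def by blast
  qed
qed

lemma finite_arcs: "finite {w. (b, w) \<in> upper_arcs M}" "finite {w. (w, b) \<in> lower_arcs M}"
  by (rule finite_subset[of _ "white_points n"]; auto simp: upper_arcs_iff lower_arcs_iff white_points_eq)+

lemma diagram_colored_graph:
  "colored_graph (black_points n) (white_points n) (blue_end M) (red_end M) (blue_list M) (red_list M)"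
  unfolding colored_graph_def blue_list_def red_list_def
  using arc_ends finite_arcs by (auto simp: upper_arcs_iff lower_arcs_iff)

lemma diagram_arcs_ordered: "arcs_ordered (black_points n) (blue_list M) (red_list M) white_index"
  unfolding arcs_ordered_def
proof (intro ballI conjI)
  fix b
  have mono: "white_index u < white_index w"
    if "u < w" "u \<in> white_points n" "w \<in> white_points n" for u w
  proof -
    from \<open>u \<in> white_points n\<close> obtain s where s: "u = white s" "white_index u = s"
      by (rule white_pointE)
    from \<open>w \<in> white_points n\<close> obtain t where "w = white t" "white_index w = t"
      by (rule white_pointE)
    with s show ?thesis using \<open>u < w\<close> by simp
  qed
  have s: "sorted_wrt (<) (map white_index (sorted_list_of_set A))" if "finite A" "A \<subseteq> white_points n" for A
    unfolding sorted_wrt_map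
    by (rule sorted_wrt_mono_rel[OF _ strict_sorted_list_of_set]) (use that mono in auto)
  show "sorted_wrt (<) (map white_index (blue_list M b))"
    unfolding blue_list_def by (rule s) (use finite_arcs in \<open>auto simp: upper_arcs_iff\<close>)
  have "sorted_wrt (<) (map white_index (sorted_list_of_set {w. (w, b) \<in> lower_arcs M}))"
    by (rule s) (use finite_arcs in \<open>auto simp: lower_arcs_iff\<close>)
  then show "sorted_wrt (>) (map white_index (red_list M b))"
    by (simp add: red_list_def rev_map[symmetric] sorted_wrt_rev)
qed

end

section \<open>Drawing an abstract diagram\<close>

definition diagram_of ::
  "'e set \<Rightarrow> ('e \<Rightarrow> 'v) \<Rightarrow> ('e \<Rightarrow> 'v) \<Rightarrow> ('v \<Rightarrow> nat) \<Rightarrow> ('e \<Rightarrow> nat) \<Rightarrow> arc_diagram" where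
  "diagram_of E bv rv x y =
     \<lparr> diagram_size = card E,
       upper_arcs = (\<lambda>e. (real (x (bv e)), white (y e))) ` E,
       lower_arcs = (\<lambda>e. (white (y e), real (x (rv e)))) ` E \<rparr>"

context
  fixes V :: "'v set" and E :: "'e set" and bv rv x y
  assumes D: "diag V E bv rv x y"
begin

lemma diag_bij: "bij_betw x V {0..card E}" "bij_betw y E {1..card E}"
  using D by (auto simp: diag_def)

lemma diag_arc: "e \<in> E \<Longrightarrow> bv e \<in> V \<and> rv e \<in> V \<and> x (bv e) < y e \<and> y e \<le> x (rv e)"
  using D by (auto simp: diag_def)

lemma diag_range: "v \<in> V \<Longrightarrow> x v \<le> card E" "e \<in> E \<Longrightarrow> 1 \<le> y e \<and> y e \<le> card E"
  using bij_betwE[OF diag_bij(1)] bij_betwE[OF diag_bij(2)] by auto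

lemma diag_y_inj: "e \<in> E \<Longrightarrow> f \<in> E \<Longrightarrow> y e = y f \<Longrightarrow> e = f"
  using diag_bij(2) by (auto simp: bij_betw_def dest: inj_onD)

lemma diagram_of_arcs:
  assumes "e \<in> E"
  shows "(b, white (y e)) \<in> upper_arcs (diagram_of E bv rv x y) \<longleftrightarrow> b = real (x (bv e))"
    "(white (y e), b) \<in> lower_arcs (diagram_of E bv rv x y) \<longleftrightarrow> b = real (x (rv e))"
  using assms by (auto simp: diagram_of_def dest: diag_y_inj[OF assms])

lemma diagram_of_meandering: "meandering_diagram (card E) (diagram_of E bv rv x y)"
  unfolding meandering_diagram_def
proof (intro conjI)
  let ?M = "diagram_of E bv rv x y"
  show "diagram_size ?M = card E" by (simp add: diagram_of_def)
  show "\<forall>(b, w)\<in>upper_arcs ?M. b \<in> black_points (card E) \<and> w \<in> white_points (card E) \<and> b < w"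
    "\<forall>(w, b)\<in>lower_arcs ?M. w \<in> white_points (card E) \<and> b \<in> black_points (card E) \<and> w < b"
    using diag_arc diag_range by (auto simp: diagram_of_def black_points_def white_points_eq)
  show "\<forall>w\<in>white_points (card E). (\<exists>!b. (b, w) \<in> upper_arcs ?M) \<and> (\<exists>!b. (w, b) \<in> lower_arcs ?M)"
  proof
    fix w assume "w \<in> white_points (card E)"
    then have "w \<in> white ` y ` E" using diag_bij(2) by (simp add: bij_betw_def white_points_eq)
    then obtain e where e: "e \<in> E" "w = white (y e)" by auto
    then have "(b, w) \<in> upper_arcs ?M \<longleftrightarrow> b = real (x (bv e))"
      "(w, b) \<in> lower_arcs ?M \<longleftrightarrow> b = real (x (rv e))" for b
      using diagram_of_arcs by simp_all
    then show "(\<exists>!b. (b, w) \<in> upper_arcs ?M) \<and> (\<exists>!b. (w, b) \<in> lower_arcs ?M)" by simp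
  qed
  show "non_crossing ?M"
    unfolding non_crossing_def pairwise_def
  proof (intro conjI ballI impI)
    fix p q assume "p \<in> upper_arcs ?M" "q \<in> upper_arcs ?M" "p \<noteq> q"
    then obtain e f where ef: "e \<in> E" "p = (real (x (bv e)), white (y e))"
      "f \<in> E" "q = (real (x (bv f)), white (y f))" by (auto simp: diagram_of_def)
    have "\<not> (x (bv e) < x (bv f) \<and> x (bv f) < y e \<and> y e < y f)"
      "\<not> (x (bv f) < x (bv e) \<and> x (bv e) < y f \<and> y f < y e)"
      using D ef unfolding diag_def by blast+
    then show "disjnt (upper_semicircle p) (upper_semicircle q)"
      using ef \<open>p \<noteq> q\<close> diag_arc by (simp only: ef, intro upper_semicircles_disjnt) auto
  next
    fix p q assume "p \<in> lower_arcs ?M" "q \<in> lower_arcs ?M" "p \<noteq> q"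
    then obtain e f where ef: "e \<in> E" "p = (white (y e), real (x (rv e)))"
      "f \<in> E" "q = (white (y f), real (x (rv f)))" by (auto simp: diagram_of_def)
    have "\<not> (y e < y f \<and> y f \<le> x (rv e) \<and> x (rv e) < x (rv f))"
      "\<not> (y f < y e \<and> y e \<le> x (rv f) \<and> x (rv f) < x (rv e))"
      using D ef unfolding diag_def by blast+
    then show "disjnt (lower_semicircle p) (lower_semicircle q)"
      unfolding lower_semicircles_disjnt_iff
      using ef \<open>p \<noteq> q\<close> diag_arc by (simp only: ef, intro upper_semicircles_disjnt) auto
  qed
qed

lemma diagram_of_white_bij: "bij_betw (\<lambda>e. white (y e)) E (white_points (card E))"
proof -
  have "(\<lambda>e. white (y e)) ` E = white ` y ` E" by (simp add: image_image)
  then show ?thesis using diag_bij(2) by (simp add: bij_betw_def white_points_eq inj_on_def)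
qed

lemma diagram_of_black_bij: "bij_betw (\<lambda>v. real (x v)) V (black_points (card E))"
proof -
  have "(\<lambda>v. real (x v)) ` V = real ` x ` V" by (simp add: image_image)
  then show ?thesis using diag_bij(1) by (simp add: bij_betw_def black_points_def inj_on_def)
qed

lemma diagram_of_ends:
  assumes "e \<in> E"
  shows "blue_end (diagram_of E bv rv x y) (white (y e)) = real (x (bv e))"
    "red_end (diagram_of E bv rv x y) (white (y e)) = real (x (rv e))"
  by (simp_all add: blue_end_def red_end_def diagram_of_arcs[OF assms])

lemma diagram_of_tree:
  assumes "is_tree V E (\<lambda>e. {bv e, rv e})"
  shows "diagram_of E bv rv x y \<in> meandering_trees (card E)"
proof -
  let ?M = "diagram_of E bv rv x y" and ?n = "card E"
  have "is_tree ((\<lambda>v. real (x v)) ` V) ((\<lambda>e. white (y e)) ` E) (underlying_ends ?M)"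
  proof (rule is_tree_isomorphic[OF assms])
    show "inj_on (\<lambda>v. real (x v)) V" "inj_on (\<lambda>e. white (y e)) E"
      using diagram_of_black_bij diagram_of_white_bij by (auto simp: bij_betw_def)
    fix e assume e: "e \<in> E"
    then have "white (y e) \<in> white_points ?n" using diag_range by (auto simp: white_points_eq)
    then show "underlying_ends ?M (white (y e)) = (\<lambda>v. real (x v)) ` {bv e, rv e}"
      using underlying_ends_eq[OF diagram_of_meandering] diagram_of_ends[OF e] by simp
  qed
  then show ?thesis
    using diagram_of_meandering diagram_of_black_bij diagram_of_white_bij
    by (simp add: meandering_trees_def bij_betw_def)
qed

end

section \<open>The bijection\<close>

lemma gamma_map_realizes:
  assumes "meandering_diagram n M"
  shows "realizes (black_points n) (white_points n) (blue_end M) (red_end M) (blue_list M) (red_list M)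
    id (gamma_map M)"
proof -
  have "half_edges_around M b = around (blue_list M) (red_list M) b" for b
    by (simp add: half_edges_around_def around_def blue_list_def red_list_def)
  then have "gamma_rot M h = label_rot (blue_end M) (red_end M) (blue_list M) (red_list M) h" for h
    by (cases h) (simp_all add: blue_end_def red_end_def)
  then show ?thesis
    using diagram_size_eq[OF assms] by (simp add: realizes_def gamma_map_def labels_def)
qed

lemma iso_class_eq:
  assumes C: "colored_graph V E bv rv bl rl"
    and X: "realizes V E bv rv bl rl g X" and Y: "realizes V E bv rv bl rl f Y"
  shows "iso_class X = iso_class Y"
  unfolding iso_class_def
proof (intro subset_antisym subsetI CollectI; elim CollectE)
  show "map_iso Y Z" if "map_iso X Z" for Z
    using realizes_iso[OF C X that] realizes_map_iso[OF C Y] by metis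
  show "map_iso X Z" if "map_iso Y Z" for Z
    using realizes_iso[OF C Y that] realizes_map_iso[OF C X] by metis
qed

text \<open>Isomorphism classes contain only maps on natural numbers, whereas
  \<open>gamma_map\<close> lives on labels. Finitely many labels can be numbered.\<close>

lemma realizes_nat_copy:
  assumes C: "colored_graph V E bv rv bl rl" and "finite V" "finite E"
    and X: "realizes V E bv rv bl rl g X"
  obtains f and Y :: "nat half_edge_map" where "realizes V E bv rv bl rl f Y"
proof -
  have "finite (labels V E)" using assms by (simp add: labels_def)
  then obtain c :: "diagram_half_edge \<Rightarrow> nat" where c: "inj_on c (labels V E)"
    using finite_imp_inj_to_nat_seg by metis
  let ?i = "the_inv_into (labels V E) c"
  define Y where "Y = \<lparr> half_edges = c ` labels V E, rot = (\<lambda>k. c (label_rot bv rv bl rl (?i k))),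
    opp = (\<lambda>k. c (gamma_opp (?i k))), half_color = (\<lambda>k. gamma_color (?i k)) \<rparr>"
  have "realizes V E bv rv bl rl c Y"
    using c by (simp add: realizes_def Y_def bij_betw_def the_inv_into_f_f)
  then show thesis using that by blast
qed

lemma meandering_treeD:
  assumes "M \<in> meandering_trees n"
  shows "meandering_diagram n M"
    and "is_tree (black_points n) (white_points n) (\<lambda>w. {blue_end M w, red_end M w})"
proof -
  show M: "meandering_diagram n M" using assms by (simp add: meandering_trees_def)
  show "is_tree (black_points n) (white_points n) (\<lambda>w. {blue_end M w, red_end M w})"
    using assms underlying_ends_eq[OF M]
    by (auto simp: meandering_trees_def intro: is_tree_cong)
qed

lemma meandering_tree_realization:
  assumes M: "M \<in> meandering_trees n" and n: "n \<ge> 1"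
    and R: "realizes (black_points n) (white_points n) (blue_end M) (red_end M) (blue_list M)
      (red_list M) g X"
  shows "realization (black_points n) (white_points n) (blue_end M) (red_end M) (blue_list M)
    (red_list M) g X"
proof
  show "white_points n \<noteq> {}" using n by (auto simp: white_points_def)
qed (use R meandering_treeD[OF M] diagram_colored_graph in auto)

lemma gamma_in_bicolored_blossoming_trees:
  assumes M: "M \<in> meandering_trees n" and n: "n \<ge> 1"
  shows "gamma M \<in> bicolored_blossoming_trees n"
proof -
  note D = meandering_treeD(1)[OF M]
  note C = diagram_colored_graph[OF D] and G = gamma_map_realizes[OF D]
  have "finite (black_points n)" "finite (white_points n)"
    by (simp_all add: black_points_def white_points_def)
  from realizes_nat_copy[OF C this G] obtain f and X :: "nat half_edge_map" where
    X: "realizes (black_points n) (white_points n) (blue_end M) (red_end M) (blue_list M)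
      (red_list M) f X" .
  interpret realization "black_points n" "white_points n" "blue_end M" "red_end M" "blue_list M"
    "red_list M" f X
    by (rule meandering_tree_realization[OF M n X])
  have "gamma M = iso_class X"
    unfolding gamma_def by (rule iso_class_eq[OF C G X])
  then show ?thesis
    using blossoming_tree_X bicolored_X card_plain_edges
    by (auto simp: bicolored_blossoming_trees_def white_card)
qed

lemma diagram_eqI:
  assumes M: "meandering_diagram n M" and N: "meandering_diagram n N"
    and "\<And>w. w \<in> white_points n \<Longrightarrow> blue_end M w = blue_end N w \<and> red_end M w = red_end N w"
  shows "M = N"
proof -
  have "upper_arcs M = upper_arcs N" "lower_arcs M = lower_arcs N"
    using assms(3) by (auto simp: upper_arcs_iff[OF M] upper_arcs_iff[OF N] lower_arcs_iff[OF M]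
        lower_arcs_iff[OF N])
  moreover have "diagram_size M = diagram_size N"
    using diagram_size_eq[OF M] diagram_size_eq[OF N] by simp
  ultimately show ?thesis by simp
qed

text \<open>A common realization identifies the two colored graphs by renamings \<open>i\<close> and
  \<open>j\<close>. The numbering of \<open>N\<close>, pulled back along them, is a second
  arrangement of the colored graph of \<open>M\<close>, so uniqueness forces both renamings to be
  the identity.\<close>

lemma gamma_inj:
  assumes n: "n \<ge> 1"
  shows "inj_on gamma (meandering_trees n)"
proof
  fix M N assume M: "M \<in> meandering_trees n" and N: "N \<in> meandering_trees n" and eq: "gamma M = gamma N"
  note DM = meandering_treeD[OF M] and DN = meandering_treeD[OF N]
  note CM = diagram_colored_graph[OF DM(1)] and CN = diagram_colored_graph[OF DN(1)]
  note GM = gamma_map_realizes[OF DM(1)] and GN = gamma_map_realizes[OF DN(1)]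
  let ?B = "black_points n" and ?W = "white_points n"
  have "finite ?B" "finite ?W" by (simp_all add: black_points_def white_points_def)
  from realizes_nat_copy[OF CM this GM] obtain f and X :: "nat half_edge_map" where
    X: "realizes ?B ?W (blue_end M) (red_end M) (blue_list M) (red_list M) f X" .
  have "map_iso (gamma_map M) X" by (rule realizes_map_iso[OF CM GM X])
  then have "map_iso (gamma_map N) X" using eq by (auto simp: gamma_def iso_class_def)
  from realizes_iso[OF CN GN this] obtain f' where
    X': "realizes ?B ?W (blue_end N) (red_end N) (blue_list N) (red_list N) f' X" .
  from realizations_isomorphic[OF meandering_tree_realization[OF M n X]
      meandering_tree_realization[OF N n X']]
  obtain i j where i: "bij_betw i ?B ?B" and j: "bij_betw j ?W ?W"
    and "\<forall>v\<in>?B. blue_list N (i v) = map j (blue_list M v) \<and> red_list N (i v) = map j (red_list M v)" .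
  then have l: "blue_list N (i v) = map j (blue_list M v) \<and> red_list N (i v) = map j (red_list M v)"
    if "v \<in> ?B" for v using that by blast
  have iB: "i v \<in> ?B" if "v \<in> ?B" for v using bij_betwE[OF i] that by blast
  have jW: "j w \<in> ?W" if "w \<in> ?W" for w using bij_betwE[OF j] that by blast
  have ends: "blue_end N (j w) = i (blue_end M w)" "red_end N (j w) = i (red_end M w)"
    if w: "w \<in> ?W" for w
  proof -
    note a = arc_ends[OF DM(1) w]
    have "w \<in> set (blue_list M (blue_end M w))" "w \<in> set (red_list M (red_end M w))"
      using CM w a unfolding colored_graph_def by auto
    then have "j w \<in> set (blue_list N (i (blue_end M w)))" "j w \<in> set (red_list N (i (red_end M w)))"
      using l[OF a(1)] l[OF a(3)] by auto
    then show "blue_end N (j w) = i (blue_end M w)" "red_end N (j w) = i (red_end M w)"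
      using CN iB[OF a(1)] iB[OF a(3)] unfolding colored_graph_def by auto
  qed
  \<comment> \<open>By \<open>ends\<close> the arcs of \<open>M\<close>, renamed, are arcs of
    \<open>N\<close>, so all conditions are inherited from the diagram \<open>N\<close>.\<close>
  have "diag ?B ?W (blue_end M) (red_end M) (black_index \<circ> i) (white_index \<circ> j)"
  proof -
    have N': "\<And>e. e \<in> ?W \<Longrightarrow> black_index (blue_end N e) < white_index e \<and> white_index e \<le> black_index (red_end N e)"
      "\<And>e f. e \<in> ?W \<Longrightarrow> f \<in> ?W \<Longrightarrow> \<not> (black_index (blue_end N e) < black_index (blue_end N f) \<and>
        black_index (blue_end N f) < white_index e \<and> white_index e < white_index f)"
      "\<And>e f. e \<in> ?W \<Longrightarrow> f \<in> ?W \<Longrightarrow> \<not> (white_index e < white_index f \<and>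
        white_index f \<le> black_index (red_end N e) \<and> black_index (red_end N e) < black_index (red_end N f))"
      using diagram_diag[OF DN(1)] unfolding diag_def by blast+
    show ?thesis
      unfolding diag_def white_card
    proof (intro conjI ballI)
      show "bij_betw (black_index \<circ> i) ?B {0..n}" "bij_betw (white_index \<circ> j) ?W {1..n}"
        by (rule bij_betw_trans[OF i black_bij] bij_betw_trans[OF j white_bij])+
    qed (use N'(1)[OF jW] N'(2,3)[OF jW jW] arc_ends[OF DM(1)] in \<open>simp_all add: ends\<close>)
  qed
  moreover have "arcs_ordered ?B (blue_list M) (red_list M) (white_index \<circ> j)"
    using diagram_arcs_ordered[OF DN(1)] l iB unfolding arcs_ordered_def
    by (metis map_map)
  ultimately have id: "(\<forall>v\<in>?B. black_index v = black_index (i v)) \<and> (\<forall>w\<in>?W. white_index w = white_index (j w))"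
    using arrangement_unique[OF CM DM(2) diagram_diag[OF DM(1)] diagram_arcs_ordered[OF DM(1)]]
    by fastforce
  have "i v = v" if "v \<in> ?B" for v
    using id that iB[OF that] black_bij[of n] by (metis bij_betw_imp_inj_on inj_onD)
  moreover have "j w = w" if "w \<in> ?W" for w
    using id that jW[OF that] white_bij[of n] by (metis bij_betw_imp_inj_on inj_onD)
  ultimately show "M = N"
    using ends arc_ends[OF DM(1)] by (intro diagram_eqI[OF DM(1) DN(1)]) metis
qed

text \<open>A renaming of vertices and edges that respects the lists induces a bijection of labels,
  here \<open>s\<close> with inverse \<open>r\<close>; composing \<open>g\<close> with
  \<open>r\<close> gives the new realization.\<close>

lemma realizes_relabel:
  assumes C: "colored_graph V E bv rv bl rl" and C': "colored_graph V' E' bv' rv' bl' rl'"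
    and i: "bij_betw i V V'" and j: "bij_betw j E E'"
    and l: "\<And>v. v \<in> V \<Longrightarrow> bl' (i v) = map j (bl v) \<and> rl' (i v) = map j (rl v)"
    and R: "realizes V E bv rv bl rl g X"
  obtains g' where "realizes V' E' bv' rv' bl' rl' g' X"
proof -
  let ?i = "the_inv_into V i" and ?j = "the_inv_into E j"
  define r where "r h = (case h of Upper_half w \<Rightarrow> Upper_half (?j w) | Lower_half w \<Rightarrow> Lower_half (?j w)
    | Left_bud b \<Rightarrow> Left_bud (?i b) | Left_bud_tip b \<Rightarrow> Left_bud_tip (?i b)
    | Right_bud b \<Rightarrow> Right_bud (?i b) | Right_bud_tip b \<Rightarrow> Right_bud_tip (?i b))" for h
  define s where "s h = (case h of Upper_half w \<Rightarrow> Upper_half (j w) | Lower_half w \<Rightarrow> Lower_half (j w)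
    | Left_bud b \<Rightarrow> Left_bud (i b) | Left_bud_tip b \<Rightarrow> Left_bud_tip (i b)
    | Right_bud b \<Rightarrow> Right_bud (i b) | Right_bud_tip b \<Rightarrow> Right_bud_tip (i b))" for h
  have inv: "\<And>v. v \<in> V \<Longrightarrow> ?i (i v) = v \<and> i v \<in> V'" "\<And>v. v \<in> V' \<Longrightarrow> i (?i v) = v \<and> ?i v \<in> V"
    "\<And>w. w \<in> E \<Longrightarrow> ?j (j w) = w \<and> j w \<in> E'" "\<And>w. w \<in> E' \<Longrightarrow> j (?j w) = w \<and> ?j w \<in> E"
    using i j the_inv_into_f_f f_the_inv_into_f_bij_betw bij_betwE[OF bij_betw_the_inv_into]
      bij_betwE by (metis bij_betw_imp_inj_on)+
  have rs: "r (s h) = h" "s h \<in> labels V' E'" if "h \<in> labels V E" for h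
    using that inv by (cases h; simp add: r_def s_def)+
  have sr: "s (r h) = h" "r h \<in> labels V E" if "h \<in> labels V' E'" for h
    using that inv by (cases h; simp add: r_def s_def)+
  have r: "bij_betw r (labels V' E') (labels V E)"
    by (rule bij_betw_byWitness[where f' = s]) (use rs sr in auto)
  have X: "bij_betw g (labels V E) (half_edges X)"
    "\<And>h. h \<in> labels V E \<Longrightarrow> rot X (g h) = g (label_rot bv rv bl rl h) \<and>
      opp X (g h) = g (gamma_opp h) \<and> half_color X (g h) = gamma_color h"
    using R by (auto simp: realizes_def)
  have r_opp: "gamma_opp (r h) = r (gamma_opp h)" "gamma_color (r h) = gamma_color h" for h
    by (cases h; simp add: r_def)+
  have "realizes V' E' bv' rv' bl' rl' (g \<circ> r) X"
  proof (rule realizesI[OF C'])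
    show "bij_betw (g \<circ> r) (labels V' E') (half_edges X)" by (rule bij_betw_trans[OF r X(1)])
    show "opp X ((g \<circ> r) h) = (g \<circ> r) (gamma_opp h)" "half_color X ((g \<circ> r) h) = gamma_color h"
      if "h \<in> labels V' E'" for h
      using X(2)[OF sr(2)[OF that]] r_opp by auto
  next
    fix v' assume v': "v' \<in> V'"
    define v where "v = ?i v'"
    have v: "v \<in> V" "v' = i v" using inv(2)[OF v'] by (auto simp: v_def)
    show "rot X ((g \<circ> r) (Left_bud_tip v')) = (g \<circ> r) (Left_bud_tip v')"
      "rot X ((g \<circ> r) (Right_bud_tip v')) = (g \<circ> r) (Right_bud_tip v')"
      using X(2)[of "Left_bud_tip v"] X(2)[of "Right_bud_tip v"] v(1)
      by (simp_all add: r_def flip: v_def)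
    have sub: "set (bl v) \<subseteq> E" "set (rl v) \<subseteq> E" using C v by (auto simp: colored_graph_def)
    have ar: "map r (around bl' rl' v') = around bl rl v"
      using l[OF v(1)] v sub inv by (auto simp: around_def r_def comp_def subset_iff map_idI)
    fix k assume k: "k < length (around bl' rl' v')"
    have len: "length (around bl' rl' v') = length (around bl rl v)"
      using arg_cong[OF ar, of length] by simp
    have k': "Suc k mod length (around bl rl v) < length (around bl rl v)"
      using k len by (intro mod_less_divisor) auto
    have nth: "r (around bl' rl' v' ! m) = around bl rl v ! m" if "m < length (around bl rl v)" for m
      using arg_cong[OF ar, of "\<lambda>l. l ! m"] that len by simp
    have "around bl rl v ! k \<in> labels V E" using around_labels[OF C v(1)] k len by auto
    from X(2)[OF this] show "rot X ((g \<circ> r) (around bl' rl' v' ! k)) =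
        (g \<circ> r) (around bl' rl' v' ! (Suc k mod length (around bl' rl' v')))"
      using nth[of k] nth[OF k'] k len label_rot_nth[OF C v(1), of k] by simp
  qed
  then show thesis using that by blast
qed

text \<open>A strictly sorted list is determined by its set, so the orders kept by
  \<open>arcs_ordered\<close> are the ones read off the drawing.\<close>

lemma diagram_of_lists:
  assumes C: "colored_graph V E bv rv bl rl" and D: "diag V E bv rv x y"
    and O: "arcs_ordered V bl rl y" and v: "v \<in> V"
  shows "blue_list (diagram_of E bv rv x y) (real (x v)) = map (\<lambda>e. white (y e)) (bl v)"
    and "red_list (diagram_of E bv rv x y) (real (x v)) = map (\<lambda>e. white (y e)) (rl v)"
proof -
  let ?M = "diagram_of E bv rv x y"
  have inj: "x u = x v \<longleftrightarrow> u = v" if "u \<in> V" for u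
    using diag_bij(1)[OF D] that v by (auto simp: bij_betw_def dest: inj_onD)
  have sets: "set (bl v) = {e \<in> E. bv e = v}" "set (rl v) = {e \<in> E. rv e = v}"
    using C v unfolding colored_graph_def by blast+
  have "{w. (real (x v), w) \<in> upper_arcs ?M} = (\<lambda>e. white (y e)) ` set (bl v)"
    "{w. (w, real (x v)) \<in> lower_arcs ?M} = (\<lambda>e. white (y e)) ` set (rl v)"
    unfolding sets using inj diag_arc[OF D] by (force simp: diagram_of_def)+
  then have s: "{w. (real (x v), w) \<in> upper_arcs ?M} = set (map (\<lambda>e. white (y e)) (bl v))"
    "{w. (w, real (x v)) \<in> lower_arcs ?M} = set (rev (map (\<lambda>e. white (y e)) (rl v)))"
    by simp_all
  have o: "sorted_wrt (<) (map y (bl v))" "sorted_wrt (>) (map y (rl v))"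
    using O v by (auto simp: arcs_ordered_def)
  have "sorted_wrt (<) (map (\<lambda>e. white (y e)) (bl v))"
    "sorted_wrt (<) (rev (map (\<lambda>e. white (y e)) (rl v)))"
    using o by (simp_all add: sorted_wrt_map sorted_wrt_rev)
  then have "sorted_list_of_set (set (map (\<lambda>e. white (y e)) (bl v))) = map (\<lambda>e. white (y e)) (bl v)"
    "sorted_list_of_set (set (rev (map (\<lambda>e. white (y e)) (rl v)))) = rev (map (\<lambda>e. white (y e)) (rl v))"
    using sorted_list_of_set.idem_if_sorted_distinct strict_sorted_iff by blast+
  then show "blue_list ?M (real (x v)) = map (\<lambda>e. white (y e)) (bl v)"
    "red_list ?M (real (x v)) = map (\<lambda>e. white (y e)) (rl v)"
    unfolding blue_list_def red_list_def s by simp_all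
qed

lemma gamma_surj:
  assumes "B \<in> bicolored_blossoming_trees n"
  shows "B \<in> gamma ` meandering_trees n"
proof -
  obtain X :: "nat half_edge_map" where X: "blossoming_tree X" "bicolored X" "card (plain_edges X) = n" "B = iso_class X"
    using assms unfolding bicolored_blossoming_trees_def by blast
  interpret b: bicolored_blossoming X using X by unfold_locales
  interpret r: realization b.V b.E b.bv b.rv b.bl b.rl b.half X by (rule b.realization_half)
  have n: "card b.E = n" using X(3) r.card_plain_edges by simp
  obtain x y where D: "diag b.V b.E b.bv b.rv x y" and O: "arcs_ordered b.V b.bl b.rl y"
    using arrangement_exists[OF r.C r.T] by blast
  define M where "M = diagram_of b.E b.bv b.rv x y"
  have M: "M \<in> meandering_trees n"
    unfolding M_def n[symmetric] by (rule diagram_of_tree[OF D r.T])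
  note DM = meandering_treeD(1)[OF M]
  note CM = diagram_colored_graph[OF DM]
  have lists: "blue_list M (real (x v)) = map (\<lambda>e. white (y e)) (b.bl v) \<and>
      red_list M (real (x v)) = map (\<lambda>e. white (y e)) (b.rl v)" if "v \<in> b.V" for v
    unfolding M_def using diagram_of_lists[OF r.C D O that] by simp
  obtain g where "realizes (black_points n) (white_points n) (blue_end M) (red_end M) (blue_list M)
      (red_list M) g X"
    using realizes_relabel[OF r.C CM diagram_of_black_bij[OF D, unfolded n]
        diagram_of_white_bij[OF D, unfolded n] lists r.R] .
  then have "gamma M = B"
    unfolding gamma_def X(4) using iso_class_eq[OF CM gamma_map_realizes[OF DM]] by blast
  then show ?thesis using M by blast
qed

section \<open>Tamari intervals and meandering trees\<close>

lemma phi_eq_diagram_of: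
  assumes "size T = n" "size T' = n"
  shows "phi (T, T') = diagram_of {1..n} (leftmost T') (rightmost T) id id"
proof -
  have "real t - 1 - real (left_size T' t) = real (leftmost T' t)" if "1 \<le> t" "t \<le> n" for t
    using left_size_less[of t T'] that assms by (simp add: leftmost_def of_nat_diff)
  then show ?thesis
    using assms by (auto simp: phi_def diagram_of_def white_def rightmost_def intro!: image_cong)
qed

lemma tamari_diag:
  assumes "size T = n" "size T' = n"
  shows "diag {0..n} {1..n} (leftmost T') (rightmost T) id id"
  unfolding diag_def
proof (intro conjI ballI)
  fix s assume s: "s \<in> {1..n}"
  then show "leftmost T' s \<in> {0..n}" "id (leftmost T' s) < id s"
    using leftmost_less[of s T'] by auto
  show "rightmost T s \<in> {0..n}" "id s \<le> id (rightmost T s)"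
    using s rightmost_le[of s T] rightmost_ge[of s T] assms by auto
  fix t assume t: "t \<in> {1..n}"
  show "\<not> (id (leftmost T' s) < id (leftmost T' t) \<and> id (leftmost T' t) < id s \<and> id s < id t)"
    "\<not> (id s < id t \<and> id t \<le> id (rightmost T s) \<and> id (rightmost T s) < id (rightmost T t))"
    using s t assms leftmost_noncrossing[of s t T'] rightmost_noncrossing[of s t T] by auto
qed (auto simp: bij_betw_def)

lemma phi_in_meandering_trees:
  assumes "I \<in> tamari_intervals n"
  shows "phi I \<in> meandering_trees n"
proof -
  obtain T T' where I: "I = (T, T')" "size T = n" "size T' = n" "tamari_le T T'"
    using assms by (auto simp: tamari_intervals_def binary_trees_def)
  note D = tamari_diag[OF I(2,3)]
  have "no_conflict {1..n} (leftmost T') (rightmost T) id id"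
    using I tamari_le_iff_no_conflict[of T T'] by (auto simp: no_conflict_def)
  then have "is_tree {0..n} {1..n} (\<lambda>t. {leftmost T' t, rightmost T t})"
    using no_conflict_tree[OF D] by simp
  from diagram_of_tree[OF D this] show ?thesis
    using phi_eq_diagram_of[OF I(2,3)] I(1) by simp
qed

text \<open>The ends of the upper arcs give back \<open>leftmost T'\<close> and those of the lower
  arcs \<open>rightmost T\<close>, and each of these determines its tree.\<close>

lemma phi_inj: "inj_on phi (tamari_intervals n)"
proof
  fix I J assume "I \<in> tamari_intervals n" "J \<in> tamari_intervals n" and eq: "phi I = phi J"
  then obtain T T' S S' where I: "I = (T, T')" "size T = n" "size T' = n"
    and J: "J = (S, S')" "size S = n" "size S' = n"
    by (auto simp: tamari_intervals_def binary_trees_def)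
  have d: "diagram_of {1..n} (leftmost T') (rightmost T) id id =
      diagram_of {1..n} (leftmost S') (rightmost S) id id"
    using eq I J phi_eq_diagram_of by simp
  have "leftmost T' t = leftmost S' t \<and> rightmost T t = rightmost S t" if "1 \<le> t" "t \<le> n" for t
  proof -
    have t: "t \<in> {1..n}" using that by simp
    show ?thesis
      using diagram_of_ends[OF tamari_diag[OF I(2,3)] t] diagram_of_ends[OF tamari_diag[OF J(2,3)] t]
      unfolding d by simp
  qed
  then show "I = J"
    using I J leftmost_inject[of T' S'] rightmost_inject[of T S] by auto
qed

text \<open>Upper and lower arcs are each non-crossing and so come from binary trees
  \<open>T'\<close> and \<open>T\<close>; a tree has no conflicts, which makes this pair an
  interval.\<close>

lemma phi_surj:
  assumes "M \<in> meandering_trees n"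
  shows "M \<in> phi ` tamari_intervals n"
proof -
  note M = meandering_treeD[OF assms]
  note D = diagram_diag[OF M(1)]
  define b where "b t = black_index (blue_end M (white t))" for t
  define r where "r t = black_index (red_end M (white t))" for t
  have w: "white t \<in> white_points n" if "1 \<le> t" "t \<le> n" for t
    using that by (auto simp: white_points_eq)
  have br: "b t < t" "t \<le> r t" "r t \<le> n" if "1 \<le> t" "t \<le> n" for t
    using diag_arc[OF D w[OF that]] diag_range(1)[OF D, of "red_end M (white t)"] that
    by (auto simp: b_def r_def white_card)
  have cross: "\<not> (b s < b t \<and> b t < s \<and> s < t)" "\<not> (s < t \<and> t \<le> r s \<and> r s < r t)"
    "\<not> (s < t \<and> t \<le> r s \<and> b t < s)" if st: "1 \<le> s" "t \<le> n" for s t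
  proof -
    have "\<not> (b s < b t \<and> b t < s \<and> s < t) \<and> \<not> (s < t \<and> t \<le> r s \<and> r s < r t) \<and>
        \<not> (s < t \<and> t \<le> r s \<and> b t < s)" if "s < t"
    proof -
      have st': "1 \<le> s" "s \<le> n" "1 \<le> t" "t \<le> n" using st \<open>s < t\<close> by auto
      have "no_conflict (white_points n) (blue_end M) (red_end M) black_index white_index"
        by (rule tree_no_conflict[OF D M(2)])
      then show ?thesis
        using D w[OF st'(1,2)] w[OF st'(3,4)] white_index[OF st'(1)] white_index[OF st'(3)]
        unfolding diag_def no_conflict_def b_def r_def by metis
    qed
    then show "\<not> (b s < b t \<and> b t < s \<and> s < t)" "\<not> (s < t \<and> t \<le> r s \<and> r s < r t)"
      "\<not> (s < t \<and> t \<le> r s \<and> b t < s)" by blast+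
  qed
  have "\<exists>T'. size T' = n \<and> (\<forall>t. 1 \<le> t \<and> t \<le> n \<longrightarrow> leftmost T' t = b t)"
    by (rule exists_leftmost) (use br cross in auto)
  then obtain T' where T': "size T' = n" "\<And>t. 1 \<le> t \<Longrightarrow> t \<le> n \<Longrightarrow> leftmost T' t = b t" by blast
  have "\<exists>T. size T = n \<and> (\<forall>t. 1 \<le> t \<and> t \<le> n \<longrightarrow> rightmost T t = r t)"
    by (rule exists_rightmost) (use br cross in auto)
  then obtain T where T: "size T = n" "\<And>t. 1 \<le> t \<Longrightarrow> t \<le> n \<Longrightarrow> rightmost T t = r t" by blast
  have "tamari_le T T'"
    using T T' cross(3) tamari_le_iff_no_conflict[of T T'] by auto
  then have I: "(T, T') \<in> tamari_intervals n"
    using T(1) T'(1) by (simp add: tamari_intervals_def binary_trees_def)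
  have "M = phi (T, T')"
  proof (rule diagram_eqI[OF M(1)])
    show "meandering_diagram n (phi (T, T'))" by (rule meandering_treeD(1)[OF phi_in_meandering_trees[OF I]])
    fix v assume v: "v \<in> white_points n"
    then obtain t where t: "1 \<le> t" "t \<le> n" "v = white t" by (auto simp: white_points_eq)
    have "blue_end M v = real (b t)" "red_end M v = real (r t)"
      using arc_ends[OF M(1) v] t by (auto simp: b_def r_def elim!: black_pointE)
    moreover have "blue_end (phi (T, T')) v = real (b t)" "red_end (phi (T, T')) v = real (r t)"
      using diagram_of_ends[OF tamari_diag[OF T(1) T'(1)], of t] t T T'
      by (simp_all add: phi_eq_diagram_of)
    ultimately show "blue_end M v = blue_end (phi (T, T')) v \<and> red_end M v = red_end (phi (T, T')) v"
      by simp
  qed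
  then show ?thesis using I by blast
qed

theorem theorem4p1:
  fixes n :: nat
  assumes "n \<ge> 1"
  shows "phi ` tamari_intervals n \<subseteq> meandering_trees n \<and>
         bij_betw Phi (tamari_intervals n) (bicolored_blossoming_trees n)"
proof
  show sub: "phi ` tamari_intervals n \<subseteq> meandering_trees n" using phi_in_meandering_trees by blast
  then have "bij_betw phi (tamari_intervals n) (meandering_trees n)"
    using phi_inj phi_surj unfolding bij_betw_def by blast
  moreover have "bij_betw gamma (meandering_trees n) (bicolored_blossoming_trees n)"
    using gamma_inj[OF assms] gamma_surj gamma_in_bicolored_blossoming_trees[OF _ assms]
    unfolding bij_betw_def by blast
  ultimately show "bij_betw Phi (tamari_intervals n) (bicolored_blossoming_trees n)"
    unfolding Phi_def by (rule bij_betw_trans)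
qed

end
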